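(* For every $c\ge1$, there is an $(n,k,ck)$-splitter of size $O\big(e^{\frac{k}{c}(1+o(1))}\log n\big)$ that can be constructed deterministically in time $2^{9k}n^{O(1)}$.
   Context: For positive integers $n,k,\ell$, an $(n,k,\ell)$-splitter is a family $H$ of functions $f:[n]\to[\ell]$ such that for every set $S\subseteq[n]$ with $|S|=k$ there is $f\in H$ with $\lfloor k/\ell\rfloor\le|f^{-1}(j)\cap S|\le\lceil k/\ell\rceil$ for all $j\in[\ell]$ (for $\ell\ge k$ this means $f$ is injective on $S$). Here $ck$ is an integer and the $o(1)$ is as $k\to\infty$. *)

theory Defs
  imports Complex_Main "HOL-Library.FuncSet" "HOL-Library.Log_Nat"
begin

definition splitter :: "nat \<Rightarrow> nat \<Rightarrow> nat \<Rightarrow> (nat \<Rightarrow> nat) set \<Rightarrow> bool" where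
  "splitter n k l H \<longleftrightarrow>
     H \<subseteq> ({1..n} \<rightarrow>\<^sub>E {1..l}) \<and>
     (\<forall>S. S \<subseteq> {1..n} \<and> card S = k \<longrightarrow>
       (\<exists>f\<in>H. \<forall>j\<in>{1..l}.
          \<lfloor>real k / real l\<rfloor> \<le> int (card (f -` {j} \<inter> S)) \<and>
          int (card (f -` {j} \<inter> S)) \<le> \<lceil>real k / real l\<rceil>))"

text \<open>
  Model of computation: the random access machine with logarithmic cost of Aho, Hopcroft
  and Ullman, with structured control flow instead of jumps.  Registers hold natural numbers
  and are addressed by natural numbers; subtraction is truncated, and division is integer
  division with \<open>x div 0 = 0\<close>.  There is a write-only output tape.
\<close>

datatype loc =
    Dir nat \<comment> \<open>the register with this address\<close>
  | Ind nat \<comment> \<open>the register whose address is stored in the register with this address\<close>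

datatype operand = Const nat | At loc

datatype arith = Add | Sub | Mul | Div

datatype com =
    Skip
  | Move loc operand
  | Arith loc arith operand operand
  | Write operand
  | Seq com com
  | Cond operand com com \<comment> \<open>branches on whether the operand is nonzero\<close>
  | While operand com \<comment> \<open>loops as long as the operand is nonzero\<close>

type_synonym mem = "nat \<Rightarrow> nat"

type_synonym state = "mem \<times> nat list"

fun address :: "mem \<Rightarrow> loc \<Rightarrow> nat" where
  "address m (Dir i) = i"
| "address m (Ind i) = m i"

fun fetch :: "mem \<Rightarrow> operand \<Rightarrow> nat" where
  "fetch m (Const a) = a"
| "fetch m (At x) = m (address m x)"

fun apply_arith :: "arith \<Rightarrow> nat \<Rightarrow> nat \<Rightarrow> nat" where
  "apply_arith Add a b = a + b"
| "apply_arith Sub a b = a - b"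
| "apply_arith Mul a b = a * b"
| "apply_arith Div a b = a div b"

text \<open>The number of binary digits of a number, where 0 has one digit.\<close>

definition digits :: "nat \<Rightarrow> nat" where
  "digits a = max 1 (floorlog 2 a)"

fun address_cost :: "mem \<Rightarrow> loc \<Rightarrow> nat" where
  "address_cost m (Dir i) = digits i"
| "address_cost m (Ind i) = digits i + digits (m i)"

fun operand_cost :: "mem \<Rightarrow> operand \<Rightarrow> nat" where
  "operand_cost m (Const a) = digits a"
| "operand_cost m (At x) = address_cost m x + digits (m (address m x))"

text \<open>\<open>exec P s t s'\<close>: started in \<open>s\<close>, the program \<open>P\<close> halts in \<open>s'\<close> at total cost \<open>t\<close>.\<close>

inductive exec :: "com \<Rightarrow> state \<Rightarrow> nat \<Rightarrow> state \<Rightarrow> bool" where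
  Skip: "exec Skip s 1 s"
| Move: "exec (Move x a) (m, out) (address_cost m x + operand_cost m a)
           (m(address m x := fetch m a), out)"
| Arith: "exec (Arith x h a b) (m, out)
            (address_cost m x + operand_cost m a + operand_cost m b)
            (m(address m x := apply_arith h (fetch m a) (fetch m b)), out)"
| Write: "exec (Write a) (m, out) (operand_cost m a) (m, out @ [fetch m a])"
| Seq: "exec P s t s' \<Longrightarrow> exec Q s' u s'' \<Longrightarrow> exec (Seq P Q) s (t + u) s''"
| CondTrue: "fetch m a \<noteq> 0 \<Longrightarrow> exec P (m, out) t s \<Longrightarrow>
    exec (Cond a P Q) (m, out) (operand_cost m a + t) s"
| CondFalse: "fetch m a = 0 \<Longrightarrow> exec Q (m, out) t s \<Longrightarrow>
    exec (Cond a P Q) (m, out) (operand_cost m a + t) s"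
| WhileTrue: "fetch m a \<noteq> 0 \<Longrightarrow> exec P (m, out) t s \<Longrightarrow> exec (While a P) s u s' \<Longrightarrow>
    exec (While a P) (m, out) (operand_cost m a + t + u) s'"
| WhileFalse: "fetch m a = 0 \<Longrightarrow>
    exec (While a P) (m, out) (operand_cost m a) (m, out)"

inductive_cases SkipE: "exec Skip s t s'"
inductive_cases MoveE: "exec (Move x a) s t s'"
inductive_cases ArithE: "exec (Arith x h a b) s t s'"
inductive_cases WriteE: "exec (Write a) s t s'"
inductive_cases SeqE: "exec (Seq P Q) s t s'"
inductive_cases CondE: "exec (Cond a P Q) s t s'"
inductive_cases WhileE: "exec (While a P) s t s'"

lemma exec_deterministic:
  "exec P s t s' \<Longrightarrow> exec P s u s'' \<Longrightarrow> u = t \<and> s'' = s'"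
proof (induction arbitrary: u s'' rule: exec.induct)
  case Skip then show ?case by (auto elim: SkipE)
next
  case Move then show ?case by (auto elim: MoveE)
next
  case Arith then show ?case by (auto elim: ArithE)
next
  case Write then show ?case by (auto elim: WriteE)
next
  case Seq then show ?case by (blast elim: SeqE)
next
  case CondTrue then show ?case by (fastforce elim: CondE)
next
  case CondFalse then show ?case by (fastforce elim: CondE)
next
  case (WhileTrue m a P out t s v s')
  from WhileTrue.prems WhileTrue.hyps(1) obtain t1 s1 v1
    where "exec P (m, out) t1 s1" "exec (While a P) s1 v1 s''"
      "u = operand_cost m a + t1 + v1"
    by (auto elim: WhileE)
  with WhileTrue.IH show ?case by blast
next
  case WhileFalse then show ?case by (auto elim: WhileE)
qed

text \<open>The parameters are given in registers 0, 1 and 2; all other registers are 0.\<close>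

definition initial :: "nat \<Rightarrow> nat \<Rightarrow> nat \<Rightarrow> state" where
  "initial n k l = ((\<lambda>_. 0)(0 := n, 1 := k, 2 := l), [])"

text \<open>
  A family of functions on \<open>{1..n}\<close>, listed as \<open>fs\<close>, is output as the concatenation of the
  value tables of its members.
\<close>

definition value_tables :: "nat \<Rightarrow> (nat \<Rightarrow> nat) list \<Rightarrow> nat list" where
  "value_tables n fs = concat (map (\<lambda>f. map f [1..<Suc n]) fs)"

end

(*
  Fix s = floor (sqrt k) and q = 4 k^2.  A member of the splitter is a composition of two maps.
  The first, from {1..n} to a set of size q, is one of O(k^2 log n) hash functions chosen greedily:
  each new value minimises the exponentially weighted number of collisions with the pairs seen so
  far, which keeps every pair from colliding in more than a 1 / k^2 fraction of the functions, so
  that every k-subset is injected by some function.  The second map cuts the q points into b = k div s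
  intervals, guesses the cuts and k mod s special points by brute force, and colours each interval
  with its own m = (l - k mod s) div b colours by a function that is injective on the s relevant
  points.  These functions come from a greedy cover of all s-tuples by the method of conditional
  expectations.  A random function is injective on s points with probability at least
  exp (- s^2 / m), so the b independent choices cost exp (b s^2 / m) = exp (k / c (1 + o(1))), and
  everything else is exp (o(k)) since there are only O(sqrt k) guesses and intervals.  The tuples
  number q^s = exp (o(k)), hence the cover is found in time exp (o(k)).
*)
theory Submission imports Defs "HOL-Real_Asymp.Real_Asymp" begin

section \<open>Programs that evaluate nested loops\<close>


text \<open>Covering all \<open>k\<close>-tuples over \<open>q\<close> points at once would mean
  handling \<open>q ^ k\<close> tuples, which is not \<open>exp (O(k))\<close>. Working with
  \<open>s\<close> points at a time brings this down to \<open>q ^ s\<close>, and the main term does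
  not suffer: \<open>m\<close> is about \<open>c * k / b\<close> and \<open>b * s\<close> about
  \<open>k\<close>, so \<open>b * s^2 / m\<close> is about \<open>(b * s)^2 / (c * k)\<close>, that
  is \<open>k / c\<close>. Much longer intervals would bring back too many tuples, much shorter ones
  too many cuts to guess. Only the hash functions see \<open>n\<close>, so the logarithm of
  \<open>n\<close> enters once and is not raised to the power \<open>b\<close>. The allowance
  \<open>2 ^ (9 * k)\<close> is generous: the number of functions grows like
  \<open>exp (k / c)\<close> with \<open>c \<ge> 1\<close>, and all other costs fit into
  \<open>exp (o(k))\<close> times a fixed power of \<open>n\<close>. Under logarithmic cost an
  operation is charged by bit length, so a whole table may sit in one register. All cost estimates
  then reduce to one number \<beta> that bounds bit lengths and loop lengths: a value computed by a
  fixed nest of loops costs a fixed power of \<beta>, and only the output loop runs longer.\<close>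

type_synonym code = "nat \<Rightarrow> com"

type_synonym world = "nat \<times> mem"

text \<open>A Kripke-style order on machine states: a later world has a stack at least as high and
  agrees on everything below the earlier stack pointer. Code that reads only from there keeps its
  value, so facts about code can be carried under further bindings.\<close>

definition extends :: "world \<Rightarrow> world \<Rightarrow> bool" (infix "\<preceq>" 50) where
  "w \<preceq> w' \<longleftrightarrow> fst w \<le> fst w' \<and> (\<forall>i<fst w. snd w' i = snd w i)"

text \<open>
  Code is indexed by the first free register \<open>d\<close>: it leaves its result in \<open>d\<close> and preserves all
  registers below, so that registers above serve as a stack.  Here \<open>\<beta>\<close> bounds the binary digits of
  all values and the number of rounds of every loop, and \<open>j\<close> grows with the nesting depth.
\<close>

definition computes :: "nat \<Rightarrow> world \<Rightarrow> code \<Rightarrow> nat \<Rightarrow> nat \<Rightarrow> bool" where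
  "computes \<beta> w c v j \<longleftrightarrow> v < 2 ^ \<beta> \<and>
     (\<forall>d m out. w \<preceq> (d, m) \<and> d + 4 * j + 64 \<le> \<beta> \<longrightarrow>
       (\<exists>t m'. exec (c d) (m, out) t (m', out) \<and> m' d = v \<and> (\<forall>i<d. m' i = m i) \<and> t \<le> \<beta> ^ (j + 2)))"

lemma extends_refl: "w \<preceq> w"
  by (simp add: extends_def)

lemma extends_trans: "u \<preceq> v \<Longrightarrow> v \<preceq> w \<Longrightarrow> u \<preceq> w"
  by (auto simp: extends_def)

lemma extends_memory:
  "w \<preceq> (d, m) \<Longrightarrow> d \<le> d' \<Longrightarrow> (\<And>i. i < d \<Longrightarrow> m' i = m i) \<Longrightarrow> w \<preceq> (d', m')"
  by (auto simp: extends_def)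

lemma digits_le: "v < 2 ^ \<beta> \<Longrightarrow> 0 < \<beta> \<Longrightarrow> digits v \<le> \<beta>"
  by (cases "v = 0") (auto simp: digits_def floorlog_leI floorlog_le_iff)

lemma computes_bound: "computes \<beta> w c v j \<Longrightarrow> v < 2 ^ \<beta>"
  by (simp add: computes_def)

lemma computes_exec:
  assumes "computes \<beta> w c v j" "w \<preceq> (d, m)" "d + 4 * j + 64 \<le> \<beta>"
  obtains t m' where "exec (c d) (m, out) t (m', out)" "m' d = v" "\<And>i. i < d \<Longrightarrow> m' i = m i"
    "t \<le> \<beta> ^ (j + 2)"
proof -
  have "\<exists>t m'. exec (c d) (m, out) t (m', out) \<and> m' d = v \<and> (\<forall>i<d. m' i = m i) \<and> t \<le> \<beta> ^ (j + 2)"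
    using assms(1)[unfolded computes_def] assms(2,3) by simp
  then show thesis using that by blast
qed

lemma computesI:
  assumes "v < 2 ^ \<beta>"
    "\<And>d m out. w \<preceq> (d, m) \<Longrightarrow> d + 4 * j + 64 \<le> \<beta> \<Longrightarrow>
       \<exists>t m'. exec (c d) (m, out) t (m', out) \<and> m' d = v \<and> (\<forall>i<d. m' i = m i) \<and> t \<le> \<beta> ^ (j + 2)"
  shows "computes \<beta> w c v j"
  using assms unfolding computes_def by blast

lemma computes_mono:
  assumes "computes \<beta> w c v j" "w \<preceq> w'" "j \<le> j'"
  shows "computes \<beta> w' c v j'"
proof (rule computesI)
  show "v < 2 ^ \<beta>" using assms(1) by (rule computes_bound)
  fix d m out assume a: "w' \<preceq> (d, m)" "d + 4 * j' + 64 \<le> \<beta>"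
  obtain t m' where "exec (c d) (m, out) t (m', out)" "m' d = v" "\<And>i. i < d \<Longrightarrow> m' i = m i"
    "t \<le> \<beta> ^ (j + 2)"
    using assms a extends_trans[OF assms(2)] by (elim computes_exec[where d = d and m = m and out = out]) auto
  moreover have "\<beta> ^ (j + 2) \<le> \<beta> ^ (j' + 2)"
    using a assms(3) by (intro power_increasing) auto
  then have "t \<le> \<beta> ^ (j' + 2)" using \<open>t \<le> \<beta> ^ (j + 2)\<close> by (rule order_trans[rotated])
  ultimately show "\<exists>t m'. exec (c d) (m, out) t (m', out) \<and> m' d = v \<and> (\<forall>i<d. m' i = m i) \<and> t \<le> \<beta> ^ (j' + 2)"
    by (intro exI[of _ t] exI[of _ m']) auto
qed

lemma computes_extend: "computes \<beta> w c v j \<Longrightarrow> w \<preceq> w' \<Longrightarrow> computes \<beta> w' c v j"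
  using computes_mono by blast

lemma computes_conv: "computes \<beta> w c v j \<Longrightarrow> v = v' \<Longrightarrow> j \<le> j' \<Longrightarrow> computes \<beta> w c v' j'"
  using computes_mono extends_refl by blast

definition cst :: "nat \<Rightarrow> code" where
  "cst a d = Move (Dir d) (Const a)"

definition var :: "nat \<Rightarrow> code" where
  "var i d = Move (Dir d) (At (Dir i))"

definition opr :: "arith \<Rightarrow> code \<Rightarrow> code \<Rightarrow> code" where
  "opr h x y d = Seq (x d) (Seq (y (Suc d)) (Arith (Dir d) h (At (Dir d)) (At (Dir (Suc d)))))"

definition ite :: "code \<Rightarrow> code \<Rightarrow> code \<Rightarrow> code" where
  "ite x y z d = Seq (x d) (Cond (At (Dir d)) (y d) (z d))"

text \<open>Binding by higher-order abstract syntax: the body is a function on code and receives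
  \<open>var d\<close>, which rereads the saved value from a fixed register however deep it is used.
  Substituting the code of \<open>x\<close> itself would recompute it at each use.\<close>

definition bind :: "code \<Rightarrow> (code \<Rightarrow> code) \<Rightarrow> code" where
  "bind x B d = Seq (x d) (Seq (B (var d) (Suc d)) (Move (Dir d) (At (Dir (Suc d)))))"

text \<open>Register \<open>d\<close> counts the remaining rounds down, \<open>d + 1\<close> holds
  the accumulator, and \<open>d + 2\<close> counts up and serves as the index given to the
  body.\<close>

definition iter_body :: "(code \<Rightarrow> code \<Rightarrow> code) \<Rightarrow> code" where
  "iter_body B d =
     Seq (B (var (d + 1)) (var (d + 2)) (d + 3))
    (Seq (Move (Dir (d + 1)) (At (Dir (d + 3))))
    (Seq (Arith (Dir (d + 2)) Add (At (Dir (d + 2))) (Const 1))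
         (Arith (Dir d) Sub (At (Dir d)) (Const 1))))"

definition iter :: "code \<Rightarrow> code \<Rightarrow> (code \<Rightarrow> code \<Rightarrow> code) \<Rightarrow> code" where
  "iter x y B d =
     Seq (x d)
    (Seq (y (d + 1))
    (Seq (Move (Dir (d + 2)) (Const 0))
    (Seq (While (At (Dir d)) (iter_body B d))
         (Move (Dir d) (At (Dir (d + 1)))))))"

lemma less_two_power: "d + 64 \<le> \<beta> \<Longrightarrow> i \<le> d + 3 \<Longrightarrow> i < 2 ^ \<beta>" for i :: nat
  using less_exp[of \<beta>] by linarith

lemma digits_address: "d + 64 \<le> \<beta> \<Longrightarrow> i \<le> d + 3 \<Longrightarrow> digits i \<le> \<beta>"
  by (rule digits_le[OF less_two_power]) auto

lemma computes_cst: "a < 2 ^ \<beta> \<Longrightarrow> computes \<beta> w (cst a) a 0"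
proof (rule computesI)
  fix d m out assume a: "a < 2 ^ \<beta>" and "w \<preceq> (d, m)" "d + 4 * 0 + 64 \<le> \<beta>"
  then have b: "d + 64 \<le> \<beta>" by simp
  have "digits d + digits a \<le> 2 * \<beta>"
    using digits_address[OF b, of d] digits_le[OF a] b by simp
  also have "\<dots> \<le> \<beta> * \<beta>" using b by (intro mult_right_mono) auto
  finally have "digits d + digits a \<le> \<beta> ^ (0 + 2)" by (simp add: power2_eq_square)
  then show "\<exists>t m'. exec (cst a d) (m, out) t (m', out) \<and> m' d = a \<and> (\<forall>i<d. m' i = m i) \<and> t \<le> \<beta> ^ (0 + 2)"
    using exec.Move[of "Dir d" "Const a" m out]
    by (intro exI[of _ "digits d + digits a"] exI[of _ "m(d := a)"]) (auto simp: cst_def)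
qed

lemma computes_var: "m i < 2 ^ \<beta> \<Longrightarrow> i < d \<Longrightarrow> computes \<beta> (d, m) (var i) (m i) 0"
proof (rule computesI)
  fix d' m' out assume a: "m i < 2 ^ \<beta>" and e: "(d, m) \<preceq> (d', m')" and i: "i < d" and "d' + 4 * 0 + 64 \<le> \<beta>"
  then have b: "d' + 64 \<le> \<beta>" by simp
  have eq: "m' i = m i" "i < d'" using e i by (auto simp: extends_def)
  have "digits d' + (digits i + digits (m i)) \<le> 3 * \<beta>"
    using digits_address[OF b, of d'] digits_address[OF b, of i] digits_le[OF a] b eq by simp
  also have "\<dots> \<le> \<beta> * \<beta>" using b by (intro mult_right_mono) auto
  finally have "digits d' + (digits i + digits (m i)) \<le> \<beta> ^ (0 + 2)" by (simp add: power2_eq_square)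
  then show "\<exists>t m''. exec (var i d') (m', out) t (m'', out) \<and> m'' d' = m i \<and> (\<forall>i<d'. m'' i = m' i) \<and> t \<le> \<beta> ^ (0 + 2)"
    using exec.Move[of "Dir d'" "At (Dir i)" m' out] eq
    by (intro exI[of _ "digits d' + (digits i + digits (m i))"] exI[of _ "m'(d' := m i)"]) (auto simp: var_def)
qed

text \<open>Two subprograms and a bounded number of elementary steps cost at most
  \<open>10 * \<beta> ^ (j + 2)\<close>, and \<open>64 \<le> \<beta>\<close> absorbs the constant
  into one more factor. Hence each loop-free constructor raises the depth by one.\<close>

lemma time_bound:
  fixes \<beta> j :: nat
  assumes "64 \<le> \<beta>" "a \<le> \<beta> ^ (j + 2)" "b \<le> \<beta> ^ (j + 2)" "c \<le> 8 * \<beta>"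
  shows "a + (b + c) \<le> \<beta> ^ (Suc j + 2)"
proof -
  have "8 * \<beta> \<le> 8 * \<beta> ^ (j + 2)"
    using assms(1) self_le_power[of \<beta> "j + 2"] by simp
  then have "a + (b + c) \<le> 10 * \<beta> ^ (j + 2)" using assms by linarith
  also have "\<dots> \<le> \<beta> * \<beta> ^ (j + 2)" using assms(1) by (intro mult_right_mono) auto
  finally show ?thesis by simp
qed

lemma computes_opr:
  assumes "computes \<beta> w x v j" "computes \<beta> w y u j'" "apply_arith h v u < 2 ^ \<beta>"
  shows "computes \<beta> w (opr h x y) (apply_arith h v u) (Suc (max j j'))"
proof (rule computesI)
  show "apply_arith h v u < 2 ^ \<beta>" by fact
  let ?j = "max j j'"
  have x: "computes \<beta> w x v ?j" and y: "computes \<beta> w y u ?j"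
    using assms(1,2) by (auto elim: computes_conv)
  fix d m out assume e: "w \<preceq> (d, m)" and "d + 4 * Suc ?j + 64 \<le> \<beta>"
  then have d: "d + 4 * ?j + 64 \<le> \<beta>" "Suc d + 4 * ?j + 64 \<le> \<beta>" "d + 64 \<le> \<beta>" by auto
  obtain t1 m1 where 1: "exec (x d) (m, out) t1 (m1, out)" "m1 d = v" "\<And>i. i < d \<Longrightarrow> m1 i = m i"
    "t1 \<le> \<beta> ^ (?j + 2)" using computes_exec[OF x e d(1)] by blast
  have "w \<preceq> (Suc d, m1)" using extends_memory[OF e _ 1(3)] by simp
  then obtain t2 m2 where 2: "exec (y (Suc d)) (m1, out) t2 (m2, out)" "m2 (Suc d) = u"
    "\<And>i. i < Suc d \<Longrightarrow> m2 i = m1 i" "t2 \<le> \<beta> ^ (?j + 2)"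
    using computes_exec[OF y _ d(2)] by blast
  have v: "m2 d = v" using 1 2 by simp
  let ?t3 = "digits d + (digits d + digits v) + (digits (Suc d) + digits u)"
  have 3: "exec (Arith (Dir d) h (At (Dir d)) (At (Dir (Suc d)))) (m2, out) ?t3
      (m2(d := apply_arith h v u), out)"
    using exec.Arith[of "Dir d" h "At (Dir d)" "At (Dir (Suc d))" m2 out] v 2 by simp
  have "?t3 \<le> 8 * \<beta>"
    using digits_address[OF d(3), of d] digits_address[OF d(3), of "Suc d"]
      digits_le[OF computes_bound[OF x]] digits_le[OF computes_bound[OF y]] d by simp
  then have "t1 + (t2 + ?t3) \<le> \<beta> ^ (Suc ?j + 2)"
    using 1 2 d by (intro time_bound) auto
  moreover have "exec (opr h x y d) (m, out) (t1 + (t2 + ?t3)) (m2(d := apply_arith h v u), out)"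
    unfolding opr_def using 1(1) 2(1) 3 by (intro exec.Seq)
  ultimately show "\<exists>t m'. exec (opr h x y d) (m, out) t (m', out) \<and> m' d = apply_arith h v u \<and>
      (\<forall>i<d. m' i = m i) \<and> t \<le> \<beta> ^ (Suc ?j + 2)"
    using 1(3) 2(2,3) by (intro exI[of _ "t1 + (t2 + ?t3)"] exI[of _ "m2(d := apply_arith h v u)"]) simp
qed

lemma computes_ite:
  assumes "computes \<beta> w x v j" "v \<noteq> 0 \<Longrightarrow> computes \<beta> w y u j'" "v = 0 \<Longrightarrow> computes \<beta> w z u' j''"
  shows "computes \<beta> w (ite x y z) (if v \<noteq> 0 then u else u') (Suc (max j (max j' j'')))"
proof (rule computesI)
  let ?u = "if v \<noteq> 0 then u else u'" and ?c = "if v \<noteq> 0 then y else z" and ?j = "max j (max j' j'')"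
  have x: "computes \<beta> w x v ?j" using assms(1) by (rule computes_conv) auto
  have y: "computes \<beta> w ?c ?u ?j"
    using computes_conv[OF assms(2)] computes_conv[OF assms(3)] by (cases "v = 0") auto
  show "?u < 2 ^ \<beta>" using y by (rule computes_bound)
  fix d m out assume e: "w \<preceq> (d, m)" and "d + 4 * Suc ?j + 64 \<le> \<beta>"
  then have d: "d + 4 * ?j + 64 \<le> \<beta>" "d + 64 \<le> \<beta>" by auto
  obtain t1 m1 where 1: "exec (x d) (m, out) t1 (m1, out)" "m1 d = v" "\<And>i. i < d \<Longrightarrow> m1 i = m i"
    "t1 \<le> \<beta> ^ (?j + 2)" using computes_exec[OF x e d(1)] by blast
  have "w \<preceq> (d, m1)" using extends_memory[OF e _ 1(3)] by simp
  then obtain t2 m2 where 2: "exec (?c d) (m1, out) t2 (m2, out)" "m2 d = ?u"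
    "\<And>i. i < d \<Longrightarrow> m2 i = m1 i" "t2 \<le> \<beta> ^ (?j + 2)"
    using computes_exec[OF y _ d(1)] by blast
  have "digits d + digits v \<le> 8 * \<beta>"
    using digits_address[OF d(2), of d] digits_le[OF computes_bound[OF x]] d by simp
  then have "t1 + (t2 + (digits d + digits v)) \<le> \<beta> ^ (Suc ?j + 2)"
    using 1 2 d by (intro time_bound) auto
  moreover have "exec (Cond (At (Dir d)) (y d) (z d)) (m1, out) (digits d + digits v + t2) (m2, out)"
    using exec.CondTrue[of m1 "At (Dir d)" "y d" out t2 "(m2, out)" "z d"]
      exec.CondFalse[of m1 "At (Dir d)" "z d" out t2 "(m2, out)" "y d"] 1 2 by (cases "v = 0") auto
  then have "exec (ite x y z d) (m, out) (t1 + (t2 + (digits d + digits v))) (m2, out)"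
    unfolding ite_def using 1 exec.Seq by (metis add.commute)
  ultimately show "\<exists>t m'. exec (ite x y z d) (m, out) t (m', out) \<and> m' d = ?u \<and>
      (\<forall>i<d. m' i = m i) \<and> t \<le> \<beta> ^ (Suc ?j + 2)"
    using 1(3) 2(2,3) by (intro exI[of _ "t1 + (t2 + (digits d + digits v))"] exI[of _ m2]) simp
qed

lemma computes_bind:
  assumes "computes \<beta> w x v j"
    "\<And>w' z. w \<preceq> w' \<Longrightarrow> computes \<beta> w' z v 0 \<Longrightarrow> computes \<beta> w' (B z) u j'"
  shows "computes \<beta> w (bind x B) u (Suc (max j j'))"
proof (rule computesI)
  let ?j = "max j j'"
  have x: "computes \<beta> w x v ?j" using assms(1) by (rule computes_conv) auto
  \<comment> \<open>The bound \<open>u < 2 ^ \<beta>\<close> is owed even if no stack of admissible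
    height exists, so the body is evaluated in a world made up for this purpose, with
    \<open>v\<close> in register \<open>fst w\<close>.\<close>
  have "\<exists>w' z. w \<preceq> w' \<and> computes \<beta> w' z v 0"
    using computes_var[of "(snd w)(fst w := v)" "fst w" \<beta> "Suc (fst w)"] computes_bound[OF x]
    by (intro exI[of _ "(Suc (fst w), (snd w)(fst w := v))"] exI[of _ "var (fst w)"])
      (auto simp: extends_def)
  then obtain w' z where "w \<preceq> w'" "computes \<beta> w' z v 0" by blast
  from computes_bound[OF assms(2)[OF this]] show "u < 2 ^ \<beta>" .
  fix d m out assume e: "w \<preceq> (d, m)" and "d + 4 * Suc ?j + 64 \<le> \<beta>"
  then have d: "d + 4 * ?j + 64 \<le> \<beta>" "Suc d + 4 * ?j + 64 \<le> \<beta>" "d + 64 \<le> \<beta>" by auto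
  obtain t1 m1 where 1: "exec (x d) (m, out) t1 (m1, out)" "m1 d = v" "\<And>i. i < d \<Longrightarrow> m1 i = m i"
    "t1 \<le> \<beta> ^ (?j + 2)" using computes_exec[OF x e d(1)] by blast
  have e1: "w \<preceq> (Suc d, m1)" using extends_memory[OF e _ 1(3)] by simp
  have "computes \<beta> (Suc d, m1) (var d) v 0"
    using computes_var[of m1 d \<beta> "Suc d"] 1(2) computes_bound[OF x] by simp
  then have y: "computes \<beta> (Suc d, m1) (B (var d)) u ?j"
    by (rule computes_conv[OF assms(2)[OF e1]]) simp_all
  obtain t2 m2 where 2: "exec (B (var d) (Suc d)) (m1, out) t2 (m2, out)" "m2 (Suc d) = u"
    "\<And>i. i < Suc d \<Longrightarrow> m2 i = m1 i" "t2 \<le> \<beta> ^ (?j + 2)"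
    using computes_exec[OF y extends_refl d(2)] by blast
  let ?t3 = "digits d + (digits (Suc d) + digits u)"
  have 3: "exec (Move (Dir d) (At (Dir (Suc d)))) (m2, out) ?t3 (m2(d := u), out)"
    using exec.Move[of "Dir d" "At (Dir (Suc d))" m2 out] 2 by simp
  have "?t3 \<le> 8 * \<beta>"
    using digits_address[OF d(3), of d] digits_address[OF d(3), of "Suc d"]
      digits_le[OF computes_bound[OF y]] d by simp
  then have "t1 + (t2 + ?t3) \<le> \<beta> ^ (Suc ?j + 2)"
    using 1 2 d by (intro time_bound) auto
  moreover have "exec (bind x B d) (m, out) (t1 + (t2 + ?t3)) (m2(d := u), out)"
    unfolding bind_def using 1(1) 2(1) 3 by (intro exec.Seq)
  ultimately show "\<exists>t m'. exec (bind x B d) (m, out) t (m', out) \<and> m' d = u \<and>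
      (\<forall>i<d. m' i = m i) \<and> t \<le> \<beta> ^ (Suc ?j + 2)"
    using 1(3) 2(2,3) by (intro exI[of _ "t1 + (t2 + ?t3)"] exI[of _ "m2(d := u)"]) simp
qed

text \<open>\<open>a i\<close> is the accumulator before round \<open>i\<close>. At most \<beta>
  rounds multiply the cost of the body by \<beta>, and a second factor pays for constants and
  set-up, so a loop raises the depth by two.\<close>

lemma computes_iter:
  assumes "computes \<beta> w x N j" "computes \<beta> w y (a 0) j'" "N \<le> \<beta>"
    "\<And>w' i p z. w \<preceq> w' \<Longrightarrow> i < N \<Longrightarrow> computes \<beta> w' p (a i) 0 \<Longrightarrow> computes \<beta> w' z i 0 \<Longrightarrow>
       computes \<beta> w' (B p z) (a (Suc i)) j''"
  shows "computes \<beta> w (iter x y B) (a N) (Suc (Suc (max j (max j' j''))))"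
proof (rule computesI)
  let ?j = "max j (max j' j'')"
  have x: "computes \<beta> w x N ?j" using assms(1) by (rule computes_conv) auto
  have y: "computes \<beta> w y (a 0) ?j" using assms(2) by (rule computes_conv) auto
  have step: "computes \<beta> w' (B p z) (a (Suc i)) ?j"
    if "w \<preceq> w'" "i < N" "computes \<beta> w' p (a i) 0" "computes \<beta> w' z i 0" for w' i p z
    using assms(4)[OF that] by (rule computes_conv) auto
  have below: "i < 2 ^ \<beta>" if "i \<le> N" for i
    using that assms(3) less_exp[of \<beta>] by linarith
  \<comment> \<open>Obtained without running the loop: each value is bounded in an invented world
    that holds \<open>a i\<close> and \<open>i\<close> in two registers.\<close>
  have a: "a i < 2 ^ \<beta>" if "i \<le> N" for i
    using that
  proof (induction i)
    case 0
    show ?case using y by (rule computes_bound)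
  next
    case (Suc i)
    let ?m = "(snd w)(fst w := a i, Suc (fst w) := i)" and ?d = "Suc (Suc (fst w))"
    have "computes \<beta> (?d, ?m) (B (var (fst w)) (var (Suc (fst w)))) (a (Suc i)) ?j"
      using Suc below[of i] computes_var[of ?m "fst w" \<beta> ?d] computes_var[of ?m "Suc (fst w)" \<beta> ?d]
      by (intro step) (auto simp: extends_def)
    then show ?case by (rule computes_bound)
  qed
  show "a N < 2 ^ \<beta>" using a by simp
  fix d m out assume e: "w \<preceq> (d, m)" and "d + 4 * Suc (Suc ?j) + 64 \<le> \<beta>"
  then have d: "d + 4 * ?j + 64 \<le> \<beta>" "(d + 1) + 4 * ?j + 64 \<le> \<beta>" "(d + 3) + 4 * ?j + 64 \<le> \<beta>" "d + 64 \<le> \<beta>"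
    by auto
  have dg: "digits i \<le> \<beta>" if "i \<le> d + 3" for i
    using that digits_address[OF d(4)] by simp
  have dN: "digits i \<le> \<beta>" if "i \<le> N" for i using digits_le[OF below[OF that]] d by simp
  have da: "digits (a i) \<le> \<beta>" if "i \<le> N" for i using digits_le[OF a[OF that]] d by simp
  have d1: "digits 1 \<le> \<beta>" using dg[of 1] by simp
  have d0: "digits 0 \<le> \<beta>" using dg[of 0] by simp
  obtain t1 m1 where 1: "exec (x d) (m, out) t1 (m1, out)" "m1 d = N" "\<And>i. i < d \<Longrightarrow> m1 i = m i"
    "t1 \<le> \<beta> ^ (?j + 2)" using computes_exec[OF x e d(1)] by blast
  have "w \<preceq> (d + 1, m1)" using extends_memory[OF e _ 1(3)] by simp
  then obtain t2 m2 where 2: "exec (y (d + 1)) (m1, out) t2 (m2, out)" "m2 (d + 1) = a 0"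
    "\<And>i. i < d + 1 \<Longrightarrow> m2 i = m1 i" "t2 \<le> \<beta> ^ (?j + 2)"
    using computes_exec[OF y _ d(2)] by blast
  define T where "T = \<beta> ^ (?j + 2) + 16 * \<beta>"
  have loop: "\<exists>t m'. exec (While (At (Dir d)) (iter_body B d)) (m0, out) t (m', out) \<and> m' (d + 1) = a N \<and>
      (\<forall>i<d. m' i = m0 i) \<and> t \<le> n * T + 2 * \<beta>"
    if "n \<le> N" "m0 d = n" "m0 (d + 1) = a (N - n)" "m0 (d + 2) = N - n" "\<And>i. i < d \<Longrightarrow> m0 i = m i" for n m0
    using that
  proof (induction n arbitrary: m0)
    case 0
    then show ?case
      using exec.WhileFalse[of m0 "At (Dir d)" "iter_body B d" out] dg[of d] d0
      by (intro exI[of _ "digits d + digits 0"] exI[of _ m0]) auto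
  next
    case (Suc n)
    let ?i = "N - Suc n"
    have i: "?i < N" "Suc ?i = N - n" using Suc.prems by auto
    have e3: "w \<preceq> (d + 3, m0)" by (rule extends_memory[OF e _ Suc.prems(5)]) simp_all
    have "computes \<beta> (d + 3, m0) (var (d + 1)) (a ?i) 0" "computes \<beta> (d + 3, m0) (var (d + 2)) ?i 0"
      using computes_var[of m0 "d + 1" \<beta> "d + 3"] computes_var[of m0 "d + 2" \<beta> "d + 3"] Suc.prems
        below[of ?i] a[of ?i] by auto
    then have "computes \<beta> (d + 3, m0) (B (var (d + 1)) (var (d + 2))) (a (N - n)) ?j"
      using step[OF e3 i(1)] i by simp
    then obtain t3 m3 where 3: "exec (B (var (d + 1)) (var (d + 2)) (d + 3)) (m0, out) t3 (m3, out)"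
      "m3 (d + 3) = a (N - n)" "\<And>i. i < d + 3 \<Longrightarrow> m3 i = m0 i" "t3 \<le> \<beta> ^ (?j + 2)"
      using computes_exec[OF _ extends_refl d(3)] by blast
    define m4 where "m4 = m3(d + 1 := a (N - n))"
    define m5 where "m5 = m4(d + 2 := N - n)"
    define m6 where "m6 = m5(d := n)"
    let ?t4 = "digits (d + 1) + (digits (d + 3) + digits (a (N - n)))"
    let ?t5 = "digits (d + 2) + (digits (d + 2) + digits ?i) + digits 1"
    let ?t6 = "digits d + (digits d + digits (Suc n)) + digits 1"
    have 4: "exec (Move (Dir (d + 1)) (At (Dir (d + 3)))) (m3, out) ?t4 (m4, out)"
      using exec.Move[of "Dir (d + 1)" "At (Dir (d + 3))" m3 out] 3 by (simp add: m4_def)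
    have 5: "exec (Arith (Dir (d + 2)) Add (At (Dir (d + 2))) (Const 1)) (m4, out) ?t5 (m5, out)"
      using exec.Arith[of "Dir (d + 2)" Add "At (Dir (d + 2))" "Const 1" m4 out] 3(3)[of "d + 2"] Suc.prems i
      by (simp add: m4_def m5_def)
    have 6: "exec (Arith (Dir d) Sub (At (Dir d)) (Const 1)) (m5, out) ?t6 (m6, out)"
      using exec.Arith[of "Dir d" Sub "At (Dir d)" "Const 1" m5 out] 3(3)[of d] Suc.prems
      by (simp add: m4_def m5_def m6_def)
    have body: "exec (iter_body B d) (m0, out) (t3 + (?t4 + (?t5 + ?t6))) (m6, out)"
      unfolding iter_body_def using 3(1) 4 5 6 by (intro exec.Seq)
    have "\<exists>t m'. exec (While (At (Dir d)) (iter_body B d)) (m6, out) t (m', out) \<and> m' (d + 1) = a N \<and>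
      (\<forall>i<d. m' i = m6 i) \<and> t \<le> n * T + 2 * \<beta>"
      using Suc.prems 3(3) by (intro Suc.IH) (auto simp: m4_def m5_def m6_def)
    then obtain t7 m7 where 7: "exec (While (At (Dir d)) (iter_body B d)) (m6, out) t7 (m7, out)"
      "m7 (d + 1) = a N" "\<forall>i<d. m7 i = m6 i" "t7 \<le> n * T + 2 * \<beta>" by blast
    let ?t = "digits d + digits (Suc n) + (t3 + (?t4 + (?t5 + ?t6))) + t7"
    have "exec (While (At (Dir d)) (iter_body B d)) (m0, out) ?t (m7, out)"
      using exec.WhileTrue[OF _ body 7(1)] Suc.prems by simp
    moreover have "digits d + digits (Suc n) + (t3 + (?t4 + (?t5 + ?t6))) \<le> T"
      using dg[of d] dg[of "d + 1"] dg[of "d + 2"] dg[of "d + 3"] dN[of "Suc n"] dN[of ?i] da[of "N - n"] d1 3(4)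
        Suc.prems(1) unfolding T_def by linarith
    then have "?t \<le> Suc n * T + 2 * \<beta>" using 7(4) by simp
    moreover have "\<forall>i<d. m7 i = m0 i" using 7(3) 3(3) by (simp add: m4_def m5_def m6_def)
    ultimately show ?case using 7(2) by blast
  qed
  let ?m3 = "m2(d + 2 := 0)"
  have 3: "exec (Move (Dir (d + 2)) (Const 0)) (m2, out) (digits (d + 2) + digits 0) (?m3, out)"
    using exec.Move[of "Dir (d + 2)" "Const 0" m2 out] by simp
  have "\<exists>t m'. exec (While (At (Dir d)) (iter_body B d)) (?m3, out) t (m', out) \<and> m' (d + 1) = a N \<and>
      (\<forall>i<d. m' i = ?m3 i) \<and> t \<le> N * T + 2 * \<beta>"
    using 1 2 by (intro loop) auto
  then obtain t4 m4 where 4: "exec (While (At (Dir d)) (iter_body B d)) (?m3, out) t4 (m4, out)"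
      "m4 (d + 1) = a N" "\<forall>i<d. m4 i = ?m3 i" "t4 \<le> N * T + 2 * \<beta>" by blast
  let ?t5 = "digits d + (digits (d + 1) + digits (a N))"
  have 5: "exec (Move (Dir d) (At (Dir (d + 1)))) (m4, out) ?t5 (m4(d := a N), out)"
    using exec.Move[of "Dir d" "At (Dir (d + 1))" m4 out] 4 by simp
  let ?t = "t1 + (t2 + ((digits (d + 2) + digits 0) + (t4 + ?t5)))"
  have "exec (iter x y B d) (m, out) ?t (m4(d := a N), out)"
    unfolding iter_def using 1(1) 2(1) 3 4(1) 5 by (intro exec.Seq)
  moreover have "?t \<le> \<beta> ^ (Suc (Suc ?j) + 2)"
  proof -
    let ?P = "\<beta> ^ (?j + 2)"
    have b: "64 \<le> \<beta>" using d by simp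
    have P: "\<beta> * \<beta> \<le> ?P"
      using b by (simp add: power_add power2_eq_square)
    have "64 * \<beta> \<le> \<beta> * \<beta>" using b by (rule mult_right_mono) simp
    then have P': "64 * \<beta> \<le> ?P" using P by linarith
    have "N * T \<le> \<beta> * T" using assms(3) by simp
    also have "\<dots> \<le> \<beta> * (2 * ?P)" unfolding T_def using P' by (intro mult_left_mono) auto
    finally have "t4 \<le> \<beta> * (2 * ?P) + 2 * \<beta>" using 4(4) by linarith
    then have "?t \<le> 2 * ?P + 7 * \<beta> + \<beta> * (2 * ?P)"
      using 1(4) 2(4) dg[of "d + 2"] d0 dg[of d] dg[of "d + 1"] da[of N] by linarith
    also have "\<dots> \<le> 3 * ?P + \<beta> * (2 * ?P)" using P' by linarith
    also have "\<dots> \<le> \<beta> * ?P + \<beta> * (2 * ?P)" using b by (intro add_right_mono mult_right_mono) auto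
    also have "\<dots> = 3 * (\<beta> * ?P)" by simp
    also have "\<dots> \<le> \<beta> * (\<beta> * ?P)" using b by (intro mult_right_mono) auto
    finally show ?thesis by (simp add: mult.assoc)
  qed
  moreover have "\<forall>i<d. (m4(d := a N)) i = m i" using 1 2 4 by simp
  ultimately show "\<exists>t m'. exec (iter x y B d) (m, out) t (m', out) \<and> m' d = a N \<and> (\<forall>i<d. m' i = m i) \<and>
      t \<le> \<beta> ^ (Suc (Suc ?j) + 2)"
    by (intro exI[of _ ?t] exI[of _ "m4(d := a N)"]) auto
qed


section \<open>Arithmetic, comparison, search and array operations as code\<close>

definition sum_code :: "code \<Rightarrow> (code \<Rightarrow> code) \<Rightarrow> code" where
  "sum_code x B = iter x (cst 0) (\<lambda>p z. opr Add p (B z))"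

definition prod_code :: "code \<Rightarrow> (code \<Rightarrow> code) \<Rightarrow> code" where
  "prod_code x B = iter x (cst 1) (\<lambda>p z. opr Mul p (B z))"

definition power_code :: "code \<Rightarrow> code \<Rightarrow> code" where
  "power_code x y = prod_code y (\<lambda>z. x)"

definition mod_code :: "code \<Rightarrow> code \<Rightarrow> code" where
  "mod_code x y = opr Sub x (opr Mul (opr Div x y) y)"

definition eq_code :: "code \<Rightarrow> code \<Rightarrow> code" where
  "eq_code x y = ite (opr Add (opr Sub x y) (opr Sub y x)) (cst 0) (cst 1)"

definition less_code :: "code \<Rightarrow> code \<Rightarrow> code" where
  "less_code x y = ite (opr Sub y x) (cst 1) (cst 0)"

definition not_code :: "code \<Rightarrow> code" where
  "not_code x = ite x (cst 0) (cst 1)"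

text \<open>Arrays are stored in single registers, as the digits of one large number.\<close>

definition dig :: "nat \<Rightarrow> nat \<Rightarrow> nat \<Rightarrow> nat" where
  "dig b A i = A div b ^ i mod b"

definition dig_code :: "code \<Rightarrow> code \<Rightarrow> code \<Rightarrow> code" where
  "dig_code b x i = mod_code (opr Div x (power_code b i)) b"

text \<open>A champion search: a nonzero \<open>f p i\<close> means that the newcomer
  \<open>i\<close> beats the current champion \<open>p\<close>. With a truncated difference for
  \<open>f\<close>, nonzero is a strict comparison, so the search yields the first minimiser or
  maximiser.\<close>

primrec pick :: "(nat \<Rightarrow> nat \<Rightarrow> nat) \<Rightarrow> nat \<Rightarrow> nat" where
  "pick f 0 = 0"
| "pick f (Suc i) = (if f (pick f i) i \<noteq> 0 then i else pick f i)"

definition pick_code :: "(code \<Rightarrow> code \<Rightarrow> code) \<Rightarrow> code \<Rightarrow> code" where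
  "pick_code B x = iter x (cst 0) (\<lambda>p z. ite (B p z) z p)"

text \<open>Each new digit may look at the number assembled so far. A greedy algorithm whose choices
  depend on all earlier ones thus becomes a single loop with a number as accumulator.\<close>

primrec grow :: "nat \<Rightarrow> (nat \<Rightarrow> nat \<Rightarrow> nat) \<Rightarrow> nat \<Rightarrow> nat" where
  "grow b f 0 = 0"
| "grow b f (Suc i) = grow b f i + f (grow b f i) i * b ^ i"

definition grow_code :: "code \<Rightarrow> (code \<Rightarrow> code \<Rightarrow> code) \<Rightarrow> code \<Rightarrow> code" where
  "grow_code b B x = iter x (cst 0) (\<lambda>p z. opr Add p (opr Mul (B p z) (power_code b z)))"

lemma pick_less: "0 < N \<Longrightarrow> pick f N < N"
  by (induction N) (auto simp: less_Suc_eq)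

lemma pick_min: "i < N \<Longrightarrow> (g (pick (\<lambda>p z. g p - g z) N) :: nat) \<le> g i"
  by (induction N) (auto simp: less_Suc_eq)

lemma pick_max: "i < N \<Longrightarrow> (g i :: nat) \<le> g (pick (\<lambda>p z. g z - g p) N)"
  by (induction N) (auto simp: less_Suc_eq)

lemma dig_less: "0 < b \<Longrightarrow> dig b A i < b"
  by (simp add: dig_def)

lemma dig_add_power:
  assumes "A < b ^ N" "v < b"
  shows "i < N \<Longrightarrow> dig b (A + v * b ^ N) i = dig b A i" "dig b (A + v * b ^ N) N = v"
proof -
  assume i: "i < N"
  then have "b ^ N = b ^ i * (b * b ^ (N - Suc i))"
    by (metis Suc_diff_Suc add.commute less_imp_le_nat le_add_diff_inverse2 power_add power_Suc)
  then have eq: "A + v * b ^ N = A + b ^ i * (b * (v * b ^ (N - Suc i)))"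
    by (simp only: mult_ac)
  have "(A + v * b ^ N) div b ^ i = A div b ^ i + b * (v * b ^ (N - Suc i))"
    unfolding eq using assms(2) by simp
  then show "dig b (A + v * b ^ N) i = dig b A i" by (simp add: dig_def)
next
  show "dig b (A + v * b ^ N) N = v" using assms by (simp add: dig_def)
qed

lemma grow_less:
  assumes "\<And>A i. i < N \<Longrightarrow> f A i < b"
  shows "grow b f N < b ^ N"
  using assms
proof (induction N)
  case (Suc N)
  then have IH: "grow b f N < b ^ N" by simp
  have "Suc (f (grow b f N) N) * b ^ N \<le> b * b ^ N"
    using Suc.prems[of N "grow b f N"] by (intro mult_right_mono) auto
  then show ?case using IH by simp
qed simp

text \<open>Later steps add multiples of higher powers of \<open>b\<close>, which cannot touch digit
  \<open>i\<close>: what is decided at step \<open>i\<close> is what the finished number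
  shows.\<close>

lemma dig_grow:
  assumes "\<And>A i. i < N \<Longrightarrow> f A i < b" "i < M" "M \<le> N"
  shows "dig b (grow b f M) i = f (grow b f i) i"
  using assms(2,3)
proof (induction M)
  case (Suc M)
  have "grow b f M < b ^ M" "f (grow b f M) M < b"
    using Suc.prems by (auto intro!: grow_less assms(1))
  note dig_add_power[OF this]
  then show ?case using Suc by (cases "i = M") auto
qed simp

text \<open>Running through all numbers below \<open>b ^ N\<close> is running through all digit
  sequences. This serves for tuples of points, for guessed cuts and special points, and for the
  choice of a function in each interval.\<close>

lemma exists_digits:
  assumes "0 < b" "\<And>i. i < N \<Longrightarrow> f i < b"
  shows "\<exists>A < b ^ N. \<forall>i<N. dig b A i = f i"
proof (intro exI[of _ "grow b (\<lambda>_ i. if i < N then f i else 0) N"] conjI allI impI)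
  have f: "(if i < N then f i else 0) < b" for i using assms by simp
  show "grow b (\<lambda>_ i. if i < N then f i else 0) N < b ^ N" using f by (rule grow_less)
  fix i assume "i < N"
  then show "dig b (grow b (\<lambda>_ i. if i < N then f i else 0) N) i = f i"
    using dig_grow[of N "\<lambda>_ i. if i < N then f i else 0" b i N] assms(2) by simp
qed

locale machine =
  fixes \<beta> :: nat
  assumes large: "64 \<le> \<beta>"
begin

abbreviation comp :: "world \<Rightarrow> code \<Rightarrow> nat \<Rightarrow> nat \<Rightarrow> bool" where
  "comp \<equiv> computes \<beta>"

lemma small_less: "i \<le> \<beta> \<Longrightarrow> i < 2 ^ \<beta>"
  using less_exp[of \<beta>] by linarith

lemma comp_const: "a \<le> 64 \<Longrightarrow> comp w (cst a) a 0"
  using large by (intro computes_cst small_less) simp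

lemma comp_add: "comp w x v j \<Longrightarrow> comp w y u j' \<Longrightarrow> v + u < 2 ^ \<beta> \<Longrightarrow> comp w (opr Add x y) (v + u) (Suc (max j j'))"
  using computes_opr[of \<beta> w x v j y u j' Add] by simp

lemma comp_sub: "comp w x v j \<Longrightarrow> comp w y u j' \<Longrightarrow> comp w (opr Sub x y) (v - u) (Suc (max j j'))"
  using computes_opr[of \<beta> w x v j y u j' Sub] computes_bound[of \<beta> w x v j] by simp

lemma comp_mul: "comp w x v j \<Longrightarrow> comp w y u j' \<Longrightarrow> v * u < 2 ^ \<beta> \<Longrightarrow> comp w (opr Mul x y) (v * u) (Suc (max j j'))"
  using computes_opr[of \<beta> w x v j y u j' Mul] by simp

lemma comp_div: "comp w x v j \<Longrightarrow> comp w y u j' \<Longrightarrow> comp w (opr Div x y) (v div u) (Suc (max j j'))"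
  using computes_opr[of \<beta> w x v j y u j' Div]
    order_le_less_trans[OF div_le_dividend computes_bound[of \<beta> w x v j]]
  by simp

lemma comp_sum:
  assumes "comp w x n j"
    "\<And>w' z i. w \<preceq> w' \<Longrightarrow> i < n \<Longrightarrow> comp w' z i 0 \<Longrightarrow> comp w' (B z) (f i) j'"
    "n \<le> \<beta>" "(\<Sum>i<n. f i) < 2 ^ \<beta>"
  shows "comp w (sum_code x B) (\<Sum>i<n. f i) (3 + max j j')"
  unfolding sum_code_def
proof (rule computes_conv[OF computes_iter[where a = "\<lambda>n. \<Sum>i<n. f i"]])
  show "comp w x n j" by fact
  show "comp w (cst 0) (\<Sum>i<0. f i) 0" by (simp add: comp_const)
  fix w' i p z
  assume a: "w \<preceq> w'" "i < n" "comp w' p (\<Sum>i<i. f i) 0" "comp w' z i 0"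
  have "(\<Sum>i<i. f i) + f i \<le> (\<Sum>i<n. f i)"
    using a(2) sum_mono2[of "{..<n}" "{..<Suc i}" f] by (auto simp: lessThan_Suc)
  then show "comp w' (opr Add p (B z)) (\<Sum>i<Suc i. f i) (Suc (max 0 j'))"
    using comp_add[OF a(3) assms(2)[OF a(1,2,4)]] assms(4) by (simp add: add.commute)
qed (use assms in auto)

text \<open>Unlike partial sums, partial products may exceed the final value, because a later factor
  can be 0; hence the size bound for every prefix.\<close>

lemma comp_prod:
  assumes "comp w x n j"
    "\<And>w' z i. w \<preceq> w' \<Longrightarrow> i < n \<Longrightarrow> comp w' z i 0 \<Longrightarrow> comp w' (B z) (f i) j'"
    "n \<le> \<beta>" "\<And>i. i \<le> n \<Longrightarrow> (\<Prod>i<i. f i) < 2 ^ \<beta>"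
  shows "comp w (prod_code x B) (\<Prod>i<n. f i) (3 + max j j')"
  unfolding prod_code_def
proof (rule computes_conv[OF computes_iter[where a = "\<lambda>n. \<Prod>i<n. f i"]])
  show "comp w x n j" by fact
  show "comp w (cst 1) (\<Prod>i<0. f i) 0" using comp_const[of 1] by simp
  fix w' i p z
  assume a: "w \<preceq> w'" "i < n" "comp w' p (\<Prod>i<i. f i) 0" "comp w' z i 0"
  show "comp w' (opr Mul p (B z)) (\<Prod>i<Suc i. f i) (Suc (max 0 j'))"
    using comp_mul[OF a(3) assms(2)[OF a(1,2,4)]] assms(4)[of "Suc i"] a(2) by (simp add: mult.commute)
qed (use assms in auto)

lemma comp_power:
  assumes "comp w x b j" "comp w y e j'" "0 < b" "e \<le> \<beta>" "b ^ e < 2 ^ \<beta>"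
  shows "comp w (power_code x y) (b ^ e) (3 + max j j')"
proof -
  have "comp w (prod_code y (\<lambda>z. x)) (\<Prod>i<e. b) (3 + max j' j)"
  proof (rule comp_prod[OF assms(2)])
    fix i assume "i \<le> e"
    then have "b ^ i \<le> b ^ e" using assms(3) by (intro power_increasing) auto
    then show "(\<Prod>i<i. b) < 2 ^ \<beta>" using assms(5) by simp
  qed (use assms computes_extend in auto)
  then show ?thesis unfolding power_code_def by (rule computes_conv) auto
qed

lemma comp_mod:
  assumes "comp w x v j" "comp w y u j'"
  shows "comp w (mod_code x y) (v mod u) (3 + max j j')"
proof -
  have "v div u * u < 2 ^ \<beta>"
    using computes_bound[OF assms(1)] div_times_less_eq_dividend[of v u] by linarith
  then show ?thesis unfolding mod_code_def
    using assms by (intro computes_conv[OF comp_sub[OF _ comp_mul[OF comp_div]]]) (auto simp: minus_div_mult_eq_mod)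
qed

lemma comp_ite:
  assumes "comp w x v j" "v \<noteq> 0 \<Longrightarrow> comp w y u j'" "v = 0 \<Longrightarrow> comp w z u' j''"
  shows "comp w (ite x y z) (if v \<noteq> 0 then u else u') (Suc (max j (max j' j'')))"
  using computes_ite[OF assms] .

lemma comp_eq:
  assumes "comp w x v j" "comp w y u j'"
  shows "comp w (eq_code x y) (of_bool (v = u)) (3 + max j j')"
proof -
  have "(v - u) + (u - v) < 2 ^ \<beta>"
    using computes_bound[OF assms(1)] computes_bound[OF assms(2)] by linarith
  then have "comp w (eq_code x y) (if (v - u) + (u - v) \<noteq> 0 then 0 else 1) (3 + max j j')"
    unfolding eq_code_def using assms
    by (intro computes_conv[OF comp_ite[OF comp_add[OF comp_sub comp_sub] comp_const comp_const]]) auto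
  then show ?thesis by (rule computes_conv) auto
qed

lemma comp_less:
  assumes "comp w x v j" "comp w y u j'"
  shows "comp w (less_code x y) (of_bool (v < u)) (2 + max j j')"
  unfolding less_code_def using assms
  by (intro computes_conv[OF comp_ite[OF comp_sub comp_const comp_const]]) auto

lemma comp_not:
  assumes "comp w x v j"
  shows "comp w (not_code x) (of_bool (v = 0)) (Suc j)"
  unfolding not_code_def using assms
  by (intro computes_conv[OF comp_ite[OF _ comp_const comp_const]]) auto

lemma comp_dig:
  assumes "comp w x b j" "comp w y A j'" "comp w z i j''" "0 < b" "i \<le> \<beta>" "b ^ i < 2 ^ \<beta>"
  shows "comp w (dig_code x y z) (dig b A i) (7 + max j (max j' j''))"
  unfolding dig_code_def dig_def using assms
  by (intro computes_conv[OF comp_mod[OF comp_div[OF _ comp_power]]]) auto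

lemma comp_pick:
  assumes "comp w x n j" "n \<le> \<beta>"
    "\<And>w' p z a i. w \<preceq> w' \<Longrightarrow> a < n \<Longrightarrow> i < n \<Longrightarrow> comp w' p a 0 \<Longrightarrow> comp w' z i 0 \<Longrightarrow>
       comp w' (B p z) (f a i) j'"
  shows "comp w (pick_code B x) (pick f n) (3 + max j j')"
  unfolding pick_code_def
proof (rule computes_conv[OF computes_iter[where a = "pick f"]])
  show "comp w x n j" by fact
  show "comp w (cst 0) (pick f 0) 0" by (simp add: comp_const)
  fix w' i p z
  assume a: "w \<preceq> w'" "i < n" "comp w' p (pick f i) 0" "comp w' z i 0"
  have "pick f i < n" using a(2) pick_less[of i f] by (cases "i = 0") auto
  then show "comp w' (ite (B p z) z p) (pick f (Suc i)) (Suc j')"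
    using comp_ite[OF assms(3)[OF a(1) _ a(2,3,4)] a(4,3)] by simp
qed (use assms in auto)

text \<open>The body may assume \<open>A < b ^ i\<close> for the digits assembled so far, which
  keeps a tentatively appended digit within range.\<close>

lemma comp_grow:
  assumes "comp w y b j" "comp w x n j'" "n \<le> \<beta>" "0 < b" "b ^ n < 2 ^ \<beta>"
    "\<And>A i. i < n \<Longrightarrow> f A i < b"
    "\<And>w' p z A i. w \<preceq> w' \<Longrightarrow> A < b ^ i \<Longrightarrow> i < n \<Longrightarrow> comp w' p A 0 \<Longrightarrow> comp w' z i 0 \<Longrightarrow>
       comp w' (B p z) (f A i) j''"
  shows "comp w (grow_code y B x) (grow b f n) (7 + max j (max j' j''))"
  unfolding grow_code_def
proof (rule computes_conv[OF computes_iter[where a = "grow b f"]])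
  show "comp w x n j'" by fact
  show "comp w (cst 0) (grow b f 0) 0" by (simp add: comp_const)
  fix w' i p z
  assume a: "w \<preceq> w'" "i < n" "comp w' p (grow b f i) 0" "comp w' z i 0"
  have le: "b ^ k \<le> b ^ n" if "k \<le> n" for k using that assms(4) by (intro power_increasing) auto
  have "grow b f (Suc i) < b ^ Suc i" "grow b f i < b ^ i"
    using assms(6) a(2) by (intro grow_less; simp)+
  then have l: "grow b f i + f (grow b f i) i * b ^ i < 2 ^ \<beta>" "grow b f i < b ^ i"
    using le[of "Suc i"] a(2) assms(5) by auto
  have "b ^ i < 2 ^ \<beta>" using le[of i] a(2) assms(5) by simp
  then have "comp w' (power_code y z) (b ^ i) (3 + max j 0)"
    using comp_power[OF computes_extend[OF assms(1) a(1)] a(4)] a(2) assms(3,4) by simp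
  from comp_add[OF a(3) comp_mul[OF assms(7)[OF a(1) l(2) a(2,3,4)] this]]
  show "comp w' (opr Add p (opr Mul (B p z) (power_code y z))) (grow b f (Suc i))
      (Suc (Suc (max j'' (3 + j))))"
    using l(1) by simp
qed (use assms in auto)

end

section \<open>Programs that write to the output tape\<close>

definition emit_body :: "(code \<Rightarrow> code) \<Rightarrow> code" where
  "emit_body B d =
     Seq (B (var (d + 1)) (d + 2))
    (Seq (Write (At (Dir (d + 2))))
    (Seq (Arith (Dir (d + 1)) Add (At (Dir (d + 1))) (Const 1))
         (Arith (Dir d) Sub (At (Dir d)) (Const 1))))"

definition emit :: "code \<Rightarrow> (code \<Rightarrow> code) \<Rightarrow> code" where
  "emit x B d =
     Seq (x d)
    (Seq (Move (Dir (d + 1)) (Const 0))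
         (While (At (Dir d)) (emit_body B d)))"

definition store :: "code \<Rightarrow> (code \<Rightarrow> code) \<Rightarrow> code" where
  "store x B d = Seq (x d) (B (var d) (Suc d))"

text \<open>Output code comes last, so nothing is said about the final memory. Its time is a
  separate parameter because the number of items written may be far larger than \<beta>.\<close>

definition emits :: "nat \<Rightarrow> world \<Rightarrow> code \<Rightarrow> nat list \<Rightarrow> nat \<Rightarrow> nat \<Rightarrow> bool" where
  "emits \<beta> w c ys j T \<longleftrightarrow>
     (\<forall>d m out. w \<preceq> (d, m) \<and> d + 4 * j + 64 \<le> \<beta> \<longrightarrow>
       (\<exists>t m'. exec (c d) (m, out) t (m', out @ ys) \<and> t \<le> T))"

context machine
begin

lemma emits_store:
  assumes "comp w x v j"
    "\<And>w' z. w \<preceq> w' \<Longrightarrow> comp w' z v 0 \<Longrightarrow> emits \<beta> w' (B z) ys j' T"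
  shows "emits \<beta> w (store x B) ys (Suc (max j j')) (\<beta> ^ (j + 2) + T)"
  unfolding emits_def
proof (intro allI impI, elim conjE)
  fix d m out assume e: "w \<preceq> (d, m)" and "d + 4 * Suc (max j j') + 64 \<le> \<beta>"
  then have d: "d + 4 * j + 64 \<le> \<beta>" "Suc d + 4 * j' + 64 \<le> \<beta>" by auto
  obtain t1 m1 where 1: "exec (x d) (m, out) t1 (m1, out)" "m1 d = v" "\<And>i. i < d \<Longrightarrow> m1 i = m i"
    "t1 \<le> \<beta> ^ (j + 2)" using computes_exec[OF assms(1) e d(1)] by blast
  have e1: "w \<preceq> (Suc d, m1)" using extends_memory[OF e _ 1(3)] by simp
  have "comp (Suc d, m1) (var d) v 0"
    using computes_var[of m1 d \<beta> "Suc d"] 1(2) computes_bound[OF assms(1)] by simp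
  from assms(2)[OF e1 this] obtain t2 m2 where
    2: "exec (B (var d) (Suc d)) (m1, out) t2 (m2, out @ ys)" "t2 \<le> T"
    unfolding emits_def using d(2) extends_refl by blast
  have "exec (store x B d) (m, out) (t1 + t2) (m2, out @ ys)"
    unfolding store_def using 1(1) 2(1) by (rule exec.Seq)
  moreover have "t1 + t2 \<le> \<beta> ^ (j + 2) + T" using 1 2 by simp
  ultimately show "\<exists>t m'. exec (store x B d) (m, out) t (m', out @ ys) \<and> t \<le> \<beta> ^ (j + 2) + T"
    by blast
qed

lemma emits_emit:
  assumes "comp w x N j"
    "\<And>w' z i. w \<preceq> w' \<Longrightarrow> i < N \<Longrightarrow> comp w' z i 0 \<Longrightarrow> comp w' (B z) (f i) j'"
  shows "emits \<beta> w (emit x B) (map f [0..<N]) (Suc (max j j')) ((N + 1) * \<beta> ^ (max j j' + 3))"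
  unfolding emits_def
proof (intro allI impI, elim conjE)
  let ?j = "max j j'"
  have x: "comp w x N ?j" using assms(1) by (rule computes_conv) auto
  have step: "comp w' (B z) (f i) ?j" if "w \<preceq> w'" "i < N" "comp w' z i 0" for w' i z
    using assms(2)[OF that] by (rule computes_conv) auto
  fix d m out assume e: "w \<preceq> (d, m)" and "d + 4 * Suc ?j + 64 \<le> \<beta>"
  then have d: "d + 4 * ?j + 64 \<le> \<beta>" "(d + 2) + 4 * ?j + 64 \<le> \<beta>" "d + 64 \<le> \<beta>" by auto
  have below: "i < 2 ^ \<beta>" if "i \<le> N" for i
    using that computes_bound[OF x] by linarith
  have dg: "digits i \<le> \<beta>" if "i \<le> d + 3" for i
    using that digits_address[OF d(3)] by simp
  have dN: "digits i \<le> \<beta>" if "i \<le> N" for i using digits_le[OF below[OF that]] d by simp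
  have d1: "digits 1 \<le> \<beta>" using dg[of 1] by simp
  have d0: "digits 0 \<le> \<beta>" using dg[of 0] by simp
  obtain t1 m1 where 1: "exec (x d) (m, out) t1 (m1, out)" "m1 d = N" "\<And>i. i < d \<Longrightarrow> m1 i = m i"
    "t1 \<le> \<beta> ^ (?j + 2)" using computes_exec[OF x e d(1)] by blast
  define T where "T = \<beta> ^ (?j + 2) + 16 * \<beta>"
  have loop: "\<exists>t m'. exec (While (At (Dir d)) (emit_body B d)) (m0, out0) t (m', out0 @ map f [N - n..<N]) \<and>
      t \<le> n * T + 2 * \<beta>"
    if "n \<le> N" "m0 d = n" "m0 (d + 1) = N - n" "\<And>i. i < d \<Longrightarrow> m0 i = m i" for n m0 out0
    using that
  proof (induction n arbitrary: m0 out0)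
    case 0
    then show ?case
      using exec.WhileFalse[of m0 "At (Dir d)" "emit_body B d" out0] dg[of d] d0
      by (intro exI[of _ "digits d + digits 0"] exI[of _ m0]) auto
  next
    case (Suc n)
    let ?i = "N - Suc n"
    have i: "?i < N" "Suc ?i = N - n" using Suc.prems by auto
    have e3: "w \<preceq> (d + 2, m0)" by (rule extends_memory[OF e _ Suc.prems(4)]) simp_all
    have "comp (d + 2, m0) (var (d + 1)) ?i 0"
      using computes_var[of m0 "d + 1" \<beta> "d + 2"] Suc.prems below[of ?i] by auto
    then have b: "comp (d + 2, m0) (B (var (d + 1))) (f ?i) ?j"
      using step[OF e3 i(1)] by simp
    then obtain t3 m3 where 3: "exec (B (var (d + 1)) (d + 2)) (m0, out0) t3 (m3, out0)"
      "m3 (d + 2) = f ?i" "\<And>i. i < d + 2 \<Longrightarrow> m3 i = m0 i" "t3 \<le> \<beta> ^ (?j + 2)"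
      using computes_exec[OF _ extends_refl d(2)] by blast
    define m5 where "m5 = m3(d + 1 := N - n)"
    define m6 where "m6 = m5(d := n)"
    let ?t4 = "digits (d + 2) + digits (f ?i)"
    let ?t5 = "digits (d + 1) + (digits (d + 1) + digits ?i) + digits 1"
    let ?t6 = "digits d + (digits d + digits (Suc n)) + digits 1"
    let ?o = "out0 @ [f ?i]"
    have 4: "exec (Write (At (Dir (d + 2)))) (m3, out0) ?t4 (m3, ?o)"
      using exec.Write[of "At (Dir (d + 2))" m3 out0] 3 by simp
    have 5: "exec (Arith (Dir (d + 1)) Add (At (Dir (d + 1))) (Const 1)) (m3, ?o) ?t5 (m5, ?o)"
      using exec.Arith[of "Dir (d + 1)" Add "At (Dir (d + 1))" "Const 1" m3 ?o] 3(3)[of "d + 1"] Suc.prems i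
      by (simp add: m5_def)
    have 6: "exec (Arith (Dir d) Sub (At (Dir d)) (Const 1)) (m5, ?o) ?t6 (m6, ?o)"
      using exec.Arith[of "Dir d" Sub "At (Dir d)" "Const 1" m5 ?o] 3(3)[of d] Suc.prems
      by (simp add: m5_def m6_def)
    have body: "exec (emit_body B d) (m0, out0) (t3 + (?t4 + (?t5 + ?t6))) (m6, ?o)"
      unfolding emit_body_def using 3(1) 4 5 6 by (intro exec.Seq)
    have "\<exists>t m'. exec (While (At (Dir d)) (emit_body B d)) (m6, ?o) t (m', ?o @ map f [N - n..<N]) \<and>
      t \<le> n * T + 2 * \<beta>"
      using Suc.prems 3(3) by (intro Suc.IH) (auto simp: m5_def m6_def)
    then obtain t7 m7 where 7: "exec (While (At (Dir d)) (emit_body B d)) (m6, ?o) t7 (m7, ?o @ map f [N - n..<N])"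
      "t7 \<le> n * T + 2 * \<beta>" by blast
    let ?t = "digits d + digits (Suc n) + (t3 + (?t4 + (?t5 + ?t6))) + t7"
    have "[N - Suc n..<N] = (N - Suc n) # [N - n..<N]"
      using i upt_rec[of "N - Suc n" N] by simp
    then have "?o @ map f [N - n..<N] = out0 @ map f [N - Suc n..<N]" by simp
    then have "exec (While (At (Dir d)) (emit_body B d)) (m0, out0) ?t (m7, out0 @ map f [N - Suc n..<N])"
      using exec.WhileTrue[OF _ body 7(1)] Suc.prems by simp
    moreover have "digits (f ?i) \<le> \<beta>" using digits_le[OF computes_bound[OF b]] d by simp
    then have "digits d + digits (Suc n) + (t3 + (?t4 + (?t5 + ?t6))) \<le> T"
      using dg[of d] dg[of "d + 1"] dg[of "d + 2"] dN[of "Suc n"] dN[of ?i] d1 3(4)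
        Suc.prems(1) unfolding T_def by linarith
    then have "?t \<le> Suc n * T + 2 * \<beta>" using 7(2) by simp
    ultimately show ?case by blast
  qed
  let ?m3 = "m1(d + 1 := 0)"
  have 3: "exec (Move (Dir (d + 1)) (Const 0)) (m1, out) (digits (d + 1) + digits 0) (?m3, out)"
    using exec.Move[of "Dir (d + 1)" "Const 0" m1 out] by simp
  have "\<exists>t m'. exec (While (At (Dir d)) (emit_body B d)) (?m3, out) t (m', out @ map f [N - N..<N]) \<and>
      t \<le> N * T + 2 * \<beta>"
    using 1 by (intro loop) auto
  then obtain t4 m4 where 4: "exec (While (At (Dir d)) (emit_body B d)) (?m3, out) t4 (m4, out @ map f [0..<N])"
      "t4 \<le> N * T + 2 * \<beta>" by auto
  let ?t = "t1 + ((digits (d + 1) + digits 0) + t4)"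
  have "exec (emit x B d) (m, out) ?t (m4, out @ map f [0..<N])"
    unfolding emit_def using 1(1) 3 4(1) by (intro exec.Seq)
  moreover have "?t \<le> (N + 1) * \<beta> ^ (?j + 3)"
  proof -
    let ?P = "\<beta> ^ (?j + 2)"
    have b: "64 \<le> \<beta>" using d by simp
    have P: "\<beta> * \<beta> \<le> ?P" using b by (simp add: power_add power2_eq_square)
    have "64 * \<beta> \<le> \<beta> * \<beta>" using b by (rule mult_right_mono) simp
    then have P': "64 * \<beta> \<le> ?P" using P by linarith
    have Q: "64 * ?P \<le> \<beta> ^ (?j + 3)" using mult_right_mono[OF b, of ?P] by (simp add: eval_nat_numeral)
    have "T \<le> \<beta> ^ (?j + 3)" unfolding T_def using P' Q by linarith
    then have "N * T \<le> N * \<beta> ^ (?j + 3)" by simp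
    then have "?t \<le> N * \<beta> ^ (?j + 3) + 4 * \<beta> + ?P"
      using 1(4) 4(2) dg[of "d + 1"] d0 by linarith
    then show ?thesis using P' Q unfolding add_mult_distrib by linarith
  qed
  ultimately show "\<exists>t m'. exec (emit x B d) (m, out) t (m', out @ map f [0..<N]) \<and> t \<le> (N + 1) * \<beta> ^ (?j + 3)"
    by blast
qed

end

section \<open>Greedy perfect hashing\<close>


definition collisions :: "(nat \<Rightarrow> nat \<Rightarrow> nat) \<Rightarrow> nat \<Rightarrow> nat \<Rightarrow> nat \<Rightarrow> nat" where
  "collisions h i x y = (\<Sum>i'<i. of_bool (h i' x = h i' y))"

text \<open>The increase in total weight caused by giving \<open>x\<close> the value
  \<open>v\<close> in function \<open>i\<close>, where a pair weighs 2 to the number of its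
  collisions so far. It refers only to entries fixed before \<open>(i, x)\<close>.\<close>

definition collision_cost :: "(nat \<Rightarrow> nat \<Rightarrow> nat) \<Rightarrow> nat \<Rightarrow> nat \<Rightarrow> nat \<Rightarrow> nat" where
  "collision_cost h i x v = (\<Sum>y<x. of_bool (h i y = v) * 2 ^ collisions h i x y)"

text \<open>\<open>(1 + 1 / q) ^ q\<close> is at most \<open>exp 1\<close>. Rounding up to 4 keeps
  the accounting in natural numbers and powers of 2.\<close>

lemma power_Suc_le_four:
  fixes q :: nat
  assumes "0 < q"
  shows "(q + 1) ^ q \<le> 4 * q ^ q"
proof -
  have "(1 + 1 / real q) ^ q \<le> exp 1"
    using exp_ge_one_plus_x_over_n_power_n[of q 1] assms by simp
  also have "\<dots> \<le> 4" using exp_le by simp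
  finally have "(1 + 1 / real q) ^ q * real q ^ q \<le> 4 * real q ^ q"
    by (intro mult_right_mono) auto
  moreover have "(1 + 1 / real q) ^ q * real q ^ q = real (q + 1) ^ q"
    using assms by (simp flip: power_mult_distrib add: distrib_right add.commute)
  ultimately have "real ((q + 1) ^ q) \<le> real (4 * q ^ q)" by simp
  then show ?thesis by (simp only: of_nat_le_iff)
qed

text \<open>The total weight \<open>W\<close> of all pairs is a potential. The cheapest value costs
  at most the average over \<open>q\<close> values, so a round multiplies \<open>W\<close> by at
  most \<open>1 + 1 / q\<close>, and \<open>q * \<mu>\<close> rounds by at most
  \<open>4 ^ \<mu>\<close>. As \<open>W\<close> starts below \<open>n * n \<le> 4 ^ \<mu>\<close>,
  no single pair can reach weight \<open>2 ^ (4 * \<mu>)\<close>.\<close>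

lemma greedy_collisions:
  assumes greedy: "\<And>i x v. i < L \<Longrightarrow> x < n \<Longrightarrow> v < q \<Longrightarrow> collision_cost h i x (h i x) \<le> collision_cost h i x v"
    and range: "\<And>i x. i < L \<Longrightarrow> x < n \<Longrightarrow> h i x < q"
    and q: "0 < q" and L: "L = q * \<mu>" and n: "n \<le> 2 ^ \<mu>" and xy: "y < x" "x < n"
  shows "collisions h L x y < 4 * \<mu>"
proof -
  define W where "W i = (\<Sum>x<n. \<Sum>y<x. (2::nat) ^ collisions h i x y)" for i
  have step: "q * W (Suc i) \<le> (q + 1) * W i" if i: "i < L" for i
  proof -
    have "q * collision_cost h i x (h i x) \<le> (\<Sum>y<x. 2 ^ collisions h i x y)" if x: "x < n" for x
    proof -
      \<comment> \<open>The minimum is compared with the average: summed over all \<open>v\<close>,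
        each earlier point \<open>y\<close> is charged exactly once, at
        \<open>v = h i y\<close>.\<close>
      have "q * collision_cost h i x (h i x) = (\<Sum>v<q. collision_cost h i x (h i x))" by simp
      also have "\<dots> \<le> (\<Sum>v<q. collision_cost h i x v)"
        by (intro sum_mono greedy[OF i x]) auto
      also have "\<dots> = (\<Sum>y<x. \<Sum>v<q. of_bool (h i y = v) * 2 ^ collisions h i x y)"
        unfolding collision_cost_def by (rule sum.swap)
      also have "\<dots> = (\<Sum>y<x. 2 ^ collisions h i x y)"
      proof (rule sum.cong)
        fix y assume "y \<in> {..<x}"
        then have "h i y \<in> {..<q}" using range i x by auto
        then show "(\<Sum>v<q. of_bool (h i y = v) * 2 ^ collisions h i x y) = (2::nat) ^ collisions h i x y"
          by (simp add: of_bool_def if_distrib[where f = "\<lambda>u. u * _"] sum.delta cong: if_cong)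
      qed simp
      finally show ?thesis .
    qed
    then have "(\<Sum>x<n. q * collision_cost h i x (h i x)) \<le> W i"
      unfolding W_def by (intro sum_mono) auto
    then have le: "q * (\<Sum>x<n. collision_cost h i x (h i x)) \<le> W i" by (simp add: sum_distrib_left)
    have "W (Suc i) = W i + (\<Sum>x<n. collision_cost h i x (h i x))"
    proof -
      have "(2::nat) ^ collisions h (Suc i) x y =
          2 ^ collisions h i x y + of_bool (h i y = h i x) * 2 ^ collisions h i x y" for x y
        by (auto simp: collisions_def power_add)
      then show ?thesis by (simp add: W_def collision_cost_def sum.distrib)
    qed
    then show ?thesis using le by (simp add: distrib_left distrib_right)
  qed
  have iterated: "q ^ i * W i \<le> (q + 1) ^ i * W 0" if "i \<le> L" for i
    using that
  proof (induction i)
    case (Suc i)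
    have "q ^ Suc i * W (Suc i) = q ^ i * (q * W (Suc i))" by simp
    also have "\<dots> \<le> q ^ i * ((q + 1) * W i)" using step[of i] Suc.prems by (intro mult_left_mono) auto
    also have "\<dots> = (q + 1) * (q ^ i * W i)" by (simp only: mult_ac)
    also have "\<dots> \<le> (q + 1) * ((q + 1) ^ i * W 0)" using Suc by (intro mult_left_mono) auto
    finally show ?case by (simp only: power_Suc mult.assoc)
  qed simp
  have "(q + 1) ^ L = ((q + 1) ^ q) ^ \<mu>" by (simp add: L power_mult)
  also have "\<dots> \<le> (4 * q ^ q) ^ \<mu>" using power_Suc_le_four[OF q] by (intro power_mono) auto
  also have "\<dots> = 4 ^ \<mu> * q ^ L" by (simp add: L power_mult power_mult_distrib)
  finally have "q ^ L * W L \<le> 4 ^ \<mu> * q ^ L * W 0"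
    using iterated[of L] mult_right_mono[of "(q + 1) ^ L" "4 ^ \<mu> * q ^ L" "W 0"] by linarith
  then have "q ^ L * W L \<le> q ^ L * (4 ^ \<mu> * W 0)" by (simp only: mult_ac)
  then have WL: "W L \<le> 4 ^ \<mu> * W 0" using q by simp
  have "W 0 = (\<Sum>x<n. x)" by (simp add: W_def collisions_def)
  also have "\<dots> \<le> (\<Sum>x<n. n - 1)" by (intro sum_mono) auto
  also have "\<dots> < n * n" using xy by (cases n) auto
  also have "\<dots> \<le> 2 ^ \<mu> * 2 ^ \<mu>" using n by (intro mult_mono) auto
  also have "\<dots> = (4::nat) ^ \<mu>" by (simp flip: power_mult_distrib)
  finally have "4 ^ \<mu> * W 0 < 4 ^ \<mu> * 4 ^ \<mu>" by simp
  also have "(4::nat) ^ \<mu> * 4 ^ \<mu> = 2 ^ (4 * \<mu>)" by (simp add: power_mult flip: power_mult_distrib)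
  finally have W: "W L < 2 ^ (4 * \<mu>)" using WL by simp
  have "2 ^ collisions h L x y \<le> (\<Sum>y<x. (2::nat) ^ collisions h L x y)"
    using xy by (intro member_le_sum) auto
  also have "\<dots> \<le> W L" unfolding W_def
    using xy by (intro member_le_sum[where f = "\<lambda>x. \<Sum>y<x. (2::nat) ^ collisions h L x y"]) auto
  finally have "(2::nat) ^ collisions h L x y < 2 ^ (4 * \<mu>)" using W by linarith
  then show ?thesis by simp
qed

text \<open>If every function collided inside \<open>S\<close>, the pairs of \<open>S\<close> would
  collect at least \<open>L\<close> collisions. There are at most \<open>k * k\<close> pairs with
  fewer than \<open>4 * \<mu>\<close> collisions each, and \<open>q = 4 * k * k\<close> is chosen to
  make \<open>k * k * (4 * \<mu>)\<close> equal to \<open>L\<close>.\<close>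

lemma greedy_perfect_hash:
  assumes greedy: "\<And>i x v. i < L \<Longrightarrow> x < n \<Longrightarrow> v < q \<Longrightarrow> collision_cost h i x (h i x) \<le> collision_cost h i x v"
    and range: "\<And>i x. i < L \<Longrightarrow> x < n \<Longrightarrow> h i x < q"
    and q: "q = 4 * k * k" "0 < k" and L: "L = q * \<mu>" and n: "n \<le> 2 ^ \<mu>" and \<mu>: "0 < \<mu>"
    and S: "S \<subseteq> {..<n}" "card S = k"
  shows "\<exists>i<L. inj_on (h i) S"
proof (rule ccontr)
  assume "\<not> ?thesis"
  then have no: "\<not> inj_on (h i) S" if "i < L" for i using that by blast
  have fin: "finite S" using S finite_subset by blast
  have "1 \<le> (\<Sum>x\<in>S. \<Sum>y\<in>S \<inter> {..<x}. of_bool (h i x = h i y) :: nat)" if "i < L" for i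
  proof -
    have "\<exists>x y. x \<in> S \<and> y \<in> S \<and> h i x = h i y \<and> y < x"
      using no[OF that] unfolding inj_on_def by (metis linorder_neqE_nat)
    then obtain x y where xy: "x \<in> S" "y \<in> S" "h i x = h i y" "y < x" by blast
    have "1 = (of_bool (h i x = h i y) :: nat)" using xy by simp
    also have "\<dots> \<le> (\<Sum>y\<in>S \<inter> {..<x}. of_bool (h i x = h i y))"
      using xy fin by (intro member_le_sum) auto
    also have "\<dots> \<le> (\<Sum>x\<in>S. \<Sum>y\<in>S \<inter> {..<x}. of_bool (h i x = h i y) :: nat)"
      using xy fin
      by (intro member_le_sum[where f = "\<lambda>x. \<Sum>y\<in>S \<inter> {..<x}. of_bool (h i x = h i y)"]) auto
    finally show ?thesis .
  qed
  then have "(\<Sum>i<L. 1) \<le> (\<Sum>i<L. \<Sum>x\<in>S. \<Sum>y\<in>S \<inter> {..<x}. of_bool (h i x = h i y) :: nat)"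
    by (intro sum_mono) auto
  also have "\<dots> = (\<Sum>x\<in>S. \<Sum>i<L. \<Sum>y\<in>S \<inter> {..<x}. of_bool (h i x = h i y))"
    by (rule sum.swap)
  also have "\<dots> = (\<Sum>x\<in>S. \<Sum>y\<in>S \<inter> {..<x}. collisions h L x y)"
    unfolding collisions_def by (intro sum.cong refl sum.swap)
  \<comment> \<open>Summation preserves only weak inequalities, so the strict bound is carried as
    \<open>4 * \<mu> - 1\<close>.\<close>
  also have "\<dots> \<le> (\<Sum>x\<in>S. \<Sum>y\<in>S \<inter> {..<x}. 4 * \<mu> - 1)"
  proof (intro sum_mono)
    fix x y assume "x \<in> S" "y \<in> S \<inter> {..<x}"
    then have "collisions h L x y < 4 * \<mu>"
      using S q by (intro greedy_collisions[OF greedy range _ L n]) auto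
    then show "collisions h L x y \<le> 4 * \<mu> - 1" by simp
  qed
  also have "\<dots> \<le> (\<Sum>x\<in>S. \<Sum>y\<in>S. 4 * \<mu> - 1)"
    using fin by (intro sum_mono sum_mono2) auto
  also have "\<dots> = k * k * (4 * \<mu> - 1)" by (simp add: S)
  also have "\<dots> < k * k * (4 * \<mu>)" using \<mu> q by (intro mult_strict_left_mono) auto
  also have "\<dots> = L" by (simp add: L q)
  finally show False by simp
qed

section \<open>Greedy covering of tuples\<close>


text \<open>Injectivity on the tuple is expressed by a vanishing count, because nested sums are what
  the programs evaluate.\<close>

definition clash :: "nat \<Rightarrow> (nat \<Rightarrow> nat) \<Rightarrow> (nat \<Rightarrow> nat) \<Rightarrow> nat" where
  "clash s f \<tau> = (\<Sum>i<s. \<Sum>j<i. of_bool (f (\<tau> i) = f (\<tau> j)))"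

text \<open>Unassigned points receive distinct values outside the range of \<open>g\<close>.\<close>

definition partial :: "nat \<Rightarrow> (nat \<Rightarrow> nat) \<Rightarrow> nat \<Rightarrow> nat \<Rightarrow> nat" where
  "partial m g y x = (if x < y then g x else m + x)"

definition assigned :: "nat \<Rightarrow> (nat \<Rightarrow> nat) \<Rightarrow> nat \<Rightarrow> nat" where
  "assigned s \<tau> y = (\<Sum>i<s. of_bool (\<tau> i < y))"

definition falling :: "nat \<Rightarrow> nat \<Rightarrow> nat" where
  "falling m s = (\<Prod>u<s. m - u)"

text \<open>
  This is \<open>m ^ s\<close> times the probability that a random function which agrees with \<open>g\<close> below \<open>y\<close> is
  injective on the tuple \<open>\<tau>\<close>.
\<close>

definition weight :: "nat \<Rightarrow> nat \<Rightarrow> (nat \<Rightarrow> nat) \<Rightarrow> nat \<Rightarrow> (nat \<Rightarrow> nat) \<Rightarrow> nat" where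
  "weight m s g y \<tau> = of_bool (clash s (partial m g y) \<tau> = 0) *
     (m ^ assigned s \<tau> y * falling (m - assigned s \<tau> y) (s - assigned s \<tau> y))"

lemma clash_eq_0: "clash s f \<tau> = 0 \<longleftrightarrow> inj_on (\<lambda>i. f (\<tau> i)) {..<s}"
proof -
  have "clash s f \<tau> = 0 \<longleftrightarrow> (\<forall>i<s. \<forall>j<i. f (\<tau> i) \<noteq> f (\<tau> j))"
    by (auto simp: clash_def)
  also have "\<dots> \<longleftrightarrow> inj_on (\<lambda>i. f (\<tau> i)) {..<s}"
    unfolding inj_on_def by (metis lessThan_iff linorder_neqE_nat order.strict_trans nat_neq_iff)
  finally show ?thesis .
qed

lemma assigned_eq_card: "assigned s \<tau> y = card {i. i < s \<and> \<tau> i < y}"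
proof -
  have "assigned s \<tau> y = card ({..<s} \<inter> {i. \<tau> i < y})"
    unfolding assigned_def by (simp add: sum.If_cases of_bool_def)
  also have "{..<s} \<inter> {i. \<tau> i < y} = {i. i < s \<and> \<tau> i < y}" by auto
  finally show ?thesis .
qed

lemma falling_Suc: "falling m (Suc s) = m * falling (m - 1) s"
  unfolding falling_def prod.lessThan_Suc_shift by simp

text \<open>The law of total expectation for the value at \<open>y\<close>. If \<open>y\<close> is
  not in the tuple nothing changes, and an existing clash persists. Otherwise exactly
  \<open>m - a\<close> of the \<open>m\<close> values avoid the \<open>a\<close> values in use, and
  \<open>falling (m - a) (s - a)\<close> splits off this factor \<open>m - a\<close>.\<close>

lemma weight_average:
  assumes "s \<le> m" "\<And>x. x < y \<Longrightarrow> g x < m"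
  shows "(\<Sum>v<m. weight m s (g(y := v)) (Suc y) \<tau>) = m * weight m s g y \<tau>"
proof (cases "y \<in> \<tau> ` {..<s}")
  case False
  have "weight m s (g(y := v)) (Suc y) \<tau> = weight m s g y \<tau>" for v
  proof -
    have ne: "\<tau> i \<noteq> y" if "i < s" for i using that False by auto
    then have "partial m (g(y := v)) (Suc y) (\<tau> i) = partial m g y (\<tau> i)" if "i < s" for i
      using that by (auto simp: partial_def less_Suc_eq)
    then have "clash s (partial m (g(y := v)) (Suc y)) \<tau> = clash s (partial m g y) \<tau>"
      by (simp add: clash_def)
    moreover have "assigned s \<tau> (Suc y) = assigned s \<tau> y"
      using ne by (auto simp: assigned_def less_Suc_eq intro!: sum.cong)
    ultimately show ?thesis by (simp add: weight_def)
  qed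
  then show ?thesis by simp
next
  case True
  then obtain k where k: "k < s" "\<tau> k = y" by auto
  let ?p = "\<lambda>i. partial m g y (\<tau> i)" and ?q = "\<lambda>v i. partial m (g(y := v)) (Suc y) (\<tau> i)"
  show ?thesis
  proof (cases "clash s (partial m g y) \<tau> = 0")
    case False
    then obtain i j where ij: "i < s" "j < s" "i \<noteq> j" "?p i = ?p j"
      unfolding clash_eq_0 inj_on_def by auto
    \<comment> \<open>Values \<open>m + x\<close> never meet values below \<open>m\<close>, so the
      clash is between two assigned points or repeats a point; fixing the value at \<open>y\<close>
      undoes neither.\<close>
    have "?q v i = ?q v j" for v
      using ij(4) assms(2)[of "\<tau> i"] assms(2)[of "\<tau> j"] by (auto simp: partial_def split: if_splits)
    then have "clash s (partial m (g(y := v)) (Suc y)) \<tau> \<noteq> 0" for v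
      unfolding clash_eq_0 inj_on_def using ij by auto
    then have "weight m s (g(y := v)) (Suc y) \<tau> = 0" for v by (simp add: weight_def)
    moreover have "weight m s g y \<tau> = 0" using False by (simp add: weight_def)
    ultimately show ?thesis by simp
  next
    case True
    then have inj: "inj_on ?p {..<s}" by (simp add: clash_eq_0)
    let ?A = "{i. i < s \<and> \<tau> i < y}"
    let ?V = "(\<lambda>i. g (\<tau> i)) ` ?A"
    let ?a = "assigned s \<tau> y"
    have uniq: "i = k" if "i < s" "\<tau> i = y" for i
      by (rule inj_onD[OF inj]) (use that k in auto)
    have "inj_on (\<lambda>i. g (\<tau> i)) ?A"
    proof (rule inj_onI)
      fix i j assume "i \<in> ?A" "j \<in> ?A" "g (\<tau> i) = g (\<tau> j)"
      then show "i = j" using inj_onD[OF inj, of i j] by (simp add: partial_def)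
    qed
    then have cV: "card ?V = ?a" by (simp add: card_image assigned_eq_card)
    have V: "?V \<subseteq> {..<m}" using assms(2) by auto
    have "{i. i < s \<and> \<tau> i < Suc y} = insert k ?A"
    proof (rule set_eqI)
      fix i
      show "i \<in> {i. i < s \<and> \<tau> i < Suc y} \<longleftrightarrow> i \<in> insert k ?A"
        using k uniq[of i] by (auto simp: less_Suc_eq)
    qed
    then have a': "assigned s \<tau> (Suc y) = Suc ?a" using k by (simp add: assigned_eq_card)
    have "?A \<subset> {..<s}" using k by auto
    then have "?a < s" using psubset_card_mono[of "{..<s}" ?A] by (simp add: assigned_eq_card)
    then have s: "s - ?a = Suc (s - Suc ?a)" by simp
    \<comment> \<open>Unassigned points carry values from \<open>m\<close> upward, so only the
      values in \<open>?V\<close> can block \<open>v\<close>.\<close>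
    have free: "clash s (partial m (g(y := v)) (Suc y)) \<tau> = 0 \<longleftrightarrow> v \<notin> ?V" if "v < m" for v
    proof -
      have s: "{..<s} = insert k ({..<s} - {k})" using k by auto
      have other: "?q v i = ?p i" if "i \<in> {..<s} - {k}" for i
        using that uniq[of i] by (auto simp: partial_def less_Suc_eq)
      have "inj_on (?q v) ({..<s} - {k}) = inj_on ?p ({..<s} - {k})"
        by (rule inj_on_cong[OF other])
      then have "inj_on (?q v) ({..<s} - {k})" using inj_on_diff[OF inj] by simp
      then have "inj_on (?q v) (insert k ({..<s} - {k})) \<longleftrightarrow> ?q v k \<notin> ?q v ` ({..<s} - {k})"
        by (simp only: inj_on_insert Diff_idemp simp_thms)
      then have "clash s (partial m (g(y := v)) (Suc y)) \<tau> = 0 \<longleftrightarrow> ?q v k \<notin> ?q v ` ({..<s} - {k})"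
        unfolding clash_eq_0 s[symmetric] .
      also have "?q v ` ({..<s} - {k}) = ?p ` ({..<s} - {k})" using other by (intro image_cong) auto
      also have "?q v k = v" using k by (simp add: partial_def)
      also have "v \<notin> ?p ` ({..<s} - {k}) \<longleftrightarrow> v \<notin> ?V"
        using that k by (auto simp: partial_def image_iff)
      finally show ?thesis .
    qed
    let ?c = "m ^ Suc ?a * falling (m - Suc ?a) (s - Suc ?a)"
    have "(\<Sum>v<m. weight m s (g(y := v)) (Suc y) \<tau>) = (\<Sum>v<m. of_bool (v \<notin> ?V) * ?c)"
      using free by (intro sum.cong) (auto simp: weight_def a')
    also have "\<dots> = (\<Sum>v\<in>{..<m} - ?V. ?c)"
      by (intro sum.mono_neutral_cong_right) auto
    also have "\<dots> = card ({..<m} - ?V) * ?c" by simp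
    also have "card ({..<m} - ?V) = m - ?a" using V cV by (simp add: card_Diff_subset finite_subset)
    also have "(m - ?a) * ?c = m * (m ^ ?a * falling (m - ?a) (s - ?a))"
      unfolding s falling_Suc by simp
    also have "m ^ ?a * falling (m - ?a) (s - ?a) = weight m s g y \<tau>"
      using True by (simp add: weight_def)
    finally show ?thesis .
  qed
qed

text \<open>
  The induction step passes from \<open>(s, m - 1)\<close> to \<open>(s + 1, m)\<close>; it works because
  \<open>s / (m - 1) \<le> (s + 1) / m\<close> for \<open>s + 1 \<le> m\<close>.
\<close>

lemma falling_ge: "s \<le> m \<Longrightarrow> real m ^ s * exp (- (real s ^ 2 / real m)) \<le> real (falling m s)"
proof (induction s arbitrary: m)
  case 0
  show ?case by (simp add: falling_def)
next
  case (Suc s)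
  show ?case
  proof (cases "s = 0")
    case True
    then show ?thesis by (simp add: falling_def mult_left_le)
  next
    case False
    then have m: "real m > 1" using Suc.prems by simp
    have eq: "real (m - 1) = real m - 1" using Suc.prems by (simp add: of_nat_diff)
    have IH: "(real m - 1) ^ s * exp (- (real s ^ 2 / (real m - 1))) \<le> real (falling (m - 1) s)"
      using Suc.IH[of "m - 1"] Suc.prems eq by simp
    \<comment> \<open>This is \<open>1 + x \<le> exp x\<close> at \<open>x = 1 / (m - 1)\<close>,
      where \<open>1 + x = m / (m - 1)\<close>.\<close>
    have "real m * exp (- (1 / (real m - 1))) \<le> real m - 1"
      using exp_ge_add_one_self[of "1 / (real m - 1)"] m
      by (simp add: exp_minus field_simps)
    then have "(real m * exp (- (1 / (real m - 1)))) ^ s \<le> (real m - 1) ^ s"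
      by (intro power_mono) auto
    then have pow: "real m ^ s * exp (- (real s / (real m - 1))) \<le> (real m - 1) ^ s"
      by (simp add: power_mult_distrib flip: exp_of_nat_mult)
    have "real (Suc s) * real s / (real m - 1) \<le> real (Suc s) * (real (Suc s) / real m)"
    proof -
      have "real s / (real m - 1) \<le> real (Suc s) / real m"
        using m Suc.prems by (simp add: field_simps)
      from mult_left_mono[OF this, of "real (Suc s)"] show ?thesis by simp
    qed
    then have "real (Suc s) * real s / (real m - 1) \<le> real (Suc s) ^ 2 / real m"
      by (simp add: power2_eq_square)
    then have "- (real (Suc s) ^ 2 / real m) \<le> - (real s / (real m - 1)) + - (real s ^ 2 / (real m - 1))"
      by (simp add: power2_eq_square algebra_simps add_divide_distrib)
    then have "exp (- (real (Suc s) ^ 2 / real m)) \<le> exp (- (real s / (real m - 1))) * exp (- (real s ^ 2 / (real m - 1)))"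
      by (simp flip: exp_add)
    then have "real m ^ Suc s * exp (- (real (Suc s) ^ 2 / real m)) \<le>
        real m ^ Suc s * (exp (- (real s / (real m - 1))) * exp (- (real s ^ 2 / (real m - 1))))"
      by (rule mult_left_mono) simp
    also have "\<dots> = real m * ((real m ^ s * exp (- (real s / (real m - 1)))) * exp (- (real s ^ 2 / (real m - 1))))"
      by simp
    also have "\<dots> \<le> real m * ((real m - 1) ^ s * exp (- (real s ^ 2 / (real m - 1))))"
      using pow by (intro mult_left_mono mult_right_mono) auto
    also have "\<dots> \<le> real m * real (falling (m - 1) s)" using IH by (intro mult_left_mono) auto
    finally show ?thesis by (simp add: falling_Suc)
  qed
qed

section \<open>Progress of the greedy cover and the number of rounds\<close>

definition missed :: "nat \<Rightarrow> (nat \<Rightarrow> nat \<Rightarrow> nat) \<Rightarrow> nat \<Rightarrow> (nat \<Rightarrow> nat) \<Rightarrow> nat" where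
  "missed s g r \<tau> = of_bool ((\<Sum>r'<r. of_bool (clash s (g r') \<tau> = 0) :: nat) = 0)"

text \<open>Tuples with a repeated entry are left out, since no function is injective on
  them.\<close>

definition uncovered :: "nat \<Rightarrow> nat \<Rightarrow> (nat \<Rightarrow> nat \<Rightarrow> nat) \<Rightarrow> (nat \<Rightarrow> nat \<Rightarrow> nat) \<Rightarrow> nat \<Rightarrow> nat" where
  "uncovered M s \<tau> g r = (\<Sum>t<M. of_bool (clash s (\<lambda>x. x) (\<tau> t) = 0) * missed s g r (\<tau> t))"

text \<open>\<open>m ^ s\<close> times the expected number of missed tuples that a function will
  cover if it agrees with \<open>f\<close> below \<open>y\<close> and is random elsewhere. A tuple
  with a repeated entry contributes 0, as equal points always clash.\<close>

definition potential ::
    "nat \<Rightarrow> nat \<Rightarrow> nat \<Rightarrow> (nat \<Rightarrow> nat \<Rightarrow> nat) \<Rightarrow> (nat \<Rightarrow> nat \<Rightarrow> nat) \<Rightarrow> nat \<Rightarrow> (nat \<Rightarrow> nat) \<Rightarrow> nat \<Rightarrow> nat" where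
  "potential M m s \<tau> g r f y = (\<Sum>t<M. missed s g r (\<tau> t) * weight m s f y (\<tau> t))"

text \<open>\<open>M\<close> is both the number of tuples and the number of rows. While a tuple is
  missed, each row covers at least one more, so \<open>M\<close> rows always suffice, and how many
  are really used is read off afterwards.\<close>

locale greedy_cover =
  fixes M m s q :: nat and \<tau> g :: "nat \<Rightarrow> nat \<Rightarrow> nat"
  assumes s_le: "s \<le> m" and m_pos: "0 < m" and M_pos: "0 < M"
    and tuple: "\<And>t i. t < M \<Longrightarrow> i < s \<Longrightarrow> \<tau> t i < q"
    and range: "\<And>r y. r < M \<Longrightarrow> y < q \<Longrightarrow> g r y < m"
    and greedy: "\<And>r y v. r < M \<Longrightarrow> y < q \<Longrightarrow> v < m \<Longrightarrow>
      potential M m s \<tau> g r ((g r)(y := v)) (Suc y) \<le> potential M m s \<tau> g r (g r) (Suc y)"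
begin

abbreviation "U \<equiv> uncovered M s \<tau> g"

text \<open>The chosen value does at least as well as the average over all \<open>v\<close>, and
  that average is the potential before the choice.\<close>

lemma potential_step:
  assumes "r < M" "y < q"
  shows "potential M m s \<tau> g r (g r) y \<le> potential M m s \<tau> g r (g r) (Suc y)"
proof -
  have "m * potential M m s \<tau> g r (g r) y = (\<Sum>t<M. missed s g r (\<tau> t) * (m * weight m s (g r) y (\<tau> t)))"
    by (simp add: potential_def sum_distrib_left mult.left_commute)
  also have "\<dots> = (\<Sum>t<M. missed s g r (\<tau> t) * (\<Sum>v<m. weight m s ((g r)(y := v)) (Suc y) (\<tau> t)))"
    using weight_average[OF s_le, of y "g r"] range assms by simp
  also have "\<dots> = (\<Sum>v<m. potential M m s \<tau> g r ((g r)(y := v)) (Suc y))"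
    unfolding potential_def sum_distrib_left by (rule sum.swap)
  also have "\<dots> \<le> (\<Sum>v<m. potential M m s \<tau> g r (g r) (Suc y))"
    using greedy assms by (intro sum_mono) auto
  finally show ?thesis using m_pos by simp
qed

lemma potential_mono:
  assumes "r < M"
  shows "y \<le> q \<Longrightarrow> potential M m s \<tau> g r (g r) 0 \<le> potential M m s \<tau> g r (g r) y"
proof (induction y)
  case (Suc y)
  then show ?case using potential_step[OF assms, of y] by simp
qed simp

text \<open>Compare the two ends of a row. Before any value is set the potential is
  \<open>U r * falling m s\<close>, the expectation for a random function; once all are set it is
  \<open>m ^ s\<close> times the number of tuples newly covered. Greedy choices never let it drop in
  between.\<close>

lemma uncovered_step:
  assumes "r < M"
  shows "U (Suc r) * m ^ s + U r * falling m s \<le> U r * m ^ s"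
proof -
  have "clash s (\<lambda>x. m + x) \<tau>' = clash s (\<lambda>x. x) \<tau>'" for \<tau>' by (simp add: clash_def)
  then have "weight m s (g r) 0 \<tau>' = of_bool (clash s (\<lambda>x. x) \<tau>' = 0) * falling m s" for \<tau>'
    by (simp add: weight_def assigned_def partial_def[abs_def])
  then have "potential M m s \<tau> g r (g r) 0 = U r * falling m s"
    unfolding potential_def uncovered_def sum_distrib_right by (intro sum.cong) (simp_all only: mult_ac)
  then have le: "U r * falling m s \<le> potential M m s \<tau> g r (g r) q"
    using potential_mono[OF assms, of q] by simp
  have final: "weight m s (g r) q (\<tau> t) = of_bool (clash s (g r) (\<tau> t) = 0) * m ^ s" if "t < M" for t
  proof -
    have "assigned s (\<tau> t) q = s" using tuple[OF that] by (simp add: assigned_def)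
    moreover have "clash s (partial m (g r) q) (\<tau> t) = clash s (g r) (\<tau> t)"
      using tuple[OF that] by (simp add: clash_def partial_def)
    ultimately show ?thesis by (simp add: weight_def falling_def)
  qed
  have "of_bool (clash s (\<lambda>x. x) \<tau>' = 0) * missed s g (Suc r) \<tau>' +
      missed s g r \<tau>' * of_bool (clash s (g r) \<tau>' = 0) = of_bool (clash s (\<lambda>x. x) \<tau>' = 0) * missed s g r \<tau>'" for \<tau>'
  proof -
    have "clash s (\<lambda>x. x) \<tau>' = 0" if "clash s (g r) \<tau>' = 0"
      using that unfolding clash_eq_0 inj_on_def by metis
    then show ?thesis by (auto simp: missed_def)
  qed
  then have "U (Suc r) + (\<Sum>t<M. missed s g r (\<tau> t) * of_bool (clash s (g r) (\<tau> t) = 0)) = U r"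
    by (simp only: uncovered_def flip: sum.distrib)
  moreover have "potential M m s \<tau> g r (g r) q = (\<Sum>t<M. missed s g r (\<tau> t) * of_bool (clash s (g r) (\<tau> t) = 0)) * m ^ s"
    unfolding potential_def sum_distrib_right by (intro sum.cong) (simp_all add: final mult.assoc)
  ultimately have "U (Suc r) * m ^ s + potential M m s \<tau> g r (g r) q = U r * m ^ s"
    by (simp only: flip: distrib_right)
  then show ?thesis using le by linarith
qed

lemma falling_pos: "0 < falling m s"
  using s_le by (auto simp: falling_def)

lemma uncovered_decreases: "r < M \<Longrightarrow> 0 < U r \<Longrightarrow> U (Suc r) < U r"
proof -
  assume "r < M" "0 < U r"
  then have "U (Suc r) * m ^ s < U r * m ^ s"
    using uncovered_step[of r] falling_pos mult_pos_pos[of "U r" "falling m s"] by linarith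
  then show ?thesis by simp
qed

lemma uncovered_le: "r \<le> M \<Longrightarrow> U r \<le> M - r"
proof (induction r)
  case 0
  have "U 0 \<le> (\<Sum>t<M. 1)" unfolding uncovered_def by (intro sum_mono) (auto simp: missed_def)
  then show ?case by simp
next
  case (Suc r)
  have "U (Suc r) \<le> U r - 1"
    using uncovered_decreases[of r] uncovered_step[of r] Suc.prems m_pos
    by (cases "U r = 0") auto
  then show ?case using Suc by simp
qed

definition rounds :: nat where
  "rounds = (\<Sum>r<M. of_bool (0 < U r))"

text \<open>\<open>U\<close> never increases and vanishes at \<open>M\<close>, so the rows with
  something left form an initial segment. The count \<open>rounds\<close>, which a program evaluates
  as a sum, is therefore the first index with nothing left.\<close>

lemma uncovered_pos_iff: "r < M \<Longrightarrow> 0 < U r \<longleftrightarrow> r < rounds"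
proof -
  define r0 where "r0 = (LEAST r. U r = 0)"
  have "U M = 0" using uncovered_le[of M] by simp
  then have r0: "U r0 = 0" "r0 \<le> M" unfolding r0_def by (auto intro: LeastI Least_le)
  have before: "0 < U r" if "r < r0" for r using not_less_Least[of r "\<lambda>r. U r = 0"] that r0_def by auto
  have after: "U r = 0" if "r0 \<le> r" "r \<le> M" for r
    using that
  proof (induction r rule: dec_induct)
    case (step r)
    then show ?case using uncovered_step[of r] m_pos by simp
  qed (rule r0)
  have "{..<M} \<inter> {r. 0 < U r} = {..<r0}"
  proof (rule set_eqI)
    fix r
    show "r \<in> {..<M} \<inter> {r. 0 < U r} \<longleftrightarrow> r \<in> {..<r0}"
      using before[of r] after[of r] r0(2) by (cases "r < r0") auto
  qed
  then have "rounds = r0" by (simp add: rounds_def of_bool_def sum.If_cases)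
  then show "r < M \<Longrightarrow> 0 < U r \<longleftrightarrow> r < rounds"
    using before after[of r] by (cases "r < r0") auto
qed

lemma covered:
  assumes "t < M" "inj_on (\<tau> t) {..<s}"
  shows "\<exists>r<rounds. inj_on (\<lambda>i. g r (\<tau> t i)) {..<s}"
proof (rule ccontr)
  assume no: "\<not> ?thesis"
  have "rounds \<le> (\<Sum>r<M. 1)" unfolding rounds_def by (intro sum_mono) auto
  then have le: "rounds \<le> M" by simp
  have "U rounds = 0"
    using uncovered_pos_iff[of rounds] uncovered_le[of M] le by (cases "rounds = M") auto
  moreover have "missed s g rounds (\<tau> t) = 1"
    using no by (auto simp: missed_def clash_eq_0)
  moreover have "clash s (\<lambda>x. x) (\<tau> t) = 0" using assms by (simp add: clash_eq_0)
  ultimately show False using assms(1) unfolding uncovered_def by auto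
qed

text \<open>Each round leaves at most a fraction \<open>1 - p \<le> exp (- p)\<close> of the tuples,
  where \<open>p \<ge> exp (- s^2 / m)\<close>. Before the last round at least one tuple remains, so
  \<open>p * (rounds - 1) \<le> ln M\<close>; the summand 1 is that last round.\<close>

lemma rounds_le: "real rounds \<le> 1 + ln (real M) * exp (real s ^ 2 / real m)"
proof (cases "rounds = 0")
  case True
  then show ?thesis using M_pos by simp
next
  case False
  define p where "p = real (falling m s) / real m ^ s"
  have M0: "real (U 0) \<le> real M" using uncovered_le[of 0] by simp
  have U: "real (U r) \<le> real M * exp (- p * real r)" if "r \<le> M" for r
    using that
  proof (induction r)
    case (Suc r)
    have "real (U (Suc r) * m ^ s + U r * falling m s) \<le> real (U r * m ^ s)"
      using uncovered_step[of r] Suc.prems by (simp only: of_nat_le_iff)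
    then have "real (U (Suc r)) \<le> real (U r) * (1 - p)"
      using m_pos by (simp add: p_def field_simps)
    also have "\<dots> \<le> real (U r) * exp (- p)"
      using exp_ge_add_one_self[of "- p"] by (intro mult_left_mono) auto
    also have "\<dots> \<le> (real M * exp (- p * real r)) * exp (- p)"
      using Suc by (intro mult_right_mono) auto
    finally show ?case by (simp add: algebra_simps flip: exp_add)
  qed (use M0 in simp)
  have "rounds \<le> (\<Sum>r<M. 1)" unfolding rounds_def by (intro sum_mono) auto
  then have "rounds - 1 < M" using False by simp
  then have "0 < U (rounds - 1)" using uncovered_pos_iff[of "rounds - 1"] False by simp
  then have "1 \<le> real M * exp (- p * real (rounds - 1))"
    using U[of "rounds - 1"] \<open>rounds - 1 < M\<close> by linarith
  then have "exp (p * real (rounds - 1)) \<le> real M" by (simp add: exp_minus field_simps)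
  then have ln: "p * real (rounds - 1) \<le> ln (real M)"
    using M_pos by (subst ln_ge_iff) auto
  have p: "exp (- (real s ^ 2 / real m)) \<le> p"
    using falling_ge[OF s_le] m_pos by (simp add: p_def field_simps)
  have "exp (- (real s ^ 2 / real m)) * real (rounds - 1) \<le> ln (real M)"
    using ln mult_right_mono[OF p, of "real (rounds - 1)"] by linarith
  then have "real (rounds - 1) \<le> ln (real M) * exp (real s ^ 2 / real m)"
    by (simp add: exp_minus field_simps)
  then show ?thesis using False by (simp add: of_nat_diff)
qed

end

section \<open>Colourings from cuts and special points\<close>


text \<open>The answer is shifted by one so that 0 can mean that \<open>x\<close> is not
  special.\<close>

primrec special :: "(nat \<Rightarrow> nat) \<Rightarrow> nat \<Rightarrow> nat \<Rightarrow> nat" where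
  "special p x 0 = 0"
| "special p x (Suc e) = (if p e = x then Suc e else special p x e)"

text \<open>The number of cuts at or below \<open>x\<close> is the number of its interval, for cuts
  listed in any order.\<close>

definition block :: "(nat \<Rightarrow> nat) \<Rightarrow> nat \<Rightarrow> nat \<Rightarrow> nat" where
  "block p x N = (\<Sum>j<N. of_bool (p j < Suc x))"

text \<open>One sequence \<open>p\<close> holds both guesses: \<open>b - 1\<close> cuts, then
  \<open>r\<close> special points. Interval \<open>B\<close> owns the colours
  \<open>B * m + 1\<close> to \<open>B * m + m\<close>, and the special points own the
  \<open>r\<close> colours after \<open>b * m\<close>, whichever interval they lie in.\<close>

definition colour :: "nat \<Rightarrow> nat \<Rightarrow> nat \<Rightarrow> (nat \<Rightarrow> nat) \<Rightarrow> (nat \<Rightarrow> nat \<Rightarrow> nat) \<Rightarrow> nat \<Rightarrow> nat" where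
  "colour b m r p g x =
     (let e = special (\<lambda>e. p (b - 1 + e)) x r; B = block p x (b - 1)
      in if e \<noteq> 0 then b * m + e else B * m + g B x + 1)"

lemma special_le: "special p x r \<le> r"
  by (induction r) auto

lemma special_eq_0: "(\<And>e. e < r \<Longrightarrow> p e \<noteq> x) \<Longrightarrow> special p x r = 0"
  by (induction r) auto

lemma special_eq_Suc: "inj_on p {..<r} \<Longrightarrow> e < r \<Longrightarrow> special p (p e) r = Suc e"
proof (induction r)
  case (Suc r)
  then show ?case using inj_onD[OF Suc.prems(1), of r e]
    by (auto simp: less_Suc_eq lessThan_Suc intro: inj_on_subset)
qed simp

lemma block_le: "block p x N \<le> N"
proof -
  have "block p x N \<le> (\<Sum>j<N. 1)" unfolding block_def by (intro sum_mono) auto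
  then show ?thesis by simp
qed

lemma colour_range:
  assumes "0 < b" "\<And>B. B < b \<Longrightarrow> g B x < m"
  shows "colour b m r p g x \<in> {1..b * m + r}"
proof -
  let ?B = "block p x (b - 1)"
  have "?B < b" using block_le[of p x "b - 1"] assms(1) by simp
  then have "?B * m + g ?B x + 1 \<le> Suc ?B * m" using assms(2)[of ?B] by simp
  also have "\<dots> \<le> b * m" using \<open>?B < b\<close> by (intro mult_right_mono) auto
  finally have "?B * m + g ?B x + 1 \<le> b * m" .
  then show ?thesis using special_le[of "\<lambda>e. p (b - 1 + e)" x r] by (auto simp: colour_def Let_def)
qed

lemma block_cong: "(\<And>j. j < N \<Longrightarrow> p j = p' j) \<Longrightarrow> block p x N = block p' x N"
  by (simp add: block_def)

lemma special_cong: "(\<And>j. j < N \<Longrightarrow> p j = p' j) \<Longrightarrow> special p x N = special p' x N"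
  by (induction N) auto

lemma colour_cong:
  assumes "0 < b" "\<And>j. j < b - 1 + r \<Longrightarrow> p j = p' j" "\<And>B. B < b \<Longrightarrow> g B x = g' B x"
  shows "colour b m r p g x = colour b m r p' g' x"
proof -
  have "special (\<lambda>e. p (b - 1 + e)) x r = special (\<lambda>e. p' (b - 1 + e)) x r"
    using assms(2) by (intro special_cong) auto
  moreover have eq: "block p x (b - 1) = block p' x (b - 1)"
    using assms(2) by (intro block_cong) auto
  moreover have "block p' x (b - 1) < b" using block_le[of p' x "b - 1"] assms(1) by simp
  then have "g (block p' x (b - 1)) x = g' (block p' x (b - 1)) x" by (rule assms(3))
  ultimately show ?thesis by (simp add: colour_def Let_def)
qed

text \<open>
  The cuts are chosen so that each of the \<open>b\<close> intervals contains \<open>s\<close> elements of \<open>Y\<close>; the \<open>r\<close>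
  largest elements of \<open>Y\<close> become special points with private colours.
\<close>

lemma exists_injective_colour:
  assumes Y: "Y \<subseteq> {..<q}" "card Y = b * s + r" and pos: "0 < b" "0 < s"
    and range: "\<And>i x. i < R \<Longrightarrow> x < q \<Longrightarrow> g i x < m"
    and cover: "\<And>\<tau>. (\<And>i. i < s \<Longrightarrow> \<tau> i < q) \<Longrightarrow> inj_on \<tau> {..<s} \<Longrightarrow>
      \<exists>i<R. inj_on (\<lambda>e. g i (\<tau> e)) {..<s}"
  obtains p u where "\<And>j. j < b - 1 + r \<Longrightarrow> p j < q" "\<And>B. B < b \<Longrightarrow> u B < R"
    "inj_on (colour b m r p (\<lambda>B. g (u B))) Y"
proof -
  define N where "N = b * s + r"
  define y where "y = (!) (sorted_list_of_set Y)"
  have fin: "finite Y" using Y finite_subset by blast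
  have mono: "y i < y j" if "i < j" "j < N" for i j
    unfolding y_def using that Y
    by (intro sorted_wrt_nth_less[OF strict_sorted_list_of_set]) (auto simp: N_def)
  have y_in: "y i \<in> Y" if "i < N" for i
    using nth_mem[of i "sorted_list_of_set Y"] that fin Y by (simp add: y_def N_def)
  have y_surj: "\<exists>i<N. z = y i" if "z \<in> Y" for z
    using that fin Y in_set_conv_nth[of z "sorted_list_of_set Y"] by (auto simp: y_def N_def)
  have y_eq: "y i = y j \<longleftrightarrow> i = j" if "i < N" "j < N" for i j
    using mono[of i j] mono[of j i] that by (cases i j rule: linorder_cases) auto
  have y_le: "y i < Suc (y j) \<longleftrightarrow> i \<le> j" if "i < N" "j < N" for i j
    using mono[of i j] mono[of j i] that by (cases i j rule: linorder_cases) auto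
  have y_q: "y i < q" if "i < N" for i using y_in[OF that] Y by auto
  have part: "B * s + i < b * s" if "B < b" "i < s" for B i
  proof -
    have "B * s + i < Suc B * s" using that by simp
    also have "\<dots> \<le> b * s" using that by (intro mult_right_mono) auto
    finally show ?thesis .
  qed
  \<comment> \<open>Each run of \<open>s\<close> consecutive ranks is an injective tuple, so the
    cover supplies a function for it, independently for each interval.\<close>
  have "\<exists>i<R. inj_on (\<lambda>e. g i (y (B * s + e))) {..<s}" if "B < b" for B
  proof (rule cover[of "\<lambda>e. y (B * s + e)"])
    show "inj_on (\<lambda>e. y (B * s + e)) {..<s}"
      using part[OF that] y_eq by (intro inj_onI) (auto simp: N_def trans_less_add1)
  qed (use part[OF that] y_q in \<open>auto simp: N_def trans_less_add1\<close>)
  then obtain u where u: "\<And>B. B < b \<Longrightarrow> u B < R"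
    "\<And>B. B < b \<Longrightarrow> inj_on (\<lambda>e. g (u B) (y (B * s + e))) {..<s}"
    by metis
  \<comment> \<open>Ranks count from 0. Cut \<open>j\<close> is the element of rank
    \<open>Suc j * s\<close>, the first one of interval \<open>Suc j\<close>; the elements from rank
    \<open>b * s\<close> on become special.\<close>
  define p where "p j = (if j < b - 1 then y (Suc j * s) else y (b * s + (j - (b - 1))))" for j
  have cut: "Suc j * s < b * s" if "j < b - 1" for j using part[of "Suc j" 0] that pos by simp
  have p_q: "p j < q" if "j < b - 1 + r" for j
    using that y_q cut[of j] by (auto simp: p_def N_def trans_less_add1)
  have sp: "p (b - 1 + e) = y (b * s + e)" for e by (simp add: p_def)
  have high: "colour b m r p (\<lambda>B. g (u B)) (y (b * s + e)) = b * m + Suc e" if "e < r" for e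
  proof -
    have "inj_on (\<lambda>e. p (b - 1 + e)) {..<r}"
      unfolding sp using y_eq by (intro inj_onI) (auto simp: N_def)
    from special_eq_Suc[OF this that] have "special (\<lambda>e. p (b - 1 + e)) (y (b * s + e)) r = Suc e"
      by (simp only: sp)
    then show ?thesis by (simp add: colour_def Let_def)
  qed
  have low: "colour b m r p (\<lambda>B. g (u B)) (y e) = (e div s) * m + g (u (e div s)) (y e) + 1"
    if e: "e < b * s" for e
  proof -
    have "special (\<lambda>e. p (b - 1 + e)) (y e) r = 0"
      unfolding sp using y_eq e by (intro special_eq_0) (auto simp: N_def)
    moreover have "block p (y e) (b - 1) = e div s"
    proof -
      have "p j < Suc (y e) \<longleftrightarrow> j < e div s" if j: "j < b - 1" for j
      proof -
        have "p j < Suc (y e) \<longleftrightarrow> Suc j * s \<le> e"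
          using y_le[of "Suc j * s" e] cut[OF j] e j by (simp add: p_def N_def)
        also have "\<dots> \<longleftrightarrow> Suc j \<le> e div s" using pos by (simp add: less_eq_div_iff_mult_less_eq)
        finally show ?thesis by auto
      qed
      then have "block p (y e) (b - 1) = (\<Sum>j<b - 1. of_bool (j < e div s))"
        unfolding block_def by (intro sum.cong) auto
      also have "\<dots> = card ({..<b - 1} \<inter> {j. j < e div s})"
        by (simp add: of_bool_def sum.If_cases)
      also have "e div s < b" using e pos by (simp add: less_mult_imp_div_less)
      then have "{..<b - 1} \<inter> {j. j < e div s} = {..<e div s}" by auto
      finally show ?thesis by simp
    qed
    ultimately show ?thesis by (simp add: colour_def Let_def)
  qed
  have low_le: "colour b m r p (\<lambda>B. g (u B)) (y e) \<le> b * m" if e: "e < b * s" for e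
  proof -
    have B: "e div s < b" using e pos by (simp add: less_mult_imp_div_less)
    then have "(e div s) * m + g (u (e div s)) (y e) + 1 \<le> Suc (e div s) * m"
      using range[OF u(1)[OF B] y_q[of e]] e by (simp add: N_def)
    also have "\<dots> \<le> b * m" using B by (intro mult_right_mono) auto
    finally show ?thesis using low[OF e] by simp
  qed
  have "inj_on (colour b m r p (\<lambda>B. g (u B))) Y"
  proof (rule inj_onI)
    fix x x' assume xx: "x \<in> Y" "x' \<in> Y"
      and eq: "colour b m r p (\<lambda>B. g (u B)) x = colour b m r p (\<lambda>B. g (u B)) x'"
    obtain e e' where e: "x = y e" "e < N" "x' = y e'" "e' < N"
      using y_surj[OF xx(1)] y_surj[OF xx(2)] by blast
    have split: "e < b * s \<or> (\<exists>f<r. e = b * s + f)" if "e < N" for e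
      using that by (auto simp: N_def intro!: exI[of _ "e - b * s"])
    have "e = e'"
    proof (cases "e < b * s"; cases "e' < b * s")
      assume a: "e < b * s" "e' < b * s"
      have B: "e div s < b" "e' div s < b" using a pos by (simp_all add: less_mult_imp_div_less)
      have g: "g (u (e div s)) (y e) < m" "g (u (e' div s)) (y e') < m"
        using range u(1) B y_q e by auto
      have eq': "(e div s) * m + g (u (e div s)) (y e) = (e' div s) * m + g (u (e' div s)) (y e')"
        using eq low a e by simp
      \<comment> \<open>Values of \<open>g\<close> are below \<open>m\<close>, so the quotient by
        \<open>m\<close> recovers the interval, and the values of \<open>g\<close> must then agree
        as well.\<close>
      then have "((e div s) * m + g (u (e div s)) (y e)) div m = ((e' div s) * m + g (u (e' div s)) (y e')) div m"
        by simp
      then have d: "e div s = e' div s" using g by simp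
      have "e div s * s + e mod s = e" by simp
      moreover have "e div s * s + e' mod s = e'" unfolding d by simp
      ultimately have "g (u (e div s)) (y (e div s * s + e mod s)) = g (u (e div s)) (y (e div s * s + e' mod s))"
        using eq' d by simp
      then have "e mod s = e' mod s"
        using inj_onD[OF u(2)[OF B(1)], of "e mod s" "e' mod s"] pos by simp
      then have "e div s * s + e mod s = e' div s * s + e' mod s" by (simp only: d)
      then show ?thesis by (simp only: div_mult_mod_eq)
    next
      assume a: "e < b * s" "\<not> e' < b * s"
      then obtain f where "f < r" "e' = b * s + f" using split[OF e(4)] by blast
      then show ?thesis using eq low_le[OF a(1)] high[of f] e by simp
    next
      assume a: "\<not> e < b * s" "e' < b * s"
      then obtain f where "f < r" "e = b * s + f" using split[OF e(2)] by blast
      then show ?thesis using eq low_le[OF a(2)] high[of f] e by simp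
    next
      assume a: "\<not> e < b * s" "\<not> e' < b * s"
      then obtain f f' where "f < r" "e = b * s + f" "f' < r" "e' = b * s + f'"
        using split[OF e(2)] split[OF e(4)] by blast
      then show ?thesis using eq high[of f] high[of f'] e by simp
    qed
    then show "x = x'" using e by simp
  qed
  then show thesis by (intro that[of p u] p_q u(1))
qed

text \<open>For \<open>k < l\<close> the lower bound is 0 and injectivity gives the upper bound. For
  \<open>k = l\<close> both bounds are 1, and an injective map on \<open>k\<close> points uses every
  colour.\<close>

lemma splitter_of_injective:
  assumes "1 \<le> k" "k \<le> l" "H \<subseteq> {1..n} \<rightarrow>\<^sub>E {1..l}"
    "\<And>S. S \<subseteq> {1..n} \<Longrightarrow> card S = k \<Longrightarrow> \<exists>f\<in>H. inj_on f S"
  shows "splitter n k l H"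
  unfolding splitter_def
proof (intro conjI allI impI)
  show "H \<subseteq> {1..n} \<rightarrow>\<^sub>E {1..l}" by fact
  fix S assume S: "S \<subseteq> {1..n} \<and> card S = k"
  then obtain f where f: "f \<in> H" "inj_on f S" using assms(4) by blast
  have fin: "finite S" using S finite_subset by blast
  have "\<lfloor>real k / real l\<rfloor> \<le> int (card (f -` {j} \<inter> S)) \<and> int (card (f -` {j} \<inter> S)) \<le> \<lceil>real k / real l\<rceil>"
    if j: "j \<in> {1..l}" for j
  proof
    have "0 < \<lceil>real k / real l\<rceil>" using assms(1,2) by simp
    moreover have "card (f -` {j} \<inter> S) \<le> 1"
      using f(2) fin by (subst card_le_Suc0_iff_eq[simplified One_nat_def[symmetric]]) (auto dest: inj_onD)
    ultimately show "int (card (f -` {j} \<inter> S)) \<le> \<lceil>real k / real l\<rceil>" by linarith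
    show "\<lfloor>real k / real l\<rfloor> \<le> int (card (f -` {j} \<inter> S))"
    proof (cases "k = l")
      case True
      have "f ` S \<subseteq> {1..l}" using f(1) assms(3) S by (auto simp: PiE_iff subset_iff)
      moreover have "card (f ` S) = card {1..l}" using f(2) S True by (simp add: card_image)
      ultimately have "f ` S = {1..l}" by (intro card_subset_eq) auto
      then have "j \<in> f ` S" using j by simp
      then have "f -` {j} \<inter> S \<noteq> {}" by auto
      then have "0 < card (f -` {j} \<inter> S)" using fin by (simp add: card_gt_0_iff)
      then show ?thesis using True assms(1) by simp
    next
      case False
      then have "real k / real l < 1" using assms(1,2) by simp
      then have "\<lfloor>real k / real l\<rfloor> \<le> 0" by linarith
      then show ?thesis by linarith
    qed
  qed
  then show "\<exists>f\<in>H. \<forall>j\<in>{1..l}. \<lfloor>real k / real l\<rfloor> \<le> int (card (f -` {j} \<inter> S)) \<and>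
      int (card (f -` {j} \<inter> S)) \<le> \<lceil>real k / real l\<rceil>" using f(1) by blast
qed

section \<open>Programs for the greedy tables\<close>


text \<open>Row-major layout: filling digits in increasing order fills the table row by row, the
  order in which both greedy rules refer back to earlier entries.\<close>

definition table :: "nat \<Rightarrow> nat \<Rightarrow> nat \<Rightarrow> nat \<Rightarrow> nat \<Rightarrow> nat" where
  "table b N A i x = dig b A (i * N + x)"

definition table_code :: "code \<Rightarrow> code \<Rightarrow> code \<Rightarrow> code \<Rightarrow> code \<Rightarrow> code" where
  "table_code b N A i x = dig_code b A (opr Add (opr Mul i N) x)"

definition collision_cost_code :: "code \<Rightarrow> code \<Rightarrow> code \<Rightarrow> code \<Rightarrow> code \<Rightarrow> code \<Rightarrow> code" where
  "collision_cost_code q n A i x v = sum_code x (\<lambda>y. opr Mul (eq_code (table_code q n A i y) v)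
     (power_code (cst 2) (sum_code i (\<lambda>i'. eq_code (table_code q n A i' x) (table_code q n A i' y)))))"

definition hash_digit :: "nat \<Rightarrow> nat \<Rightarrow> nat \<Rightarrow> nat \<Rightarrow> nat" where
  "hash_digit q n A z = pick (\<lambda>v v'. collision_cost (table q n A) (z div n) (z mod n) v -
     collision_cost (table q n A) (z div n) (z mod n) v') q"

definition hash_digit_code :: "code \<Rightarrow> code \<Rightarrow> code \<Rightarrow> code \<Rightarrow> code" where
  "hash_digit_code q n A z = bind (opr Div z n) (\<lambda>i. bind (mod_code z n) (\<lambda>x.
     pick_code (\<lambda>v v'. opr Sub (collision_cost_code q n A i x v) (collision_cost_code q n A i x v')) q))"

definition hash_code :: "code \<Rightarrow> code \<Rightarrow> code \<Rightarrow> code" where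
  "hash_code q n N = grow_code q (hash_digit_code q n) N"

definition clash_code :: "code \<Rightarrow> (code \<Rightarrow> code) \<Rightarrow> code" where
  "clash_code s F = sum_code s (\<lambda>i. sum_code i (\<lambda>j. eq_code (F i) (F j)))"

definition missed_code :: "code \<Rightarrow> code \<Rightarrow> code \<Rightarrow> code \<Rightarrow> code \<Rightarrow> code \<Rightarrow> code" where
  "missed_code m q s A r t = not_code (sum_code r (\<lambda>r'. not_code (clash_code s (\<lambda>i. table_code m q A r' (dig_code q t i)))))"

definition weight_code :: "code \<Rightarrow> code \<Rightarrow> code \<Rightarrow> code \<Rightarrow> code \<Rightarrow> code \<Rightarrow> code \<Rightarrow> code" where
  "weight_code m q s A r y t = bind (sum_code s (\<lambda>i. less_code (dig_code q t i) y)) (\<lambda>a.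
     opr Mul (not_code (clash_code s (\<lambda>i. bind (dig_code q t i) (\<lambda>x.
        ite (less_code x y) (table_code m q A r x) (opr Add m x)))))
       (opr Mul (power_code m a) (prod_code (opr Sub s a) (\<lambda>u. opr Sub (opr Sub m a) u))))"

definition potential_code :: "code \<Rightarrow> code \<Rightarrow> code \<Rightarrow> code \<Rightarrow> code \<Rightarrow> code \<Rightarrow> code \<Rightarrow> code" where
  "potential_code M m q s A r y = sum_code M (\<lambda>t. opr Mul (missed_code m q s A r t) (weight_code m q s A r y t))"

definition candidate_code :: "code \<Rightarrow> code \<Rightarrow> code \<Rightarrow> code \<Rightarrow> code \<Rightarrow> code \<Rightarrow> code \<Rightarrow> code" where
  "candidate_code M m q s A z v = bind (opr Add A (opr Mul v (power_code m z))) (\<lambda>A'.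
     bind (opr Div z q) (\<lambda>r. bind (opr Add (mod_code z q) (cst 1)) (\<lambda>y. potential_code M m q s A' r y)))"

text \<open>The potential right after appending \<open>v\<close> tentatively as digit
  \<open>z\<close>, that is as the value of point \<open>z mod q\<close> in row
  \<open>z div q\<close>; the successor counts this point as assigned.\<close>

definition candidate :: "nat \<Rightarrow> nat \<Rightarrow> nat \<Rightarrow> nat \<Rightarrow> nat \<Rightarrow> nat \<Rightarrow> nat \<Rightarrow> nat" where
  "candidate M m q s A z v = potential M m s (dig q) (table m q (A + v * m ^ z)) (z div q)
     (table m q (A + v * m ^ z) (z div q)) (Suc (z mod q))"

text \<open>The difference is swapped in comparison with \<open>hash_digit\<close>: collisions are
  minimised, expected coverage is maximised.\<close>

definition row_digit :: "nat \<Rightarrow> nat \<Rightarrow> nat \<Rightarrow> nat \<Rightarrow> nat \<Rightarrow> nat \<Rightarrow> nat" where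
  "row_digit M m q s A z = pick (\<lambda>v v'. candidate M m q s A z v' - candidate M m q s A z v) m"

definition row_code :: "code \<Rightarrow> code \<Rightarrow> code \<Rightarrow> code \<Rightarrow> code \<Rightarrow> code" where
  "row_code M m q s N = grow_code m (\<lambda>A z. pick_code (\<lambda>v v'. opr Sub (candidate_code M m q s A z v')
     (candidate_code M m q s A z v)) m) N"

definition rounds_code :: "code \<Rightarrow> code \<Rightarrow> code \<Rightarrow> code \<Rightarrow> code \<Rightarrow> code" where
  "rounds_code M m q s A = sum_code M (\<lambda>r. less_code (cst 0) (sum_code M (\<lambda>t.
     opr Mul (not_code (clash_code s (\<lambda>i. dig_code q t i))) (missed_code m q s A r t))))"

lemma hash_digit_less: "0 < q \<Longrightarrow> hash_digit q n A z < q"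
  unfolding hash_digit_def by (rule pick_less)

lemma extend1: "computes \<beta> w c v j \<Longrightarrow> w \<preceq> w1 \<Longrightarrow> computes \<beta> w1 c v j"
  by (rule computes_extend)

lemma extend2: "computes \<beta> w c v j \<Longrightarrow> w \<preceq> w1 \<Longrightarrow> w1 \<preceq> w2 \<Longrightarrow> computes \<beta> w2 c v j"
  by (blast intro: extend1)

lemma sum_of_bool_le: "(\<Sum>i<n. of_bool (P i) :: nat) \<le> n"
proof -
  have "(\<Sum>i<n. of_bool (P i) :: nat) \<le> (\<Sum>i<n. 1)" by (intro sum_mono) auto
  then show ?thesis by simp
qed

section \<open>Evaluation of the table programs within the bounds\<close>

context machine
begin

lemma comp_table:
  assumes "comp w cb b 0" "comp w cN N 0" "comp w cA A 0" "comp w ci i 0" "comp w cx x j"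
    "0 < b" "i * N + x \<le> \<beta>" "b ^ (i * N + x) < 2 ^ \<beta>"
  shows "comp w (table_code cb cN cA ci cx) (table b N A i x) (9 + j)"
proof -
  have "i * N + x < 2 ^ \<beta>" using assms(7) by (rule small_less)
  then show ?thesis unfolding table_code_def table_def using assms
    by (intro computes_conv[OF comp_dig[OF assms(1,3) comp_add[OF comp_mul[OF assms(4,2)] assms(5)]]]) auto
qed

lemma comp_bind:
  assumes "comp w x v j" "\<And>w' z. w \<preceq> w' \<Longrightarrow> comp w' z v 0 \<Longrightarrow> comp w' (B z) u j'"
  shows "comp w (bind x B) u (Suc (max j j'))"
  using computes_bind[OF assms] .

text \<open>The exponents count collisions in earlier rows, of which there are fewer than
  \<open>N\<close>, so the whole sum is at most \<open>n * 2 ^ N\<close>.\<close>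

lemma comp_collision_cost:
  assumes args: "comp w cq q 0" "comp w cn n 0" "comp w cA A 0" "comp w ci i 0" "comp w cx x 0" "comp w cv v 0"
    and x: "x < n" and z: "i * n + x < N" and N: "N \<le> \<beta>" "q ^ N < 2 ^ \<beta>" "n * 2 ^ N < 2 ^ \<beta>" and q: "0 < q"
  shows "comp w (collision_cost_code cq cn cA ci cx cv) (collision_cost (table q n A) i x v) 30"
  unfolding collision_cost_code_def collision_cost_def collisions_def
proof (rule computes_conv, rule comp_sum)
  have i: "i < N" using z x by (cases n) auto
  have pow: "q ^ e < 2 ^ \<beta>" if "e \<le> N" for e
    using power_increasing[OF that, of q] q N(2) by linarith
  have idx: "i' * n + y < i * n" if "i' < i" "y < n" for i' y
    using that mult_le_mono1[of "Suc i'" i n] by simp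
  show "comp w cx x 0" by fact
  fix w' y' y assume w': "w \<preceq> w'" and y: "y < x" "comp w' y' y 0"
  note ext = args[THEN computes_extend, OF w']
  have y_le: "i * n + y \<le> \<beta>" "i * n + y \<le> N" using y z N by auto
  show "comp w' (opr Mul (eq_code (table_code cq cn cA ci y') cv)
      (power_code (cst 2) (sum_code ci (\<lambda>i'. eq_code (table_code cq cn cA i' cx) (table_code cq cn cA i' y')))))
    (of_bool (table q n A i y = v) * 2 ^ (\<Sum>i'<i. of_bool (table q n A i' x = table q n A i' y))) 25"
  proof (rule computes_conv, rule comp_mul)
    show "comp w' (eq_code (table_code cq cn cA ci y') cv) (of_bool (table q n A i y = v)) (3 + max 9 0)"
      using comp_eq[OF comp_table[OF ext(1-4) y(2) q y_le(1) pow[OF y_le(2)]] ext(6)] by simp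
    let ?c = "\<Sum>i'<i. of_bool (table q n A i' x = table q n A i' y)"
    have c: "?c \<le> i" by (rule sum_of_bool_le)
    then have c2: "(2::nat) ^ ?c < 2 ^ \<beta>" using i N(1) by (intro power_strict_increasing) auto
    show "comp w' (power_code (cst 2) (sum_code ci (\<lambda>i'. eq_code (table_code cq cn cA i' cx) (table_code cq cn cA i' y'))))
       (2 ^ ?c) (3 + max 0 (3 + max 0 12))"
    proof (rule comp_power, rule comp_const, simp, rule comp_sum, rule ext)
      fix w'' z i' assume w'': "w' \<preceq> w''" and i': "i' < i" "comp w'' z i' 0"
      note ext' = ext[THEN computes_extend, OF w'']
      have le: "i' * n + x \<le> N" "i' * n + y \<le> N" using idx[OF i'(1), of x] idx[OF i'(1), of y] x y z by auto
      have "i' * n + x \<le> \<beta>" "i' * n + y \<le> \<beta>" using le N by auto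
      from comp_eq[OF comp_table[OF ext'(1-3) i'(2) ext'(5) q this(1) pow[OF le(1)]]
          comp_table[OF ext'(1-3) i'(2) computes_extend[OF y(2) w''] q this(2) pow[OF le(2)]]]
      show "comp w'' (eq_code (table_code cq cn cA z cx) (table_code cq cn cA z y'))
         (of_bool (table q n A i' x = table q n A i' y)) 12" by simp
    qed (use c c2 i N small_less[of ?c] in auto)
    show "of_bool (table q n A i y = v) * 2 ^ ?c < (2::nat) ^ \<beta>" using c2 by simp
  qed auto
next
  show "x \<le> \<beta>" using z N by simp
next
  have i: "i < N" using z x by (cases n) auto
  have "(\<Sum>y<x. of_bool (table q n A i y = v) * 2 ^ (\<Sum>i'<i. of_bool (table q n A i' x = table q n A i' y)))
    \<le> (\<Sum>y<x. (2::nat) ^ N)"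
  proof (rule sum_mono)
    fix y
    have "(2::nat) ^ (\<Sum>i'<i. of_bool (table q n A i' x = table q n A i' y)) \<le> 2 ^ N"
      using sum_of_bool_le[of "\<lambda>i'. table q n A i' x = table q n A i' y" i] i
      by (intro power_increasing) auto
    then show "of_bool (table q n A i y = v) * 2 ^ (\<Sum>i'<i. of_bool (table q n A i' x = table q n A i' y)) \<le> (2::nat) ^ N"
      by simp
  qed
  also have "\<dots> \<le> n * 2 ^ N" using x by simp
  finally show "(\<Sum>y<x. of_bool (table q n A i y = v) * 2 ^ (\<Sum>i'<i. of_bool (table q n A i' x = table q n A i' y)))
    < (2::nat) ^ \<beta>" using N(3) by linarith
qed auto

lemma comp_hash_digit:
  assumes args: "comp w cq q 0" "comp w cn n 0" "comp w cA A 0" "comp w cz z 0"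
    and n: "0 < n" and z: "z < N" and N: "N \<le> \<beta>" "q ^ N < 2 ^ \<beta>" "n * 2 ^ N < 2 ^ \<beta>"
    and q: "0 < q" "q \<le> \<beta>"
  shows "comp w (hash_digit_code cq cn cA cz) (hash_digit q n A z) 40"
  unfolding hash_digit_code_def hash_digit_def
proof (rule computes_conv, rule comp_bind, rule comp_div[OF args(4,2)])
  fix w1 ci assume w1: "w \<preceq> w1" and ci: "comp w1 ci (z div n) 0"
  note args1 = args[THEN computes_extend, OF w1]
  show "comp w1 (bind (mod_code cz cn) (\<lambda>x. pick_code (\<lambda>v v'. opr Sub (collision_cost_code cq cn cA ci x v)
      (collision_cost_code cq cn cA ci x v')) cq))
    (pick (\<lambda>v v'. collision_cost (table q n A) (z div n) (z mod n) v -
      collision_cost (table q n A) (z div n) (z mod n) v') q) 36"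
  proof (rule computes_conv, rule comp_bind, rule comp_mod[OF args1(4,2)])
    fix w2 cx assume w2: "w1 \<preceq> w2" and cx: "comp w2 cx (z mod n) 0"
    note args2 = args1[THEN computes_extend, OF w2]
    show "comp w2 (pick_code (\<lambda>v v'. opr Sub (collision_cost_code cq cn cA ci cx v)
        (collision_cost_code cq cn cA ci cx v')) cq)
      (pick (\<lambda>v v'. collision_cost (table q n A) (z div n) (z mod n) v -
        collision_cost (table q n A) (z div n) (z mod n) v') q) 35"
    proof (rule computes_conv, rule comp_pick[OF args2(1) q(2)])
      fix w3 cv cv' v v' assume w3: "w2 \<preceq> w3" and v: "comp w3 cv v 0" "comp w3 cv' v' 0"
      note args3 = args2[THEN computes_extend, OF w3]
      have ci3: "comp w3 ci (z div n) 0" using extend2[OF ci w2 w3] .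
      have cx3: "comp w3 cx (z mod n) 0" using extend1[OF cx w3] .
      have "z mod n < n" "z div n * n + z mod n < N" using n z by auto
      note cost = comp_collision_cost[OF args3(1-3) ci3 cx3 _ this N q(1)]
      show "comp w3 (opr Sub (collision_cost_code cq cn cA ci cx cv) (collision_cost_code cq cn cA ci cx cv'))
        (collision_cost (table q n A) (z div n) (z mod n) v - collision_cost (table q n A) (z div n) (z mod n) v')
        (Suc (max 30 30))"
        using comp_sub[OF cost[OF v(1)] cost[OF v(2)]] .
    qed auto
  qed auto
qed auto

lemma comp_hash:
  assumes args: "comp w cq q 0" "comp w cn n 0" "comp w cN N 0"
    and n: "0 < n" and N: "N \<le> \<beta>" "q ^ N < 2 ^ \<beta>" "n * 2 ^ N < 2 ^ \<beta>"
    and q: "0 < q" "q \<le> \<beta>"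
  shows "comp w (hash_code cq cn cN) (grow q (hash_digit q n) N) 50"
  unfolding hash_code_def
proof (rule computes_conv, rule comp_grow[OF args(1,3) N(1) q(1) N(2) hash_digit_less[OF q(1)]])
  fix w' cA cz A z assume w': "w \<preceq> w'" and z: "z < N" and v: "comp w' cA A 0" "comp w' cz z 0"
  show "comp w' (hash_digit_code cq cn cA cz) (hash_digit q n A z) 40"
    using comp_hash_digit[OF args(1,2)[THEN computes_extend, OF w'] v n z N q] .
qed auto

lemma comp_clash:
  assumes "comp w cs s 0" "s \<le> \<beta>" "s * s < 2 ^ \<beta>"
    "\<And>w' z i. w \<preceq> w' \<Longrightarrow> i < s \<Longrightarrow> comp w' z i 0 \<Longrightarrow> comp w' (F z) (f (\<tau> i)) j"
  shows "comp w (clash_code cs F) (clash s f \<tau>) (9 + j)"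
  unfolding clash_code_def clash_def
proof (rule computes_conv, rule comp_sum[OF assms(1)])
  have le: "(\<Sum>j<i. of_bool (f (\<tau> i) = f (\<tau> j)) :: nat) \<le> i" for i by (rule sum_of_bool_le)
  fix w' z i assume w': "w \<preceq> w'" and i: "i < s" "comp w' z i 0"
  show "comp w' (sum_code z (\<lambda>j. eq_code (F z) (F j))) (\<Sum>j<i. of_bool (f (\<tau> i) = f (\<tau> j))) (6 + j)"
  proof (rule computes_conv, rule comp_sum[OF i(2)])
    fix w'' z' i' assume w'': "w' \<preceq> w''" and i': "i' < i" "comp w'' z' i' 0"
    show "comp w'' (eq_code (F z) (F z')) (of_bool (f (\<tau> i) = f (\<tau> i'))) (3 + max j j)"
      using comp_eq[OF assms(4)[OF extends_trans[OF w' w''] i(1) computes_extend[OF i(2) w'']]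
          assms(4)[OF extends_trans[OF w' w''] _ i'(2)]] i' i by simp
  qed (use i assms(2) le[of i] small_less[of i] in auto)
next
  have "(\<Sum>i<s. \<Sum>j<i. of_bool (f (\<tau> i) = f (\<tau> j)) :: nat) \<le> (\<Sum>i<s. s)"
    by (intro sum_mono order_trans[OF sum_of_bool_le]) auto
  then show "(\<Sum>i<s. \<Sum>j<i. of_bool (f (\<tau> i) = f (\<tau> j)) :: nat) < 2 ^ \<beta>" using assms(3) by simp
qed (use assms(2) in auto)

end

text \<open>Whatever a loop runs over, up to the \<open>M * q\<close> entries of a table, is bounded
  by \<beta>. Whatever is merely stored, up to a full table with \<open>M * q\<close> digits in base
  \<open>m\<close>, is bounded by \<open>2 ^ \<beta>\<close>.\<close>

locale cover_machine = machine +
  fixes m q s M :: nat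
  assumes m: "0 < m" "m \<le> \<beta>" and q: "0 < q" "q \<le> \<beta>" "q ^ s < 2 ^ \<beta>"
    and s: "s \<le> \<beta>" "s * s < 2 ^ \<beta>" and M: "0 < M" "M \<le> \<beta>" "M * m ^ s < 2 ^ \<beta>"
    and N: "M * q \<le> \<beta>" "m ^ (M * q) < 2 ^ \<beta>" and mq: "m + q < 2 ^ \<beta>"
begin

lemma m_power: "e \<le> M * q \<Longrightarrow> m ^ e < 2 ^ \<beta>"
  using power_increasing[of e "M * q" m] m N(2) by linarith

lemma q_power: "e \<le> s \<Longrightarrow> q ^ e < 2 ^ \<beta>"
  using power_increasing[of e s q] q by linarith

lemma m_power_s: "e \<le> s \<Longrightarrow> m ^ e < 2 ^ \<beta>"
proof -
  assume "e \<le> s"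
  then have "m ^ e \<le> m ^ s" using m by (intro power_increasing) auto
  also have "\<dots> \<le> M * m ^ s" using M(1) by simp
  finally show ?thesis using M(3) by linarith
qed

lemma comp_tuple:
  "comp w cq q 0 \<Longrightarrow> comp w ct t 0 \<Longrightarrow> comp w ci i 0 \<Longrightarrow> i < s \<Longrightarrow> comp w (dig_code cq ct ci) (dig q t i) 7"
  using s(1) q(1) q_power[of i] by (intro computes_conv[OF comp_dig]) auto

lemma comp_missed:
  assumes args: "comp w cm m 0" "comp w cq q 0" "comp w cs s 0" "comp w cA A 0" "comp w cr r 0" "comp w ct t 0"
    and r: "r \<le> M"
  shows "comp w (missed_code cm cq cs cA cr ct) (missed s (table m q A) r (dig q t)) 30"
  unfolding missed_code_def missed_def
proof (rule computes_conv, rule comp_not, rule comp_sum[OF args(5)])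
  fix w1 z r' assume w1: "w \<preceq> w1" and r': "r' < r" "comp w1 z r' 0"
  note args1 = args[THEN computes_extend, OF w1]
  show "comp w1 (not_code (clash_code cs (\<lambda>i. table_code cm cq cA z (dig_code cq ct i))))
     (of_bool (clash s (table m q A r') (dig q t) = 0)) 26"
  proof (rule computes_conv, rule comp_not,
      rule comp_clash[where f = "table m q A r'" and \<tau> = "dig q t", OF args1(3) s])
    fix w2 ci i assume w2: "w1 \<preceq> w2" and i: "i < s" "comp w2 ci i 0"
    note args2 = args1[THEN computes_extend, OF w2]
    have "r' * q + dig q t i < Suc r' * q" using dig_less[OF q(1), of t i] by simp
    also have "\<dots> \<le> M * q" using r r' by (intro mult_right_mono) auto
    finally have le: "r' * q + dig q t i \<le> M * q" by simp
    show "comp w2 (table_code cm cq cA z (dig_code cq ct ci)) (table m q A r' (dig q t i)) (9 + 7)"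
      using le N(1) m(1) m_power[OF le]
      by (intro comp_table args2 comp_tuple i extend1[OF r'(2) w2]) auto
  qed auto
next
  have "(\<Sum>r'<r. of_bool (clash s (table m q A r') (dig q t) = 0) :: nat) \<le> r" by (rule sum_of_bool_le)
  then show "r \<le> \<beta>" "(\<Sum>r'<r. of_bool (clash s (table m q A r') (dig q t) = 0) :: nat) < 2 ^ \<beta>"
    using r M small_less[of r] by auto
qed auto

text \<open>A weight is \<open>m ^ s\<close> times a probability.\<close>

lemma weight_le: "weight m s g y \<tau> \<le> m ^ s"
proof -
  let ?a = "assigned s \<tau> y"
  have a: "?a \<le> s" unfolding assigned_def by (rule sum_of_bool_le)
  have "falling (m - ?a) (s - ?a) \<le> (\<Prod>u<s - ?a. m)"
    unfolding falling_def by (intro prod_mono) auto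
  then have "m ^ ?a * falling (m - ?a) (s - ?a) \<le> m ^ ?a * m ^ (s - ?a)" by simp
  also have "\<dots> = m ^ s" using a by (simp flip: power_add)
  finally show ?thesis by (simp add: weight_def)
qed

lemma comp_weight:
  assumes args: "comp w cm m 0" "comp w cq q 0" "comp w cs s 0" "comp w cA A 0" "comp w cr r 0" "comp w cy y 0" "comp w ct t 0"
    and r: "r * q + y \<le> M * q"
  shows "comp w (weight_code cm cq cs cA cr cy ct) (weight m s (table m q A r) y (dig q t)) 30"
  unfolding weight_code_def
proof (rule computes_conv, rule comp_bind)
  show "comp w (sum_code cs (\<lambda>i. less_code (dig_code cq ct i) cy)) (assigned s (dig q t) y) 12"
    unfolding assigned_def
  proof (rule computes_conv, rule comp_sum[OF args(3)])
    fix w1 ci i assume w1: "w \<preceq> w1" and i: "i < s" "comp w1 ci i 0"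
    note args1 = args[THEN computes_extend, OF w1]
    show "comp w1 (less_code (dig_code cq ct ci) cy) (of_bool (dig q t i < y)) (2 + max 7 0)"
      by (intro comp_less comp_tuple args1 i)
  qed (use s sum_of_bool_le[of "\<lambda>i. dig q t i < y" s] small_less[of s] in auto)
  fix w1 ca assume w1: "w \<preceq> w1" and ca: "comp w1 ca (assigned s (dig q t) y) 0"
  note args1 = args[THEN computes_extend, OF w1]
  let ?a = "assigned s (dig q t) y"
  have a: "?a \<le> s" unfolding assigned_def by (rule sum_of_bool_le)
  have "comp w1 (clash_code cs (\<lambda>i. bind (dig_code cq ct i) (\<lambda>x.
        ite (less_code x cy) (table_code cm cq cA cr x) (opr Add cm x))))
     (clash s (partial m (table m q A r) y) (dig q t)) 20"
  proof (rule computes_conv,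
      rule comp_clash[where f = "partial m (table m q A r) y" and \<tau> = "dig q t", OF args1(3) s])
    fix w2 ci i assume w2: "w1 \<preceq> w2" and i: "i < s" "comp w2 ci i 0"
    note args2 = args1[THEN computes_extend, OF w2]
    show "comp w2 (bind (dig_code cq ct ci) (\<lambda>x. ite (less_code x cy) (table_code cm cq cA cr x) (opr Add cm x)))
       (partial m (table m q A r) y (dig q t i)) 11"
    proof (rule computes_conv, rule comp_bind, rule comp_tuple[OF args2(2,7) i(2,1)])
      fix w3 cx assume w3: "w2 \<preceq> w3" and cx: "comp w3 cx (dig q t i) 0"
      note args3 = args2[THEN computes_extend, OF w3]
      let ?x = "dig q t i"
      have x: "?x < q" using dig_less[OF q(1)] .
      have "comp w3 (ite (less_code cx cy) (table_code cm cq cA cr cx) (opr Add cm cx))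
        (if of_bool (?x < y) \<noteq> (0::nat) then table m q A r ?x else m + ?x) (Suc (max 2 (max 9 1)))"
      proof (rule computes_conv, rule comp_ite, rule comp_less[OF cx args3(6)])
        assume "of_bool (?x < y) \<noteq> (0::nat)"
        then have le: "r * q + ?x \<le> M * q" using r by simp
        show "comp w3 (table_code cm cq cA cr cx) (table m q A r ?x) (9 + 0)"
          using le N(1) m(1) m_power[OF le] by (intro comp_table args3 cx) auto
      next
        show "comp w3 (opr Add cm cx) (m + ?x) (Suc (max 0 0))"
          using x mq by (intro comp_add args3 cx) auto
      qed auto
      then show "comp w3 (ite (less_code cx cy) (table_code cm cq cA cr cx) (opr Add cm cx))
        (partial m (table m q A r) y ?x) 10"
        by (rule computes_conv) (auto simp: partial_def)
    qed auto
  qed auto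
  note clash = comp_not[OF this]
  have "comp w1 (prod_code (opr Sub cs ca) (\<lambda>u. opr Sub (opr Sub cm ca) u)) (falling (m - ?a) (s - ?a)) 6"
    unfolding falling_def
  proof (rule computes_conv, rule comp_prod, rule comp_sub[OF args1(3) ca])
    fix w2 cu u assume w2: "w1 \<preceq> w2" and u: "comp w2 cu u 0"
    show "comp w2 (opr Sub (opr Sub cm ca) cu) (m - ?a - u) (Suc (max (Suc (max 0 0)) 0))"
      by (intro comp_sub u computes_extend[OF _ w2] args1 ca)
  next
    fix i assume i: "i \<le> s - ?a"
    have "(\<Prod>u<i. m - ?a - u) \<le> (\<Prod>u<i. m)" by (intro prod_mono) auto
    then have "(\<Prod>u<i. m - ?a - u) \<le> m ^ i" by simp
    then show "(\<Prod>u<i. m - ?a - u) < 2 ^ \<beta>" using m_power_s[of i] i by linarith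
  qed (use s in auto)
  moreover have "comp w1 (power_code cm ca) (m ^ ?a) (3 + max 0 0)"
    using a s(1) m(1) m_power_s[OF a] by (intro comp_power args1 ca) auto
  moreover have "m ^ ?a * falling (m - ?a) (s - ?a) < 2 ^ \<beta>"
  proof -
    have "falling (m - ?a) (s - ?a) \<le> (\<Prod>u<s - ?a. m)"
      unfolding falling_def by (intro prod_mono) auto
    then have "m ^ ?a * falling (m - ?a) (s - ?a) \<le> m ^ ?a * m ^ (s - ?a)" by simp
    also have "\<dots> = m ^ s" using a by (simp flip: power_add)
    finally show ?thesis using m_power_s[of s] by simp
  qed
  ultimately have "comp w1 (opr Mul (power_code cm ca) (prod_code (opr Sub cs ca) (\<lambda>u. opr Sub (opr Sub cm ca) u)))
     (m ^ ?a * falling (m - ?a) (s - ?a)) (Suc (max (3 + max 0 0) 6))"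
    by (intro comp_mul)
  from comp_mul[OF clash this]
  show "comp w1 (opr Mul (not_code (clash_code cs (\<lambda>i. bind (dig_code cq ct i) (\<lambda>x.
        ite (less_code x cy) (table_code cm cq cA cr x) (opr Add cm x)))))
       (opr Mul (power_code cm ca) (prod_code (opr Sub cs ca) (\<lambda>u. opr Sub (opr Sub cm ca) u))))
     (weight m s (table m q A r) y (dig q t)) 22"
    using weight_le[of "table m q A r" y "dig q t"] m_power_s[of s] by (simp add: weight_def)
qed auto

lemma missed_le: "missed s g r \<tau> \<le> 1"
  by (simp add: missed_def)

lemma comp_potential:
  assumes args: "comp w cM M 0" "comp w cm m 0" "comp w cq q 0" "comp w cs s 0" "comp w cA A 0" "comp w cr r 0" "comp w cy y 0"
    and r: "r * q + y \<le> M * q" "r \<le> M"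
  shows "comp w (potential_code cM cm cq cs cA cr cy) (potential M m s (dig q) (table m q A) r (table m q A r) y) 36"
  unfolding potential_code_def potential_def
proof (rule computes_conv, rule comp_sum[OF args(1)])
  have le: "missed s (table m q A) r (dig q t) * weight m s (table m q A r) y (dig q t) \<le> 1 * m ^ s" for t
    by (intro mult_mono missed_le weight_le) auto
  fix w1 ct t assume w1: "w \<preceq> w1" and ct: "comp w1 ct t 0"
  note args1 = args[THEN computes_extend, OF w1]
  show "comp w1 (opr Mul (missed_code cm cq cs cA cr ct) (weight_code cm cq cs cA cr cy ct))
     (missed s (table m q A) r (dig q t) * weight m s (table m q A r) y (dig q t)) (Suc (max 30 30))"
    using le[of t] m_power_s[of s]
    by (intro comp_mul comp_missed[OF args1(2-6) ct r(2)] comp_weight[OF args1(2-7) ct r(1)]) auto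
next
  have "(\<Sum>t<M. missed s (table m q A) r (dig q t) * weight m s (table m q A r) y (dig q t)) \<le> (\<Sum>t<M. 1 * m ^ s)"
    by (intro sum_mono mult_mono missed_le weight_le) auto
  then show "(\<Sum>t<M. missed s (table m q A) r (dig q t) * weight m s (table m q A r) y (dig q t)) < 2 ^ \<beta>"
    using M(3) by simp
qed (use M in auto)

lemma comp_candidate:
  assumes args: "comp w cM M 0" "comp w cm m 0" "comp w cq q 0" "comp w cs s 0" "comp w cA A 0" "comp w cz z 0" "comp w cv v 0"
    and A: "A < m ^ z" "z < M * q" "v < m"
  shows "comp w (candidate_code cM cm cq cs cA cz cv) (candidate M m q s A z v) 40"
  unfolding candidate_code_def candidate_def
proof (rule computes_conv, rule comp_bind)
  have "A + v * m ^ z < Suc v * m ^ z" using A by simp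
  also have "\<dots> \<le> m ^ Suc z" using A(3) mult_right_mono[of "Suc v" m "m ^ z"] by simp
  finally have "A + v * m ^ z < 2 ^ \<beta>" using m_power[of "Suc z"] A(2) by simp
  then show "comp w (opr Add cA (opr Mul cv (power_code cm cz))) (A + v * m ^ z) 5"
    using m(1) N(1) A m_power[of z]
    by (intro computes_conv[OF comp_add[OF args(5) comp_mul[OF args(7) comp_power[OF args(2,6)]]]]) auto
  fix w1 cA' assume w1: "w \<preceq> w1" and cA': "comp w1 cA' (A + v * m ^ z) 0"
  note args1 = args[THEN computes_extend, OF w1]
  let ?A = "A + v * m ^ z"
  show "comp w1 (bind (opr Div cz cq) (\<lambda>r. bind (opr Add (mod_code cz cq) (cst 1)) (\<lambda>y.
       potential_code cM cm cq cs cA' r y)))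
    (potential M m s (dig q) (table m q ?A) (z div q) (table m q ?A (z div q)) (Suc (z mod q))) 38"
  proof (rule computes_conv, rule comp_bind, rule comp_div[OF args1(6,3)])
    fix w2 cr assume w2: "w1 \<preceq> w2" and cr: "comp w2 cr (z div q) 0"
    note args2 = args1[THEN computes_extend, OF w2]
    show "comp w2 (bind (opr Add (mod_code cz cq) (cst 1)) (\<lambda>y. potential_code cM cm cq cs cA' cr y))
      (potential M m s (dig q) (table m q ?A) (z div q) (table m q ?A (z div q)) (Suc (z mod q))) 37"
    proof (rule computes_conv, rule comp_bind)
      have zq: "z mod q < q" using q by simp
      show "comp w2 (opr Add (mod_code cz cq) (cst 1)) (z mod q + 1) 4"
        using zq q(2) small_less[of "Suc (z mod q)"]
        by (intro computes_conv[OF comp_add[OF comp_mod[OF args2(6,3)] comp_const]]) auto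
      fix w3 cy assume w3: "w2 \<preceq> w3" and cy: "comp w3 cy (z mod q + 1) 0"
      note args3 = args2[THEN computes_extend, OF w3]
      have "z div q < M" using A(2) by (simp add: less_mult_imp_div_less)
      moreover have "z div q * q + (z mod q + 1) \<le> M * q" using A(2) by simp
      ultimately show "comp w3 (potential_code cM cm cq cs cA' cr cy)
         (potential M m s (dig q) (table m q ?A) (z div q) (table m q ?A (z div q)) (Suc (z mod q))) 36"
        using comp_potential[OF args3(1-4) extend2[OF cA' w2 w3] extend1[OF cr w3] cy] by simp
    qed auto
  qed auto
qed auto

lemma row_digit_less: "row_digit M m q s A z < m"
  unfolding row_digit_def using m(1) by (rule pick_less)

lemma comp_row:
  assumes args: "comp w cM M 0" "comp w cm m 0" "comp w cq q 0" "comp w cs s 0" "comp w cN (M * q) 0"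
  shows "comp w (row_code cM cm cq cs cN) (grow m (row_digit M m q s) (M * q)) 60"
  unfolding row_code_def
proof (rule computes_conv, rule comp_grow[OF args(2,5) N(1) m(1) N(2) row_digit_less])
  fix w1 cA cz A z assume w1: "w \<preceq> w1" and A: "A < m ^ z" "z < M * q" "comp w1 cA A 0" "comp w1 cz z 0"
  note args1 = args(1-4)[THEN computes_extend, OF w1] A(3,4)
  show "comp w1 (pick_code (\<lambda>v v'. opr Sub (candidate_code cM cm cq cs cA cz v') (candidate_code cM cm cq cs cA cz v)) cm)
     (row_digit M m q s A z) 45"
    unfolding row_digit_def
  proof (rule computes_conv, rule comp_pick[OF args1(2) m(2)])
    fix w2 cv cv' v v' assume w2: "w1 \<preceq> w2" and v: "v < m" "v' < m" "comp w2 cv v 0" "comp w2 cv' v' 0"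
    note args2 = args1[THEN computes_extend, OF w2]
    show "comp w2 (opr Sub (candidate_code cM cm cq cs cA cz cv') (candidate_code cM cm cq cs cA cz cv))
      (candidate M m q s A z v' - candidate M m q s A z v) (Suc (max 40 40))"
      by (intro comp_sub comp_candidate args2 v A(1,2))
  qed auto
qed auto

lemma comp_rounds:
  assumes args: "comp w cM M 0" "comp w cm m 0" "comp w cq q 0" "comp w cs s 0" "comp w cA A 0"
  shows "comp w (rounds_code cM cm cq cs cA) (\<Sum>r<M. of_bool (0 < uncovered M s (dig q) (table m q A) r)) 40"
  unfolding rounds_code_def
proof (rule computes_conv, rule comp_sum[OF args(1)])
  fix w1 cr r assume w1: "w \<preceq> w1" and r: "r < M" "comp w1 cr r 0"
  note args1 = args[THEN computes_extend, OF w1]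
  have "comp w1 (sum_code cM (\<lambda>t. opr Mul (not_code (clash_code cs (\<lambda>i. dig_code cq t i))) (missed_code cm cq cs cA cr t)))
    (uncovered M s (dig q) (table m q A) r) 34"
    unfolding uncovered_def
  proof (rule computes_conv, rule comp_sum[OF args1(1)])
    have le: "of_bool (clash s (\<lambda>x. x) (dig q t) = 0) * missed s (table m q A) r (dig q t) \<le> (1::nat)" for t
      using missed_le[of "table m q A" r "dig q t"] by simp
    fix w2 ct t assume w2: "w1 \<preceq> w2" and ct: "comp w2 ct t 0"
    note args2 = args1[THEN computes_extend, OF w2]
    have "comp w2 (clash_code cs (\<lambda>i. dig_code cq ct i)) (clash s (\<lambda>x. x) (dig q t)) (9 + 7)"
      by (intro comp_clash args2 s comp_tuple computes_extend[OF args2(3)] computes_extend[OF ct])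
    then show "comp w2 (opr Mul (not_code (clash_code cs (\<lambda>i. dig_code cq ct i))) (missed_code cm cq cs cA cr ct))
       (of_bool (clash s (\<lambda>x. x) (dig q t) = 0) * missed s (table m q A) r (dig q t)) 31"
      using le_less_trans[OF le[of t] small_less[of 1]] r(1) large
      by (intro computes_conv[OF comp_mul[OF comp_not comp_missed[OF args2(2-5) extend1[OF r(2) w2] ct]]]) auto
  next
    have "(\<Sum>t<M. of_bool (clash s (\<lambda>x. x) (dig q t) = 0) * missed s (table m q A) r (dig q t)) \<le> (\<Sum>t<M. 1)"
      using missed_le[of "table m q A" r] by (intro sum_mono) (auto simp: mult_le_one)
    then show "(\<Sum>t<M. of_bool (clash s (\<lambda>x. x) (dig q t) = 0) * missed s (table m q A) r (dig q t)) < 2 ^ \<beta>"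
      using M(2) small_less[of M] by simp
  qed (use M in auto)
  then show "comp w1 (less_code (cst 0) (sum_code cM (\<lambda>t. opr Mul (not_code (clash_code cs (\<lambda>i. dig_code cq t i)))
      (missed_code cm cq cs cA cr t)))) (of_bool (0 < uncovered M s (dig q) (table m q A) r)) (2 + max 0 34)"
    by (intro comp_less comp_const) auto
next
  show "(\<Sum>r<M. of_bool (0 < uncovered M s (dig q) (table m q A) r) :: nat) < 2 ^ \<beta>"
    using sum_of_bool_le[of "\<lambda>r. 0 < uncovered M s (dig q) (table m q A) r" M] M(2) small_less[of M] by linarith
qed (use M in auto)

end


section \<open>Greedy properties of the finished tables\<close>

lemma collision_cost_cong:
  assumes "\<And>i' x'. i' < i \<Longrightarrow> x' \<le> x \<Longrightarrow> h i' x' = h' i' x'" "\<And>y. y < x \<Longrightarrow> h i y = h' i y"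
  shows "collision_cost h i x v = collision_cost h' i x v"
  unfolding collision_cost_def collisions_def using assms
  by (intro sum.cong refl arg_cong2[where f = "(*)"] arg_cong[where f = "power 2"]) auto

lemma row_index_less: "i < L \<Longrightarrow> x < n \<Longrightarrow> i * n + x < L * n" for n :: nat
proof -
  assume "i < L" "x < n"
  then have "i * n + x < Suc i * n" by simp
  also have "\<dots> \<le> L * n" using \<open>i < L\<close> by (intro mult_right_mono) auto
  finally show ?thesis .
qed

text \<open>Each digit was chosen from a partial number, whereas greediness is required of the
  finished table. The cost at \<open>(i, x)\<close> reads only earlier entries in row-major order,
  and those digits are already final.\<close>

lemma hash_table_perfect:
  assumes "0 < k" "q = 4 * k * k" "L = q * \<mu>" "n \<le> 2 ^ \<mu>" "0 < \<mu>" "S \<subseteq> {..<n}" "card S = k"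
  shows "\<exists>i<L. inj_on (table q n (grow q (hash_digit q n) (L * n)) i) S"
proof (rule greedy_perfect_hash[OF _ _ assms(2,1,3-7)])
  have q: "0 < q" using assms(1,2) by simp
  let ?H = "grow q (hash_digit q n)"
  let ?h = "table q n (?H (L * n))"
  fix i x assume i: "i < L" "x < n"
  let ?z = "i * n + x"
  have z: "?z < L * n" using i by (rule row_index_less)
  show "?h i x < q" using q by (simp add: table_def dig_less)
  have dig: "dig q (?H (L * n)) j = hash_digit q n (?H j) j" if "j < L * n" for j
    using that hash_digit_less[OF q] by (intro dig_grow) auto
  have dig': "dig q (?H ?z) j = dig q (?H (L * n)) j" if "j < ?z" for j
    using dig[of j] that z hash_digit_less[OF q] by (subst dig_grow) auto
  have cost: "collision_cost (table q n (?H ?z)) i x v = collision_cost ?h i x v" for v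
  proof (rule collision_cost_cong)
    show "table q n (?H ?z) i' x' = ?h i' x'" if "i' < i" "x' \<le> x" for i' x'
      using row_index_less[of i' i x' n] that i dig' by (simp add: table_def)
    show "table q n (?H ?z) i y = ?h i y" if "y < x" for y
      using that dig' by (simp add: table_def)
  qed
  have "?h i x = pick (\<lambda>v v'. collision_cost ?h i x v - collision_cost ?h i x v') q"
    using i by (simp add: table_def[of q n "?H (L * n)" i x] dig[OF z] hash_digit_def cost)
  then show "collision_cost ?h i x (?h i x) \<le> collision_cost ?h i x v" if "v < q" for v
    using pick_min[OF that, of "collision_cost ?h i x"] by simp
qed

lemma potential_cong:
  assumes "\<And>r' x. r' < r \<Longrightarrow> x < q \<Longrightarrow> g r' x = g' r' x" "\<And>x. x < y \<Longrightarrow> f x = f' x"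
    "\<And>t i. t < M \<Longrightarrow> i < s \<Longrightarrow> \<tau> t i < q"
  shows "potential M m s \<tau> g r f y = potential M m s \<tau> g' r f' y"
proof -
  have "missed s g r (\<tau> t) = missed s g' r (\<tau> t)" if "t < M" for t
  proof -
    have "clash s (g r') (\<tau> t) = clash s (g' r') (\<tau> t)" if "r' < r" for r'
      using assms(1)[OF that] assms(3)[OF \<open>t < M\<close>] by (simp add: clash_def)
    then show ?thesis by (simp add: missed_def)
  qed
  moreover have "partial m f y = partial m f' y"
    using assms(2) by (auto simp: partial_def)
  ultimately show ?thesis by (simp add: potential_def weight_def)
qed

text \<open>Maximality was tested on partial numbers with one tentative digit. The digits below it
  are final and the potential at \<open>Suc y\<close> reads nothing beyond it, so the test agrees
  with changing a single value of the finished table.\<close>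

lemma row_table_greedy_cover:
  assumes "s \<le> m" "0 < m" "0 < M" "0 < q"
  shows "greedy_cover M m s q (dig q) (table m q (grow m (row_digit M m q s) (M * q)))"
proof
  let ?G = "grow m (row_digit M m q s)"
  let ?g = "table m q (?G (M * q))"
  have less: "row_digit M m q s A z < m" for A z
    unfolding row_digit_def using assms(2) by (rule pick_less)
  show "dig q t i < q" for t i using assms(4) by (rule dig_less)
  show "?g r y < m" for r y using assms(2) by (simp add: table_def dig_less)
  fix r y v assume r: "r < M" "y < q" and v: "v < m"
  let ?z = "r * q + y"
  have z: "?z < M * q" using r by (rule row_index_less)
  have dig: "dig m (?G (M * q)) j = row_digit M m q s (?G j) j" if "j < M * q" for j
    using that less by (intro dig_grow) auto
  have dig': "dig m (?G ?z) j = dig m (?G (M * q)) j" if "j < ?z" for j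
    using dig[of j] that z less by (subst dig_grow) auto
  have G: "?G ?z < m ^ ?z" using less by (rule grow_less)
  have cand: "candidate M m q s (?G ?z) ?z v = potential M m s (dig q) ?g r ((?g r)(y := v)) (Suc y)"
    if v: "v < m" for v
  proof -
    have "dig m (?G ?z + v * m ^ ?z) j = dig m (?G (M * q)) j" if "j < ?z" for j
      using dig_add_power(1)[OF G v that] dig'[OF that] by simp
    moreover have "dig m (?G ?z + v * m ^ ?z) ?z = v" using dig_add_power(2)[OF G v] .
    ultimately show ?thesis unfolding candidate_def using r
      by (auto intro!: potential_cong[where q = q] simp: table_def row_index_less trans_less_add1 less_Suc_eq dig_less)
  qed
  have "?g r y = pick (\<lambda>v v'. candidate M m q s (?G ?z) ?z v' - candidate M m q s (?G ?z) ?z v) m"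
    by (simp add: table_def dig[OF z] row_digit_def)
  then have "candidate M m q s (?G ?z) ?z v \<le> candidate M m q s (?G ?z) ?z (?g r y)"
    using pick_max[OF v, of "candidate M m q s (?G ?z) ?z"] by simp
  moreover have "?g r y < m" using assms(2) by (simp add: table_def dig_less)
  ultimately show "potential M m s (dig q) ?g r ((?g r)(y := v)) (Suc y) \<le> potential M m s (dig q) ?g r (?g r) (Suc y)"
    using cand[OF v] cand[of "?g r y"] by simp
qed (use assms in auto)

section \<open>The splitter\<close>


definition root_floor :: "nat \<Rightarrow> nat" where
  "root_floor k = (\<Sum>i<k. of_bool ((i + 1) * (i + 1) - k = 0))"

text \<open>One more than the rounded-up binary logarithm; the extra one keeps it positive at
  \<open>n = 1\<close>, as the hashing argument requires.\<close>

definition bit_bound :: "nat \<Rightarrow> nat" where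
  "bit_bound n = 1 + (\<Sum>i<n. of_bool (2 ^ i < n))"

lemma root_floor_eq: "root_floor k = nat \<lfloor>sqrt (real k)\<rfloor>"
proof -
  let ?t = "nat \<lfloor>sqrt (real k)\<rfloor>"
  have iff: "(i + 1) * (i + 1) \<le> k \<longleftrightarrow> i < ?t" for i
  proof -
    have "(i + 1) * (i + 1) \<le> k \<longleftrightarrow> real (i + 1) ^ 2 \<le> real k"
      unfolding power2_eq_square by (simp only: flip: of_nat_mult) (simp only: of_nat_le_iff)
    also have "\<dots> \<longleftrightarrow> real (i + 1) \<le> sqrt (real k)"
      using real_sqrt_le_iff[of "real (i + 1) ^ 2" "real k"] by simp
    also have "\<dots> \<longleftrightarrow> int (i + 1) \<le> \<lfloor>sqrt (real k)\<rfloor>" by (simp add: le_floor_iff)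
    also have "\<dots> \<longleftrightarrow> i < ?t" by linarith
    finally show ?thesis .
  qed
  have "?t \<le> k"
  proof (rule ccontr)
    assume "\<not> ?t \<le> k"
    then have "(k + 1) * (k + 1) \<le> k" using iff[of k] by simp
    then show False by simp
  qed
  then have "{..<k} \<inter> {i. (i + 1) * (i + 1) - k = 0} = {..<?t}"
    unfolding set_eq_iff Int_iff mem_Collect_eq lessThan_iff diff_is_0_eq iff using less_le_trans by blast
  then show ?thesis by (simp only: root_floor_def of_bool_def sum.If_cases finite_lessThan) simp
qed

lemma le_bit_bound: "n \<le> 2 ^ bit_bound n"
  and bit_bound_le: "bit_bound n \<le> n + 1"
  and bit_bound_less: "bit_bound n = 1 \<or> 2 ^ (bit_bound n - 2) < n"
proof -
  define c where "c = (LEAST c. n \<le> (2::nat) ^ c)"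
  have ex: "n \<le> 2 ^ n" using less_exp[of n] by simp
  have c: "n \<le> 2 ^ c" unfolding c_def using ex by (rule LeastI)
  have "c \<le> n" unfolding c_def using ex by (rule Least_le)
  have iff: "2 ^ i < n \<longleftrightarrow> i < c" for i
  proof
    assume "2 ^ i < n"
    then have "(2::nat) ^ i < 2 ^ c" using c by linarith
    then show "i < c" by simp
  next
    assume "i < c"
    then show "2 ^ i < n" unfolding c_def by (metis not_le not_less_Least)
  qed
  have "{..<n} \<inter> {i. 2 ^ i < n} = {..<c}"
    unfolding set_eq_iff Int_iff mem_Collect_eq lessThan_iff iff using \<open>c \<le> n\<close> by auto
  then have "bit_bound n = 1 + c"
    by (simp only: bit_bound_def of_bool_def sum.If_cases finite_lessThan) simp
  then show "n \<le> 2 ^ bit_bound n" "bit_bound n \<le> n + 1" "bit_bound n = 1 \<or> 2 ^ (bit_bound n - 2) < n"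
    using c \<open>c \<le> n\<close> iff[of "c - 1"] by (auto simp: numeral_2_eq_2)
qed

text \<open>Lets all value tables be written by one flat loop over
  \<open>z = j * n + x\<close>.\<close>

lemma concat_rows: "concat (map (\<lambda>j. map (\<lambda>x. f (j * n + x)) [0..<n]) [0..<t]) = map f [0..<t * n]"
proof (induction t)
  case (Suc t)
  have "map (\<lambda>x. f (t * n + x)) [0..<n] = map f [t * n..<t * n + n]"
    using map_add_upt[of "t * n" n] by (simp add: add.commute flip: map_map[of f "\<lambda>x. x + t * n", unfolded comp_def])
  then show ?case using Suc upt_add_eq_append[of 0 "t * n" n] by (simp add: add.commute)
qed simp

section \<open>Parameters and correctness of the family\<close>

locale splitter_parameters =
  fixes n k l :: nat
  assumes n: "1 \<le> n" and k: "1 \<le> k" and kl: "k \<le> l"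
begin

definition s where "s = root_floor k"
definition b where "b = k div s"
definition r where "r = k - b * s"
definition q where "q = 4 * (k * k)"
definition m where "m = (l - r) div b"
definition M where "M = q ^ s"
definition L where "L = q * bit_bound n"
definition H where "H = grow q (hash_digit q n) (L * n)"
definition G where "G = grow m (row_digit M m q s) (M * q)"
definition R :: nat where "R = (\<Sum>r<M. of_bool (0 < uncovered M s (dig q) (table m q G) r))"
definition W where "W = q ^ (b - 1 + r)"
definition T where "T = L * W * R ^ b"

text \<open>The index is a mixed-radix number: a hash function below \<open>L\<close>, a guess of
  cuts and special points below \<open>W\<close>, and a number whose \<open>b\<close> digits in base
  \<open>R\<close> choose a function for each interval.\<close>

definition member :: "nat \<Rightarrow> nat \<Rightarrow> nat" where
  "member j x = colour b m r (dig q (j div L mod W)) (\<lambda>B. table m q G (dig R (j div L div W) B))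
     (table q n H (j mod L) x)"

definition family :: "(nat \<Rightarrow> nat) list" where
  "family = map (\<lambda>j. \<lambda>x\<in>{1..n}. member j (x - 1)) [0..<T]"

lemma sqrt_s: "real s \<le> sqrt (real k)" "sqrt (real k) < real s + 1"
proof -
  have "0 \<le> \<lfloor>sqrt (real k)\<rfloor>" by simp
  then have "real s = of_int \<lfloor>sqrt (real k)\<rfloor>" by (simp add: s_def root_floor_eq)
  then show "real s \<le> sqrt (real k)" "sqrt (real k) < real s + 1" by linarith+
qed

lemma s_pos: "0 < s"
proof -
  have "1 \<le> sqrt (real k)" using k by simp
  then show ?thesis using sqrt_s(2) by linarith
qed

lemma s_square: "s * s \<le> k"
proof -
  have "real s ^ 2 \<le> sqrt (real k) ^ 2" using sqrt_s(1) by (rule power_mono) simp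
  then have "real (s * s) \<le> real k" by (simp add: power2_eq_square)
  then show ?thesis by (simp only: of_nat_le_iff)
qed

lemma s_le: "s \<le> k"
  using s_square s_pos order_trans[of s "s * s" k] by simp

lemma b_pos: "0 < b"
  using s_le s_pos by (simp add: b_def div_greater_zero_iff)

lemma k_eq: "k = b * s + r" and r_less: "r < s"
proof -
  have "r = k mod s" unfolding r_def b_def by (simp add: minus_div_mult_eq_mod)
  then show "k = b * s + r" "r < s" using s_pos by (auto simp: b_def)
qed

text \<open>Because \<open>k \<le> l\<close>, the \<open>l - r\<close> shared colours number at
  least \<open>b * s\<close>. So every interval gets at least \<open>s\<close> colours, enough for
  its \<open>s\<close> points to be coloured injectively.\<close>

lemma s_le_m: "s \<le> m"
proof -
  have "b * s \<le> l - r" using k_eq kl by linarith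
  then have "b * s div b \<le> m" unfolding m_def by (rule div_le_mono)
  then show ?thesis using b_pos by simp
qed

lemma range_le: "b * m + r \<le> l"
proof -
  have "b * m \<le> l - r" unfolding m_def by simp
  moreover have "r \<le> l" using k_eq kl by linarith
  ultimately show ?thesis by linarith
qed

lemma q_pos: "0 < q" and M_pos: "0 < M" and L_pos: "0 < L"
  using k by (auto simp: q_def M_def L_def bit_bound_def)

lemma m_pos: "0 < m"
  using s_pos s_le_m by simp

lemma k_le_q: "k \<le> q"
  using k by (simp add: q_def)

sublocale rows: greedy_cover M m s q "dig q" "table m q G"
  unfolding G_def by (rule row_table_greedy_cover[OF s_le_m m_pos M_pos q_pos])

lemma R_eq: "R = rows.rounds"
  by (simp add: R_def rows.rounds_def)

lemma cover:
  assumes "\<And>i. i < s \<Longrightarrow> \<tau> i < q" "inj_on \<tau> {..<s}"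
  shows "\<exists>i<R. inj_on (\<lambda>e. table m q G i (\<tau> e)) {..<s}"
proof -
  obtain t where t: "t < M" "\<And>i. i < s \<Longrightarrow> dig q t i = \<tau> i"
    using exists_digits[of q s \<tau>] q_pos assms(1) unfolding M_def by blast
  then have "inj_on (dig q t) {..<s}" using assms(2) by (simp add: inj_on_def)
  from rows.covered[OF t(1) this] show ?thesis
    using t(2) by (auto simp: R_eq inj_on_def)
qed

lemma R_pos: "0 < R"
proof -
  \<comment> \<open>Any injective tuple forces a row to exist; the tuple
    \<open>0, ..., s - 1\<close> is available since \<open>s \<le> q\<close>.\<close>
  have "\<exists>i<R. inj_on (\<lambda>e. table m q G i e) {..<s}"
    using s_le k_le_q by (intro cover) auto
  then show ?thesis by auto
qed

lemma member_range: "member j x \<in> {1..l}"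
proof -
  have "member j x \<in> {1..b * m + r}"
    unfolding member_def using m_pos by (intro colour_range b_pos) (simp add: table_def dig_less)
  then show ?thesis using range_le by simp
qed

lemma exists_injective_member:
  assumes S: "S \<subseteq> {..<n}" "card S = k"
  shows "\<exists>j<T. inj_on (member j) S"
proof -
  obtain i where i: "i < L" "inj_on (table q n H i) S"
    using hash_table_perfect[of k q L "bit_bound n" n S] k S le_bit_bound
    by (auto simp: q_def L_def H_def bit_bound_def)
  let ?Y = "table q n H i ` S"
  have Y: "?Y \<subseteq> {..<q}" "card ?Y = b * s + r"
    using q_pos by (auto simp: table_def dig_less) (simp only: card_image[OF i(2), unfolded table_def] S(2) k_eq[symmetric])
  obtain p u where pu: "\<And>j. j < b - 1 + r \<Longrightarrow> p j < q" "\<And>B. B < b \<Longrightarrow> u B < R"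
    "inj_on (colour b m r p (\<lambda>B. table m q G (u B))) ?Y"
    using exists_injective_colour[OF Y b_pos s_pos, of R "table m q G" m] cover m_pos
    by (auto simp: table_def dig_less)
  obtain w where w: "w < W" "\<And>j. j < b - 1 + r \<Longrightarrow> dig q w j = p j"
    using exists_digits[of q "b - 1 + r" p] q_pos pu(1) unfolding W_def by blast
  obtain v where v: "v < R ^ b" "\<And>B. B < b \<Longrightarrow> dig R v B = u B"
    using exists_digits[of R b u] R_pos pu(2) by blast
  \<comment> \<open>Assembled so that the divisions in \<open>member\<close> recover
    \<open>i\<close>, \<open>w\<close> and \<open>v\<close>.\<close>
  define j where "j = (v * W + w) * L + i"
  have "v * W + w < R ^ b * W" using v(1) w(1) by (rule row_index_less)
  then have "j < R ^ b * W * L" unfolding j_def using i(1) by (rule row_index_less)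
  then have "j < T" by (simp add: T_def mult_ac)
  moreover have j: "j mod L = i" "j div L mod W = w" "j div L div W = v"
    using i(1) w(1) by (auto simp: j_def)
  have "member j x = colour b m r p (\<lambda>B. table m q G (u B)) (table q n H i x)" for x
    unfolding member_def j using w(2) v(2) by (intro colour_cong b_pos) auto
  then have "inj_on (member j) S"
    using comp_inj_on[OF i(2) pu(3)] by (simp add: comp_def cong: inj_on_cong)
  ultimately show ?thesis by blast
qed

lemma splitter_family: "splitter n k l (set family)"
proof (rule splitter_of_injective[OF k kl])
  show "set family \<subseteq> {1..n} \<rightarrow>\<^sub>E {1..l}"
    using member_range by (auto simp: family_def)
  fix S assume S: "S \<subseteq> {1..n}" "card S = k"
  have inj: "inj_on (\<lambda>x. x - 1) S"
  proof (rule inj_onI)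
    fix x y assume "x \<in> S" "y \<in> S" "x - 1 = y - 1"
    moreover from this have "1 \<le> x" "1 \<le> y" using S(1) by auto
    ultimately show "x = y" by simp
  qed
  have "x - 1 < n" if "x \<in> S" for x using subsetD[OF S(1) that] n by auto
  then have "(\<lambda>x. x - 1) ` S \<subseteq> {..<n}" "card ((\<lambda>x. x - 1) ` S) = k"
    using card_image[OF inj] S(2) by auto
  then obtain j where j: "j < T" "inj_on (member j) ((\<lambda>x. x - 1) ` S)"
    using exists_injective_member by blast
  have "inj_on (\<lambda>x. member j (x - 1)) S"
    using comp_inj_on[OF inj j(2)] by (simp add: comp_def)
  then have "inj_on (\<lambda>x\<in>{1..n}. member j (x - 1)) S"
    using S(1) by (subst inj_on_cong[of _ _ "\<lambda>x. member j (x - 1)"]) auto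
  then show "\<exists>f\<in>set family. inj_on f S" using j(1) by (auto simp: family_def)
qed

lemma value_tables_family: "value_tables n family = map (\<lambda>z. member (z div n) (z mod n)) [0..<T * n]"
proof -
  have "map (\<lambda>x\<in>{1..n}. member j (x - 1)) [1..<Suc n] = map (\<lambda>x. member ((j * n + x) div n) ((j * n + x) mod n)) [0..<n]" for j
  proof -
    have "[1..<Suc n] = map Suc [0..<n]" by (simp add: map_Suc_upt)
    then show ?thesis using n by (auto simp: comp_def simp del: upt_Suc)
  qed
  then show ?thesis unfolding concat_rows[symmetric] by (simp add: value_tables_def family_def comp_def del: upt_Suc)
qed

end

section \<open>The program and its cost\<close>


definition root_code :: "code \<Rightarrow> code" where
  "root_code k = sum_code k (\<lambda>i. bind (opr Add i (cst 1)) (\<lambda>x. not_code (opr Sub (opr Mul x x) k)))"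

definition bit_bound_code :: "code \<Rightarrow> code" where
  "bit_bound_code n = opr Add (cst 1) (sum_code n (\<lambda>i. less_code (power_code (cst 2) i) n))"

definition special_code :: "code \<Rightarrow> code \<Rightarrow> code \<Rightarrow> code \<Rightarrow> code \<Rightarrow> code" where
  "special_code q w b r y = iter r (cst 0) (\<lambda>p e.
     ite (eq_code (dig_code q w (opr Add (opr Sub b (cst 1)) e)) y) (opr Add e (cst 1)) p)"

definition block_code :: "code \<Rightarrow> code \<Rightarrow> code \<Rightarrow> code \<Rightarrow> code" where
  "block_code q w b y = sum_code (opr Sub b (cst 1)) (\<lambda>j. less_code (dig_code q w j) (opr Add y (cst 1)))"

definition plain_code :: "code \<Rightarrow> code \<Rightarrow> code \<Rightarrow> code \<Rightarrow> code \<Rightarrow> code \<Rightarrow> code \<Rightarrow> code \<Rightarrow> code \<Rightarrow> code" where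
  "plain_code m q b G R w u y B = bind (dig_code R u B) (\<lambda>c.
     opr Add (opr Add (opr Mul B m) (table_code m q G c y)) (cst 1))"

definition member_code ::
    "code \<Rightarrow> code \<Rightarrow> code \<Rightarrow> code \<Rightarrow> code \<Rightarrow> code \<Rightarrow> code \<Rightarrow> code \<Rightarrow> code \<Rightarrow> code \<Rightarrow> code \<Rightarrow> code" where
  "member_code n b m r q L H G R W z =
     bind (opr Div z n) (\<lambda>j. bind (mod_code z n) (\<lambda>x. bind (mod_code j L) (\<lambda>i. bind (opr Div j L) (\<lambda>j'.
     bind (mod_code j' W) (\<lambda>w. bind (opr Div j' W) (\<lambda>u. bind (table_code q n H i x) (\<lambda>y.
     bind (special_code q w b r y) (\<lambda>e. ite e (opr Add (opr Mul b m) e)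
       (bind (block_code q w b y) (plain_code m q b G R w u y))))))))))"

text \<open>Both tables and the number of rows in use are computed once and kept on the stack; the
  final loop only decodes them, so \<open>exp (k / c)\<close> enters the running time through the
  length of the output alone.\<close>

definition splitter_code :: code where
  "splitter_code =
     store (root_code (var 1)) (\<lambda>s.
     store (opr Div (var 1) s) (\<lambda>b.
     store (opr Sub (var 1) (opr Mul b s)) (\<lambda>r.
     store (opr Mul (cst 4) (opr Mul (var 1) (var 1))) (\<lambda>q.
     store (opr Div (opr Sub (var 2) r) b) (\<lambda>m.
     store (power_code q s) (\<lambda>M.
     store (opr Mul q (bit_bound_code (var 0))) (\<lambda>L.
     store (opr Mul L (var 0)) (\<lambda>N.
     store (hash_code q (var 0) N) (\<lambda>H.
     store (opr Mul M q) (\<lambda>N'.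
     store (row_code M m q s N') (\<lambda>G.
     store (rounds_code M m q s G) (\<lambda>R.
     store (power_code q (opr Add (opr Sub b (cst 1)) r)) (\<lambda>W.
     emit (opr Mul (opr Mul (opr Mul L W) (power_code R b)) (var 0))
       (member_code (var 0) b m r q L H G R W))))))))))))))"

text \<open>Registers 0 to 2 hold the input, so the stack begins at 3.\<close>

definition splitter_program :: com where
  "splitter_program = splitter_code 3"

text \<open>A context of codes with the values they stand for. Extending it as a whole replaces
  moving each earlier binding to every new world.\<close>

primrec holds :: "nat \<Rightarrow> world \<Rightarrow> (code \<times> nat) list \<Rightarrow> bool" where
  "holds \<beta> w [] \<longleftrightarrow> True"
| "holds \<beta> w (x # xs) \<longleftrightarrow> computes \<beta> w (fst x) (snd x) 0 \<and> holds \<beta> w xs"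

lemma holds_extend: "holds \<beta> w xs \<Longrightarrow> w \<preceq> w' \<Longrightarrow> holds \<beta> w' xs"
  by (induction xs) (auto intro: computes_extend)

lemma computes_bind_holds:
  assumes "holds \<beta> w xs" "computes \<beta> w x v j"
    "\<And>w' z. holds \<beta> w' ((z, v) # xs) \<Longrightarrow> computes \<beta> w' (B z) u j'"
  shows "computes \<beta> w (bind x B) u (Suc (max j j'))"
proof (rule computes_bind[OF assms(2)])
  show "computes \<beta> w' (B z) u j'" if "w \<preceq> w'" "computes \<beta> w' z v 0" for w' z
    using that holds_extend[OF assms(1)] by (intro assms(3)) simp
qed

lemma emits_conv:
  "emits \<beta> w c ys j T \<Longrightarrow> j \<le> j' \<Longrightarrow> T \<le> T' \<Longrightarrow> emits \<beta> w c ys j' T'"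
  unfolding emits_def by (meson add_le_mono le_refl le_trans mult_le_mono)

text \<open>A uniform price per stored value: with depth at most 100, and two more powers of \<beta>
  charged by \<open>computes\<close>, it is \<open>\<beta> ^ 102\<close>.\<close>

lemma (in machine) emits_store_holds:
  assumes "holds \<beta> w xs" "comp w x v j"
    "\<And>w' z. holds \<beta> w' ((z, v) # xs) \<Longrightarrow> emits \<beta> w' (B z) ys j' T" "j \<le> 100"
  shows "emits \<beta> w (store x B) ys (Suc (max 100 j')) (\<beta> ^ 102 + T)"
proof (rule emits_conv[OF emits_store[OF assms(2)]])
  show "emits \<beta> w' (B z) ys j' T" if "w \<preceq> w'" "comp w' z v 0" for w' z
    using that assms(1) holds_extend by (intro assms(3)) auto
  show "\<beta> ^ (j + 2) + T \<le> \<beta> ^ 102 + T"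
    using assms(4) large by (intro add_right_mono power_increasing) auto
qed (use assms(4) in auto)

lemma power_le_two_power: "(a::nat) ^ e \<le> 2 ^ (a * e)"
  using power_mono[of a "2 ^ a" e] less_exp[of a] by (simp add: power_mult)

section \<open>Bit lengths and stack height of the whole program\<close>

context splitter_parameters
begin

text \<open>\<open>X\<close> dominates the input and \<open>M\<close>, hence also \<open>q\<close>,
  \<open>m\<close> and \<open>R\<close>. The largest numbers have bit length of order
  \<open>X ^ 4\<close>, for instance \<open>q ^ (L * n)\<close> with
  \<open>L * n \<le> X ^ 3\<close>, so its sixth power leaves room to spare. The summand 1000
  exceeds the numerical constants that occur.\<close>

definition X where "X = n + k + l + M + 1000"
definition \<beta> where "\<beta> = X ^ 6"

lemma X_ge: "1000 \<le> X" "n \<le> X" "k \<le> X" "l \<le> X" "M \<le> X" "n + 1 \<le> X"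
  by (auto simp: X_def)

lemma s_le_X: "s \<le> X" using s_le X_ge by simp
lemma b_le_X: "b \<le> X" using order_trans[OF div_le_dividend X_ge(3)] by (simp add: b_def)
lemma r_le_X: "r \<le> X" using X_ge(3) by (simp add: r_def)
lemma m_le_X: "m \<le> X" using order_trans[OF div_le_dividend[of "l - r" b], of X] X_ge(4) by (simp add: m_def)

lemma q_le_M: "q \<le> M"
  unfolding M_def using s_pos self_le_power[of q s] q_pos by simp

lemma q_le_X: "q \<le> X" using q_le_M X_ge(5) by simp

lemma R_le_M: "R \<le> M"
  unfolding R_def by (rule sum_of_bool_le)

lemma R_le_X: "R \<le> X" using R_le_M X_ge(5) by simp

lemma X_power: "i \<le> j \<Longrightarrow> X ^ i \<le> X ^ j"
  using X_ge(1) by (intro power_increasing) auto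

lemma L_le: "L \<le> X ^ 2"
  unfolding L_def power2_eq_square using q_le_X bit_bound_le[of n] X_ge(6) by (intro mult_mono) auto

lemma Ln_le: "L * n \<le> X ^ 3"
  using mult_mono[OF L_le X_ge(2)] by (simp add: eval_nat_numeral mult_ac)

lemma Mq_le: "M * q \<le> X ^ 2"
  unfolding power2_eq_square using q_le_X X_ge(5) by (intro mult_mono) auto

lemma beta_ge: "a * X ^ 4 < \<beta>" if "a \<le> 100"
proof -
  have "a * X ^ 4 < X * X ^ 4" using that X_ge(1) by (intro mult_strict_right_mono) auto
  also have "\<dots> \<le> \<beta>" unfolding \<beta>_def power_Suc[symmetric] by (rule X_power) simp
  finally show ?thesis .
qed

lemma le_beta: "v \<le> a * X ^ 4 \<Longrightarrow> a \<le> 100 \<Longrightarrow> v \<le> \<beta>"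
  using beta_ge[of a] by simp

lemma less_power_beta: "(v::nat) \<le> 2 ^ e \<Longrightarrow> e \<le> a * X ^ 4 \<Longrightarrow> a \<le> 100 \<Longrightarrow> v < 2 ^ \<beta>"
proof -
  assume "v \<le> 2 ^ e" "e \<le> a * X ^ 4" "a \<le> 100"
  then have "e < \<beta>" using beta_ge[of a] by linarith
  then have "(2::nat) ^ e < 2 ^ \<beta>" by simp
  then show ?thesis using \<open>v \<le> 2 ^ e\<close> by linarith
qed

lemma power_less: "a \<le> X \<Longrightarrow> e \<le> c * X ^ 3 \<Longrightarrow> c \<le> 100 \<Longrightarrow> a ^ e < 2 ^ \<beta>"
proof -
  assume "a \<le> X" "e \<le> c * X ^ 3" "c \<le> 100"
  then have "a * e \<le> X * (c * X ^ 3)" by (intro mult_mono) auto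
  also have "\<dots> = c * X ^ 4" by (simp add: eval_nat_numeral mult_ac)
  finally show ?thesis by (rule less_power_beta[OF power_le_two_power]) fact
qed

lemma X_le_powers: "X \<le> X ^ 2" "X \<le> X ^ 3" "X ^ 2 \<le> X ^ 3" "X \<le> X ^ 4" "X ^ 2 \<le> X ^ 4" "X ^ 3 \<le> X ^ 4"
  using X_power[of 1] X_power[of 2] X_power[of 3] by auto

sublocale machine \<beta>
  using beta_ge[of 1] X_le_powers(4) X_ge(1) by unfold_locales linarith

lemma le_X_beta: "v \<le> X \<Longrightarrow> v \<le> \<beta>"
  using le_beta[of v 1] X_le_powers by simp

lemma less_of_le: "v \<le> a * X ^ 4 \<Longrightarrow> a \<le> 100 \<Longrightarrow> v < 2 ^ \<beta>"
  using le_beta small_less by blast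

sublocale cover: cover_machine \<beta> m q s M
proof
  show "0 < m" "0 < q" "0 < M" by (rule m_pos q_pos M_pos)+
  show "m \<le> \<beta>" "q \<le> \<beta>" "s \<le> \<beta>" "M \<le> \<beta>"
    using m_le_X q_le_X s_le_X X_ge(5) by (auto intro: le_X_beta)
  show "q ^ s < 2 ^ \<beta>" using small_less[OF le_X_beta[OF X_ge(5)]] by (simp add: M_def)
  show "s * s < 2 ^ \<beta>" using s_square X_ge(3) by (intro small_less le_X_beta) simp
  have "M * m ^ s \<le> 2 ^ M * 2 ^ (m * s)"
    using less_exp[of M] by (intro mult_mono power_le_two_power) auto
  also have "\<dots> = 2 ^ (M + m * s)" by (simp add: power_add)
  finally show "M * m ^ s < 2 ^ \<beta>"
  proof (rule less_power_beta)
    have "m * s \<le> X ^ 2" unfolding power2_eq_square by (intro mult_mono m_le_X s_le_X) auto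
    then show "M + m * s \<le> 2 * X ^ 4" using X_ge(5) X_le_powers by linarith
  qed simp
  show "M * q \<le> \<beta>" using Mq_le X_le_powers by (intro le_beta[of _ 1]) auto
  show "m ^ (M * q) < 2 ^ \<beta>"
    using Mq_le X_le_powers by (intro power_less[of _ _ 1] m_le_X) auto
  show "m + q < 2 ^ \<beta>" using m_le_X q_le_X X_le_powers by (intro less_of_le[of _ 2]) auto
qed

lemma comp_root: "comp w ck k 0 \<Longrightarrow> comp w (root_code ck) s 10"
  unfolding root_code_def s_def root_floor_def
proof (rule computes_conv, rule comp_sum)
  assume ck: "comp w ck k 0"
  then show "comp w ck k 0" .
  fix w' z i assume w': "w \<preceq> w'" and i: "i < k" "comp w' z i 0"
  show "comp w' (bind (opr Add z (cst 1)) (\<lambda>x. not_code (opr Sub (opr Mul x x) ck)))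
    (of_bool ((i + 1) * (i + 1) - k = 0)) 4"
  proof (rule computes_conv, rule comp_bind)
    have i1: "i + 1 \<le> X" using i(1) X_ge(3) by simp
    then show "comp w' (opr Add z (cst 1)) (i + 1) (Suc (max 0 0))"
      using X_le_powers by (intro comp_add i comp_const less_of_le[of _ 1]) auto
    fix w'' x assume w'': "w' \<preceq> w''" and x: "comp w'' x (i + 1) 0"
    have "(i + 1) * (i + 1) \<le> X ^ 2" unfolding power2_eq_square using i1 by (intro mult_mono) auto
    then show "comp w'' (not_code (opr Sub (opr Mul x x) ck)) (of_bool ((i + 1) * (i + 1) - k = 0))
       (Suc (Suc (max (Suc (max 0 0)) 0)))"
      using X_le_powers
      by (intro comp_not comp_sub comp_mul x extend2[OF ck w' w''] less_of_le[of _ 1]) auto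
  qed auto
next
  have "(\<Sum>i<k. of_bool ((i + 1) * (i + 1) - k = 0) :: nat) \<le> k" by (rule sum_of_bool_le)
  then show "(\<Sum>i<k. of_bool ((i + 1) * (i + 1) - k = 0) :: nat) < 2 ^ \<beta>"
    using X_ge(3) by (intro small_less le_X_beta) simp
qed (use X_ge(3) le_X_beta in auto)

lemma comp_bit_bound: "comp w cn n 0 \<Longrightarrow> comp w (bit_bound_code cn) (bit_bound n) 10"
  unfolding bit_bound_code_def bit_bound_def
proof (rule computes_conv, rule comp_add, rule comp_const, simp, rule comp_sum)
  assume cn: "comp w cn n 0"
  then show "comp w cn n 0" .
  fix w' z i assume w': "w \<preceq> w'" and i: "i < n" "comp w' z i 0"
  show "comp w' (less_code (power_code (cst 2) z) cn) (of_bool (2 ^ i < n)) (2 + max (3 + max 0 0) 0)"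
  proof -
    have "i \<le> X" "i \<le> 1 * X ^ 3" using i X_ge(2) X_le_powers(2) by auto
    then show ?thesis using i X_ge(1)
      by (intro comp_less comp_power comp_const power_less[of _ _ 1] extend1[OF cn w'] le_X_beta) auto
  qed
next
  have *: "(\<Sum>i<n. of_bool (2 ^ i < n) :: nat) \<le> n" by (rule sum_of_bool_le)
  then show "(\<Sum>i<n. of_bool (2 ^ i < n) :: nat) < 2 ^ \<beta>"
    using X_ge(2) by (intro small_less le_X_beta) simp
  show "1 + (\<Sum>i<n. of_bool (2 ^ i < n) :: nat) < 2 ^ \<beta>"
    using * X_ge(6) by (intro small_less le_X_beta) simp
qed (use X_ge(2) le_X_beta in auto)

lemma W_exponent: "b - 1 + r \<le> 2 * X ^ 3"
  using b_le_X r_le_X X_le_powers by linarith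

lemma digit_exponent:
  assumes "e \<le> b - 1 + r"
  shows "e \<le> \<beta>" "q ^ e < 2 ^ \<beta>"
  using assms W_exponent X_le_powers by (auto intro: le_beta[of _ 2] power_less[of _ _ 2] q_le_X)

lemma comp_special:
  assumes args: "comp w cq q 0" "comp w cw v 0" "comp w cb b 0" "comp w cr r 0" "comp w cy y 0"
  shows "comp w (special_code cq cw cb cr cy) (special (\<lambda>e. dig q v (b - 1 + e)) y r) 20"
  unfolding special_code_def
proof (rule computes_conv, rule computes_iter[where a = "special (\<lambda>e. dig q v (b - 1 + e)) y"])
  show "comp w cr r 0" by fact
  show "comp w (cst 0) (special (\<lambda>e. dig q v (b - 1 + e)) y 0) 0" by (simp add: comp_const)
  fix w' e p z assume w': "w \<preceq> w'" and e: "e < r"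
    and p: "comp w' p (special (\<lambda>e. dig q v (b - 1 + e)) y e) 0" and z: "comp w' z e 0"
  note args' = args[THEN computes_extend, OF w']
  have le: "b - 1 + e \<le> b - 1 + r" using e by simp
  have "e + 1 \<le> X" using e r_le_X by simp
  then have e1: "e + 1 < 2 ^ \<beta>" by (intro small_less le_X_beta)
  have idx: "comp w' (opr Add (opr Sub cb (cst 1)) z) (b - 1 + e) 2"
    using small_less[OF digit_exponent(1)[OF le]]
    by (intro computes_conv[OF comp_add[OF comp_sub[OF args'(3) comp_const] z]]) auto
  have "comp w' (ite (eq_code (dig_code cq cw (opr Add (opr Sub cb (cst 1)) z)) cy) (opr Add z (cst 1)) p)
    (if of_bool (dig q v (b - 1 + e) = y) \<noteq> (0::nat) then e + 1 else special (\<lambda>e. dig q v (b - 1 + e)) y e) 13"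
    using e1 by (intro computes_conv[OF comp_ite[OF comp_eq[OF comp_dig[OF args'(1,2) idx q_pos digit_exponent[OF le]] args'(5)]
       comp_add[OF z comp_const] p]]) auto
  then show "comp w' (ite (eq_code (dig_code cq cw (opr Add (opr Sub cb (cst 1)) z)) cy) (opr Add z (cst 1)) p)
    (special (\<lambda>e. dig q v (b - 1 + e)) y (Suc e)) 13"
    by (rule computes_conv) auto
qed (use r_le_X le_X_beta in auto)

lemma comp_block:
  assumes args: "comp w cq q 0" "comp w cw v 0" "comp w cb b 0" "comp w cy y 0" and y: "y < q"
  shows "comp w (block_code cq cw cb cy) (block (dig q v) y (b - 1)) 15"
  unfolding block_code_def block_def
proof (rule computes_conv, rule comp_sum, rule comp_sub, rule args, rule comp_const, simp)
  fix w' z j assume w': "w \<preceq> w'" and j: "j < b - 1" "comp w' z j 0"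
  note args' = args[THEN computes_extend, OF w']
  have "y + 1 \<le> X" using y q_le_X by simp
  then have y1: "y + 1 < 2 ^ \<beta>" by (intro small_less le_X_beta)
  have le: "j \<le> b - 1 + r" using j by simp
  show "comp w' (less_code (dig_code cq cw z) (opr Add cy (cst 1))) (of_bool (dig q v j < Suc y)) 11"
    using y1 by (intro computes_conv[OF comp_less[OF comp_dig[OF args'(1,2) j(2) q_pos digit_exponent[OF le]]
      comp_add[OF args'(4) comp_const]]]) auto
next
  show "b - 1 \<le> \<beta>" using b_le_X by (intro le_X_beta) simp
  show "(\<Sum>j<b - 1. of_bool (dig q v j < Suc y) :: nat) < 2 ^ \<beta>"
    using sum_of_bool_le[of "\<lambda>j. dig q v j < Suc y" "b - 1"] b_le_X
    by (intro small_less le_X_beta) linarith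
qed auto

lemma comp_plain:
  assumes args: "comp w cm m 0" "comp w cq q 0" "comp w cG G 0" "comp w cR R 0" "comp w cu u 0"
     "comp w cy y 0" "comp w cB B 0" and y: "y < q" and B: "B < b"
  shows "comp w (plain_code cm cq cb cG cR cw cu cy cB) (B * m + table m q G (dig R u B) y + 1) 20"
  unfolding plain_code_def
proof (rule computes_conv, rule comp_bind)
  have "B \<le> X" "B \<le> 1 * X ^ 3" using B b_le_X X_le_powers by auto
  then show "comp w (dig_code cR cu cB) (dig R u B) (7 + max 0 (max 0 0))"
    by (intro comp_dig args R_pos le_X_beta power_less[of _ _ 1] R_le_X) auto
  fix w' cc assume w': "w \<preceq> w'" and cc: "comp w' cc (dig R u B) 0"
  note args' = args[THEN computes_extend, OF w']
  have "dig R u B < M" using dig_less[OF R_pos, of u B] R_le_M by linarith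
  then have le: "dig R u B * q + y \<le> M * q" using row_index_less[OF _ y] by (simp add: less_imp_le)
  have t: "comp w' (table_code cm cq cG cc cy) (table m q G (dig R u B) y) 9"
    using comp_table[OF args'(1-3) cc args'(6) m_pos _ cover.m_power[OF le]] le cover.N(1) by simp
  have "table m q G (dig R u B) y < m" using m_pos by (simp add: table_def dig_less)
  then have "B * m + table m q G (dig R u B) y + 1 \<le> Suc B * m" by simp
  also have "\<dots> \<le> b * m" using B by (intro mult_right_mono) auto
  also have "\<dots> \<le> X" using range_le X_ge(4) by simp
  finally have "B * m + table m q G (dig R u B) y + 1 < 2 ^ \<beta>" by (intro small_less le_X_beta)
  then show "comp w' (opr Add (opr Add (opr Mul cB cm) (table_code cm cq cG cc cy)) (cst 1))
    (B * m + table m q G (dig R u B) y + 1) 15"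
    by (intro computes_conv[OF comp_add[OF comp_add[OF comp_mul[OF args'(7,1)] t] comp_const]]) auto
qed auto

lemma comp_member:
  assumes args: "comp w cn n 0" "comp w cb b 0" "comp w cm m 0" "comp w cr r 0" "comp w cq q 0"
    "comp w cL L 0" "comp w cH H 0" "comp w cG G 0" "comp w cR R 0" "comp w cW W 0" "comp w cz z 0"
  shows "comp w (member_code cn cb cm cr cq cL cH cG cR cW cz) (member (z div n) (z mod n)) 60"
proof -
  let ?j = "z div n" and ?x = "z mod n"
  let ?y = "table q n H (?j mod L) ?x" and ?v = "?j div L mod W" and ?u = "?j div L div W"
  let ?e = "special (\<lambda>e. dig q ?v (b - 1 + e)) ?y r" and ?B = "block (dig q ?v) ?y (b - 1)"
  have y: "?y < q" using q_pos by (simp add: table_def dig_less)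
  have B: "?B < b" using block_le[of "dig q ?v" ?y "b - 1"] b_pos by simp
  have "b * m + ?e \<le> X" using special_le[of "\<lambda>e. dig q ?v (b - 1 + e)" ?y r] range_le X_ge(4) by linarith
  then have be: "b * m + ?e < 2 ^ \<beta>" by (intro small_less le_X_beta)
  then have bm: "b * m < 2 ^ \<beta>" by linarith
  have "?j mod L * n + ?x < L * n" using L_pos n by (intro row_index_less) auto
  then have idx: "?j mod L * n + ?x \<le> \<beta>" "q ^ (?j mod L * n + ?x) < 2 ^ \<beta>"
    using Ln_le X_le_powers by (auto intro!: le_beta[of _ 1] power_less[of _ _ 1] q_le_X)
  let ?xs = "[(cn, n), (cb, b), (cm, m), (cr, r), (cq, q), (cL, L), (cH, H), (cG, G), (cR, R), (cW, W), (cz, z)]"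
  have base: "holds \<beta> w ?xs" using args by simp
  have final: "comp w' (ite ce (opr Add (opr Mul cb cm) ce) (bind (block_code cq cv cb cy) (plain_code cm cq cb cG cR cv cu cy)))
      (member (z div n) (z mod n)) 40"
    if h': "holds \<beta> w' ((ce, ?e) # (cy, ?y) # (cu, ?u) # (cv, ?v) # ?xs)" for w' ce cy cu cv
  proof -
    have "comp w' (bind (block_code cq cv cb cy) (plain_code cm cq cb cG cR cv cu cy))
        (?B * m + table m q G (dig R ?u ?B) ?y + 1) (Suc (max 15 20))"
    proof (rule comp_bind)
      show "comp w' (block_code cq cv cb cy) ?B 15" using h' y by (intro comp_block) auto
      show "comp w'' (plain_code cm cq cb cG cR cv cu cy cB) (?B * m + table m q G (dig R ?u ?B) ?y + 1) 20"
        if "w' \<preceq> w''" "comp w'' cB ?B 0" for w'' cB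
        using h' y B that by (intro comp_plain) (auto elim: extend1)
    qed
    moreover have "comp w' (opr Add (opr Mul cb cm) ce) (b * m + ?e) (Suc (max (Suc (max 0 0)) 0))"
      using h' be bm by (intro comp_add comp_mul) auto
    moreover have "comp w' ce ?e 0" using h' by simp
    ultimately show ?thesis
      by (intro computes_conv[OF comp_ite])
        (auto simp: member_def colour_def Let_def)
  qed
  show ?thesis
    unfolding member_code_def
    by (rule computes_conv,
        rule computes_bind_holds[OF base], rule comp_div[of _ _ z 0 _ n 0], rule args, rule args,
        rule computes_bind_holds, assumption, rule comp_mod[of _ _ z 0 _ n 0], simp, simp,
        rule computes_bind_holds, assumption, rule comp_mod[of _ _ ?j 0 _ L 0], simp, simp,
        rule computes_bind_holds, assumption, rule comp_div[of _ _ ?j 0 _ L 0], simp, simp,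
        rule computes_bind_holds, assumption, rule comp_mod[of _ _ "?j div L" 0 _ W 0], simp, simp,
        rule computes_bind_holds, assumption, rule comp_div[of _ _ "?j div L" 0 _ W 0], simp, simp,
        rule computes_bind_holds, assumption,
        rule comp_table[of _ _ q _ n _ H _ "?j mod L" _ ?x 0], simp, simp, simp, simp, simp, rule q_pos, rule idx, rule idx,
        rule computes_bind_holds, assumption,
        rule comp_special[of _ _ _ ?v _ _ _ ?y], simp, simp, simp, simp, simp,
        rule final, simp, simp_all)
qed

lemma comp_parameters:
  shows comp_b: "comp w ck k 0 \<Longrightarrow> comp w cs s 0 \<Longrightarrow> comp w (opr Div ck cs) b 1"
    and comp_r: "comp w ck k 0 \<Longrightarrow> comp w cb b 0 \<Longrightarrow> comp w cs s 0 \<Longrightarrow> comp w (opr Sub ck (opr Mul cb cs)) r 2"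
    and comp_q: "comp w ck k 0 \<Longrightarrow> comp w (opr Mul (cst 4) (opr Mul ck ck)) q 2"
    and comp_m: "comp w cl l 0 \<Longrightarrow> comp w cr r 0 \<Longrightarrow> comp w cb b 0 \<Longrightarrow> comp w (opr Div (opr Sub cl cr) cb) m 2"
    and comp_M: "comp w cq q 0 \<Longrightarrow> comp w cs s 0 \<Longrightarrow> comp w (power_code cq cs) M 3"
    and comp_L: "comp w cq q 0 \<Longrightarrow> comp w cn n 0 \<Longrightarrow> comp w (opr Mul cq (bit_bound_code cn)) L 11"
    and comp_Ln: "comp w cL L 0 \<Longrightarrow> comp w cn n 0 \<Longrightarrow> comp w (opr Mul cL cn) (L * n) 1"
    and comp_Mq: "comp w cM M 0 \<Longrightarrow> comp w cq q 0 \<Longrightarrow> comp w (opr Mul cM cq) (M * q) 1"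
    and comp_W: "comp w cq q 0 \<Longrightarrow> comp w cb b 0 \<Longrightarrow> comp w cr r 0 \<Longrightarrow>
      comp w (power_code cq (opr Add (opr Sub cb (cst 1)) cr)) W 10"
proof -
  have kk: "k * k < 2 ^ \<beta>" "4 * (k * k) < 2 ^ \<beta>"
    using small_less[OF le_X_beta[OF q_le_X]] by (auto simp: q_def)
  have bs: "b * s < 2 ^ \<beta>" using k_eq small_less[OF le_X_beta[OF X_ge(3)]] by linarith
  show "comp w (opr Div ck cs) b 1" if "comp w ck k 0" "comp w cs s 0"
    using comp_div[OF that] by (simp add: b_def)
  show "comp w (opr Sub ck (opr Mul cb cs)) r 2" if "comp w ck k 0" "comp w cb b 0" "comp w cs s 0"
    using that bs unfolding r_def by (intro computes_conv[OF comp_sub[OF _ comp_mul]]) auto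
  show "comp w (opr Mul (cst 4) (opr Mul ck ck)) q 2" if "comp w ck k 0"
    using that kk unfolding q_def by (intro computes_conv[OF comp_mul[OF comp_const comp_mul]]) auto
  show "comp w (opr Div (opr Sub cl cr) cb) m 2" if "comp w cl l 0" "comp w cr r 0" "comp w cb b 0"
    using that unfolding m_def by (intro computes_conv[OF comp_div[OF comp_sub]]) auto
  show "comp w (power_code cq cs) M 3" if "comp w cq q 0" "comp w cs s 0"
    using that q_pos cover.s(1) cover.q(3) unfolding M_def by (intro computes_conv[OF comp_power]) auto
  show "comp w (opr Mul cq (bit_bound_code cn)) L 11" if "comp w cq q 0" "comp w cn n 0"
    using comp_mul[OF that(1) comp_bit_bound[OF that(2)]] L_le X_le_powers less_of_le[of L 1]
    by (simp add: L_def)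
  show "comp w (opr Mul cL cn) (L * n) 1" if "comp w cL L 0" "comp w cn n 0"
    using comp_mul[OF that] Ln_le X_le_powers less_of_le[of "L * n" 1] by simp
  show "comp w (opr Mul cM cq) (M * q) 1" if "comp w cM M 0" "comp w cq q 0"
    using comp_mul[OF that] small_less[OF cover.N(1)] by simp
  show "comp w (power_code cq (opr Add (opr Sub cb (cst 1)) cr)) W 10"
    if "comp w cq q 0" "comp w cb b 0" "comp w cr r 0"
    using that q_pos digit_exponent[OF order_refl] small_less[OF digit_exponent(1)[OF order_refl]] unfolding W_def
    by (intro computes_conv[OF comp_power[OF _ comp_add[OF comp_sub[OF _ comp_const]]]]) auto
qed

lemma comp_H: "comp w cq q 0 \<Longrightarrow> comp w cn n 0 \<Longrightarrow> comp w cN (L * n) 0 \<Longrightarrow> comp w (hash_code cq cn cN) H 50"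
  unfolding H_def
proof (rule comp_hash)
  show "L * n \<le> \<beta>" using Ln_le X_le_powers by (intro le_beta[of _ 1]) auto
  show "q ^ (L * n) < 2 ^ \<beta>" using Ln_le by (intro power_less[of _ _ 1] q_le_X) auto
  have "n * 2 ^ (L * n) \<le> 2 ^ n * 2 ^ (L * n)" using less_exp[of n] by (intro mult_right_mono) auto
  also have "\<dots> = 2 ^ (n + L * n)" by (simp add: power_add)
  finally show "n * 2 ^ (L * n) < 2 ^ \<beta>"
    using Ln_le X_ge(2) X_le_powers by (intro less_power_beta[of _ _ 2]) auto
  show "q \<le> \<beta>" using q_le_X by (rule le_X_beta)
qed (use n q_pos in auto)

lemma comp_R:
  "comp w cM M 0 \<Longrightarrow> comp w cm m 0 \<Longrightarrow> comp w cq q 0 \<Longrightarrow> comp w cs s 0 \<Longrightarrow> comp w cG G 0 \<Longrightarrow>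
    comp w (rounds_code cM cm cq cs cG) R 40"
  unfolding R_def by (rule cover.comp_rounds)

lemma comp_G:
  "comp w cM M 0 \<Longrightarrow> comp w cm m 0 \<Longrightarrow> comp w cq q 0 \<Longrightarrow> comp w cs s 0 \<Longrightarrow> comp w cN (M * q) 0 \<Longrightarrow>
    comp w (row_code cM cm cq cs cN) G 60"
  unfolding G_def by (rule cover.comp_row)

lemma comp_size:
  assumes "comp w cL L 0" "comp w cW W 0" "comp w cR R 0" "comp w cb b 0" "comp w cn n 0"
  shows "comp w (opr Mul (opr Mul (opr Mul cL cW) (power_code cR cb)) cn) (T * n) 10"
proof -
  have b: "b \<le> \<beta>" "b \<le> 1 * X ^ 3" using b_le_X X_le_powers by (auto intro: le_X_beta)
  have Rb: "R ^ b < 2 ^ \<beta>" using b R_le_X by (intro power_less[of _ _ 1]) auto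
  have "T * n \<le> 2 ^ L * 2 ^ (q * (b - 1 + r)) * 2 ^ (R * b) * 2 ^ n"
    unfolding T_def W_def using less_exp[of L] less_exp[of n]
    by (intro mult_mono power_le_two_power) auto
  also have "\<dots> = 2 ^ (L + q * (b - 1 + r) + R * b + n)" by (simp add: power_add)
  finally have Tn: "T * n < 2 ^ \<beta>"
  proof (rule less_power_beta)
    have "q * (b - 1 + r) \<le> X * (2 * X ^ 3)" by (intro mult_mono q_le_X W_exponent) auto
    also have "\<dots> = 2 * X ^ 4" by (simp add: eval_nat_numeral algebra_simps)
    finally have "q * (b - 1 + r) \<le> 2 * X ^ 4" .
    moreover have "R * b \<le> X ^ 2" unfolding power2_eq_square by (intro mult_mono R_le_X b_le_X) auto
    ultimately show "L + q * (b - 1 + r) + R * b + n \<le> 5 * X ^ 4"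
      using L_le X_ge(2) X_le_powers by linarith
  qed simp
  \<comment> \<open>Intermediate products need bounds too; the remaining factors are positive, so
    each is at most the final product.\<close>
  have "T * 1 \<le> T * n" using n by (intro mult_left_mono) auto
  then have T: "T < 2 ^ \<beta>" using Tn by linarith
  have "L * W * 1 \<le> T" unfolding T_def using R_pos by (intro mult_left_mono) auto
  then have LW: "L * W < 2 ^ \<beta>" using T by linarith
  show ?thesis
    using assms Tn T LW b Rb R_pos
    by (intro computes_conv[OF comp_mul[OF comp_mul[OF comp_mul comp_power]]]) (auto simp: T_def)
qed

text \<open>The 14 consists of thirteen stored values and one extra unit for the set-up of the
  output loop, all charged at the same power of \<beta>.\<close>

theorem exec_splitter_program:
  "\<exists>t m'. exec splitter_program (initial n k l) t (m', value_tables n family) \<and> t \<le> (T * n + 14) * \<beta> ^ 102"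
proof -
  define mem0 :: mem where "mem0 = (\<lambda>_. 0)(0 := n, 1 := k, 2 := l)"
  have var: "comp (3, mem0) (var 0) n 0" "comp (3, mem0) (var 1) k 0" "comp (3, mem0) (var 2) l 0"
    using computes_var[of mem0 0 \<beta> 3] computes_var[of mem0 1 \<beta> 3] computes_var[of mem0 2 \<beta> 3]
      small_less[OF le_X_beta] X_ge by (auto simp: mem0_def)
  then have base: "holds \<beta> (3, mem0) [(var 0, n), (var 1, k), (var 2, l)]" by simp
  have member: "comp w' (member_code (var 0) cb cm cr cq cL cH cG cR cW cz) (member (z div n) (z mod n)) 60"
    if "w \<preceq> w'" "comp w' cz z 0" "holds \<beta> w [(cW, W), (cR, R), (cG, G), (cN', M * q), (cH, H), (cN, L * n),
      (cL, L), (cM, M), (cm, m), (cq, q), (cr, r), (cb, b), (cs, s), (var 0, n), (var 1, k), (var 2, l)]"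
    for w w' cW cR cG cN' cH cN cL cM cm cq cr cb cs cz z
    using that(2) holds_extend[OF that(3,1)] by (intro comp_member) auto
  have "(T * n + 1) * \<beta> ^ (max 10 60 + 3) \<le> (T * n + 1) * \<beta> ^ 102"
    using large by (intro mult_left_mono power_increasing) auto
  then have time: "(T * n + 1) * \<beta> ^ (max 10 60 + 3) + 13 * \<beta> ^ 102 \<le> (T * n + 14) * \<beta> ^ 102"
    by (simp add: add_mult_distrib)
  have e: "emits \<beta> (3, mem0) splitter_code (map (\<lambda>z. member (z div n) (z mod n)) [0..<T * n]) 120
      ((T * n + 14) * \<beta> ^ 102)"
    unfolding splitter_code_def
    by (rule emits_conv, rule emits_store_holds[OF base], rule comp_root, rule var,
        rule emits_store_holds, assumption, rule comp_b, simp, simp,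
        rule emits_store_holds, assumption, rule comp_r, simp, simp, simp,
        rule emits_store_holds, assumption, rule comp_q, simp,
        rule emits_store_holds, assumption, rule comp_m, simp, simp, simp,
        rule emits_store_holds, assumption, rule comp_M, simp, simp,
        rule emits_store_holds, assumption, rule comp_L, simp, simp,
        rule emits_store_holds, assumption, rule comp_Ln, simp, simp,
        rule emits_store_holds, assumption, rule comp_H, simp, simp, simp,
        rule emits_store_holds, assumption, rule comp_Mq, simp, simp,
        rule emits_store_holds, assumption, rule comp_G, simp, simp, simp, simp, simp,
        rule emits_store_holds, assumption, rule comp_R, simp, simp, simp, simp, simp,
        rule emits_store_holds, assumption, rule comp_W, simp, simp, simp,
        rule emits_emit, rule comp_size, simp, simp, simp, simp, simp,
        rule member, assumption, assumption, assumption,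
        use time in simp_all)
  \<comment> \<open>The program starts at register 3 and is treated as having depth 120.\<close>
  have d: "3 + 4 * 120 + 64 \<le> \<beta>"
    using beta_ge[of 1] X_le_powers(4) X_ge(1) by linarith
  from e[unfolded emits_def, THEN spec[of _ 3], THEN spec[of _ mem0], THEN spec[of _ "[]"], THEN mp, OF conjI[OF extends_refl d]]
  show ?thesis
    unfolding value_tables_family initial_def mem0_def[symmetric] splitter_program_def append_Nil .
qed

end

section \<open>Asymptotics\<close>


text \<open>An upper bound for \<open>s / m\<close>; for small \<open>k\<close> the general denominator need not be positive.\<close>

definition load :: "real \<Rightarrow> nat \<Rightarrow> real" where
  "load c k = (if k < 16 then 1 else 1 / (c - 3 / sqrt (real k)))"

text \<open>The factors bound, in turn, \<open>q\<close> as a factor of \<open>L\<close>; the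
  guesses \<open>q ^ (b - 1 + r)\<close>, where \<open>b - 1 + r \<le> 3 * sqrt k\<close>; and the
  non-exponential and the exponential part of \<open>R ^ b\<close>, where
  \<open>b \<le> 2 * sqrt k\<close>. The factor \<open>bit_bound n\<close> is kept apart.\<close>

definition size_bound :: "real \<Rightarrow> nat \<Rightarrow> real" where
  "size_bound c k = (4 * real k ^ 2) * (4 * real k ^ 2) powr (3 * sqrt (real k)) *
     (1 + sqrt (real k) * ln (4 * real k ^ 2)) powr (2 * sqrt (real k)) * exp (real k * load c k)"

text \<open>Bounds \<open>X / n\<close>: the power with exponent \<open>sqrt k\<close> stands for
  \<open>M = q ^ s\<close>, and 1001 is the 1000 in \<open>X\<close> plus 1 for \<open>n\<close>
  itself.\<close>

definition memory_bound :: "real \<Rightarrow> nat \<Rightarrow> real" where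
  "memory_bound c k = real k + c * real k + (4 * real k ^ 2) powr sqrt (real k) + 1001"

lemma four_squares:
  assumes "1 \<le> k"
  shows "4 \<le> 4 * real k ^ 2" "0 < ln (4 * real k ^ 2)"
proof -
  have "1 \<le> real k ^ 2" using assms by simp
  then show "4 \<le> 4 * real k ^ 2" by simp
  then show "0 < ln (4 * real k ^ 2)" by (intro ln_gt_zero) linarith
qed

lemma ln_size_bound:
  assumes "1 \<le> k"
  shows "ln (size_bound c k) = ln (4 * real k ^ 2) + 3 * sqrt (real k) * ln (4 * real k ^ 2) +
    2 * sqrt (real k) * ln (1 + sqrt (real k) * ln (4 * real k ^ 2)) + real k * load c k"
    "1 \<le> size_bound c k \<or> load c k < 0"
proof -
  note four = four_squares[OF assms]
  have one: "1 \<le> 1 + sqrt (real k) * ln (4 * real k ^ 2)" using four by simp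
  show "ln (size_bound c k) = ln (4 * real k ^ 2) + 3 * sqrt (real k) * ln (4 * real k ^ 2) +
    2 * sqrt (real k) * ln (1 + sqrt (real k) * ln (4 * real k ^ 2)) + real k * load c k"
  proof -
    have gen: "ln (a * a powr u * y powr v * exp w) = ln a + u * ln a + v * ln y + w"
      if "0 < a" "0 < y" for a u y v w :: real
      using that by (simp add: ln_mult ln_powr)
    show ?thesis unfolding size_bound_def by (rule gen) (use four one in linarith)+
  qed
  show "1 \<le> size_bound c k \<or> load c k < 0"
  proof (cases "load c k < 0")
    case False
    then have "1 \<le> exp (real k * load c k)" by simp
    moreover have "1 \<le> (4 * real k ^ 2) powr (3 * sqrt (real k))"
      "1 \<le> (1 + sqrt (real k) * ln (4 * real k ^ 2)) powr (2 * sqrt (real k))"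
      using four one by (auto intro!: ge_one_powr_ge_zero)
    ultimately have "1 * 1 * 1 * 1 \<le> size_bound c k"
      unfolding size_bound_def using four by (intro mult_mono) auto
    then show ?thesis by simp
  qed simp
qed

text \<open>From 16 on the root is at least 4, so \<open>3 / sqrt k\<close> is below
  \<open>1 \<le> c\<close>; this explains the threshold in \<open>load\<close>.\<close>

lemma load_pos: "1 \<le> c \<Longrightarrow> 0 < load c k"
proof (cases "k < 16")
  case False
  assume c: "1 \<le> c"
  have "4 \<le> sqrt (real k)" using False by (intro real_le_rsqrt) simp
  then have "3 / sqrt (real k) < 1" by (subst pos_divide_less_eq) linarith+
  then have "0 < 1 / (c - 3 / sqrt (real k))" using c by (intro divide_pos_pos) linarith+
  then show ?thesis using False by (simp only: load_def if_False)
qed (simp add: load_def)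

lemma size_bound_ge_1: "1 \<le> c \<Longrightarrow> 1 \<le> k \<Longrightarrow> 1 \<le> size_bound c k"
  using ln_size_bound(2)[of k c] load_pos[of c k] by linarith

lemma eventually_ln_size_bound:
  "\<forall>\<^sub>F k in at_top. ln (size_bound c k) / real k =
    (ln (4 * real k ^ 2) + 3 * sqrt (real k) * ln (4 * real k ^ 2) +
    2 * sqrt (real k) * ln (1 + sqrt (real k) * ln (4 * real k ^ 2))) / real k + 1 / (c - 3 / sqrt (real k))"
  using eventually_ge_at_top[of "16 :: nat"]
proof eventually_elim
  case (elim k)
  then have "load c k = 1 / (c - 3 / sqrt (real k))" by (simp add: load_def)
  then show ?case using ln_size_bound(1)[of k c] elim by (simp add: add_divide_distrib)
qed

text \<open>All factors but the last have logarithms of order at most \<open>sqrt k * ln k\<close>,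
  which vanish after division by \<open>k\<close>; the last contributes
  \<open>1 / (c - 3 / sqrt k)\<close>.\<close>

lemma tendsto_ln_size_bound:
  assumes "1 \<le> c"
  shows "(\<lambda>k. ln (size_bound c k) / real k) \<longlonglongrightarrow> 1 / c"
proof -
  have "(\<lambda>k. (ln (4 * real k ^ 2) + 3 * sqrt (real k) * ln (4 * real k ^ 2) +
    2 * sqrt (real k) * ln (1 + sqrt (real k) * ln (4 * real k ^ 2))) / real k) \<longlonglongrightarrow> 0"
    by real_asymp
  moreover have "(\<lambda>k. 3 / sqrt (real k)) \<longlonglongrightarrow> 0" by real_asymp
  then have "(\<lambda>k. 1 / (c - 3 / sqrt (real k))) \<longlonglongrightarrow> 1 / (c - 0)"
    using assms by (intro tendsto_intros) auto
  ultimately have "(\<lambda>k. (ln (4 * real k ^ 2) + 3 * sqrt (real k) * ln (4 * real k ^ 2) +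
    2 * sqrt (real k) * ln (1 + sqrt (real k) * ln (4 * real k ^ 2))) / real k + 1 / (c - 3 / sqrt (real k)))
    \<longlonglongrightarrow> 0 + 1 / (c - 0)" by (rule tendsto_add)
  then show ?thesis
    using tendsto_cong[OF eventually_ln_size_bound[of c]] by simp
qed

lemma memory_bound_ge: "1 \<le> c \<Longrightarrow> 1001 \<le> memory_bound c k"
  by (simp add: memory_bound_def)

lemma tendsto_ln_memory_bound:
  assumes "1 \<le> c"
  shows "(\<lambda>k. ln (memory_bound c k) / real k) \<longlonglongrightarrow> 0"
  unfolding memory_bound_def using assms by real_asymp

text \<open>Absorbs the finitely many exceptions of an asymptotic bound into the constant, so that
  the final estimate can hold for every \<open>k\<close>.\<close>

lemma eventually_le_imp_le:
  fixes f g :: "nat \<Rightarrow> real"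
  assumes "\<forall>\<^sub>F k in at_top. f k \<le> g k" "\<And>k. 0 < g k"
  shows "\<exists>D :: nat. \<forall>k. f k \<le> real D * g k"
proof -
  obtain K where K: "\<And>k. K \<le> k \<Longrightarrow> f k \<le> g k"
    using assms(1) by (auto simp: eventually_at_top_linorder)
  define d where "d = 1 + (\<Sum>k<K. \<bar>f k\<bar> / g k)"
  have nonneg: "0 \<le> \<bar>f k\<bar> / g k" for k using assms(2)[of k] by simp
  have "f k \<le> d * g k" for k
  proof (cases "k < K")
    case True
    then have "\<bar>f k\<bar> / g k \<le> (\<Sum>k<K. \<bar>f k\<bar> / g k)" using nonneg by (intro member_le_sum) auto
    then have "\<bar>f k\<bar> / g k \<le> d" by (simp add: d_def)
    then have "\<bar>f k\<bar> \<le> d * g k" using assms(2)[of k] by (simp add: pos_divide_le_eq)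
    then show ?thesis by linarith
  next
    case False
    have "1 \<le> d" using nonneg by (simp add: d_def sum_nonneg)
    then have "1 * g k \<le> d * g k" using assms(2)[of k] by (intro mult_right_mono) auto
    then show ?thesis using K[of k] False by simp
  qed
  moreover have "d * g k \<le> real (nat \<lceil>d\<rceil>) * g k" for k
    using assms(2)[of k] by (intro mult_right_mono) (auto simp: real_nat_ceiling_ge)
  ultimately show ?thesis by (intro exI[of _ "nat \<lceil>d\<rceil>"]) (meson order_trans)
qed

text \<open>The exponent is \<open>k / c + o(k)\<close>, eventually below \<open>2 * k\<close> for
  any fixed power \<open>N\<close> of the memory bound, and \<open>2 \<le> 9 * ln 2\<close>.\<close>

lemma time_constant:
  assumes "1 \<le> c"
  shows "\<exists>D :: nat. \<forall>k\<ge>1. size_bound c k * memory_bound c k ^ N \<le> real D * 2 ^ (9 * k)"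
proof -
  have "(\<lambda>k. ln (size_bound c k) / real k + real N * (ln (memory_bound c k) / real k)) \<longlonglongrightarrow> 1 / c + real N * 0"
    by (intro tendsto_intros tendsto_ln_size_bound tendsto_ln_memory_bound assms)
  moreover have "1 / c + real N * 0 < 2" using assms by (simp add: divide_less_eq)
  ultimately have "\<forall>\<^sub>F k in at_top. ln (size_bound c k) / real k + real N * (ln (memory_bound c k) / real k) < 2"
    by (rule order_tendstoD)
  then have "\<forall>\<^sub>F k in at_top. size_bound c k * memory_bound c k ^ N \<le> 2 ^ (9 * k)"
    using eventually_ge_at_top[of "1 :: nat"]
  proof eventually_elim
    case (elim k)
    have pos: "0 < size_bound c k" "0 < memory_bound c k"
      using size_bound_ge_1[OF assms elim(2)] memory_bound_ge[OF assms, of k] by auto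
    have "ln (size_bound c k * memory_bound c k ^ N) = ln (size_bound c k) + real N * ln (memory_bound c k)"
      using pos by (simp add: ln_mult ln_realpow)
    also have "\<dots> = (ln (size_bound c k) / real k + real N * (ln (memory_bound c k) / real k)) * real k"
      using elim(2) by (simp add: field_simps)
    also have "\<dots> \<le> 2 * real k" using elim by (intro mult_right_mono) auto
    also have "1 / 2 \<le> ln (2 :: real)" using ln_le_minus_one[of "1 / 2 :: real"] by (simp add: ln_div)
    then have "2 * real k \<le> (9 * ln 2) * real k" by (intro mult_right_mono) auto
    also have "\<dots> = ln (2 ^ (9 * k))" by (simp add: ln_realpow)
    finally show ?case using pos by simp
  qed
  then show ?thesis using eventually_le_imp_le[of "\<lambda>k. size_bound c k * memory_bound c k ^ N" "\<lambda>k. 2 ^ (9 * k)"]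
    by auto
qed

section \<open>Size and time of the family in terms of k and n\<close>

context splitter_parameters
begin

lemma sqrt_le_two_s: "sqrt (real k) \<le> 2 * real s"
  using sqrt_s(2) s_pos by linarith

lemma b_le_sqrt: "real b \<le> 2 * sqrt (real k)"
proof -
  have "real b * sqrt (real k) \<le> real b * (2 * real s)" using sqrt_le_two_s by (intro mult_left_mono) auto
  also have "\<dots> = 2 * real (b * s)" by simp
  also have "b * s \<le> k" using k_eq by linarith
  then have "2 * real (b * s) \<le> 2 * real k" by (simp only: mult_le_cancel_left_pos zero_less_numeral of_nat_le_iff)
  also have "\<dots> = (2 * sqrt (real k)) * sqrt (real k)" by simp
  finally show ?thesis using k by (simp only: mult_le_cancel_right) auto
qed

lemma r_le_sqrt: "real r \<le> sqrt (real k)"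
  using r_less sqrt_s(1) by linarith

lemma real_q: "real q = 4 * real k ^ 2"
  by (simp add: q_def power2_eq_square)

text \<open>Rounding loses fewer than \<open>b\<close> colours and the special points take
  \<open>r\<close>, together at most \<open>3 * sqrt k\<close>. So \<open>b * m\<close> is at least
  \<open>(c - 3 / sqrt k) * k\<close>, hence at least \<open>(c - 3 / sqrt k) * b * s\<close>, which
  bounds \<open>s / m\<close>; the other factor \<open>b * s\<close> is at most
  \<open>k\<close>.\<close>

lemma load_ge:
  assumes "real l = c * real k" "1 \<le> c"
  shows "real b * (real s ^ 2 / real m) \<le> real k * load c k"
proof -
  have m: "0 < real m" using m_pos by simp
  have bs: "real b * real s \<le> real k" using k_eq by (metis le_add1 of_nat_le_iff of_nat_mult)
  have "real s / real m \<le> load c k"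
  proof (cases "k < 16")
    case True
    then show ?thesis using s_le_m m by (simp add: load_def)
  next
    case False
    let ?S = "sqrt (real k)"
    have S: "4 \<le> ?S" using False by (intro real_le_rsqrt) simp
    have "l - r < b * m + b" unfolding m_def using b_pos by (metis dividend_less_times_div mult.commute add.commute)
    then have "l < b * m + b + r" by linarith
    then have "real l < real b * real m + real b + real r" by (metis of_nat_add of_nat_less_iff of_nat_mult)
    then have bm: "c * real k - 3 * ?S \<le> real b * real m"
      using b_le_sqrt r_le_sqrt assms(1) by linarith
    have "3 / ?S * real k = 3 * (real k / ?S)" by simp
    also have "real k / ?S = ?S" by (rule real_div_sqrt) simp
    finally have "(c - 3 / ?S) * real k = c * real k - 3 * ?S" by (simp only: left_diff_distrib)
    then have "(c - 3 / ?S) * real k \<le> real b * real m" using bm by simp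
    moreover have "0 \<le> c - 3 / ?S" using load_pos[OF assms(2), of k] False by (simp add: load_def)
    then have "(c - 3 / ?S) * (real b * real s) \<le> (c - 3 / ?S) * real k"
      using bs by (rule mult_left_mono[rotated])
    ultimately have "(c - 3 / ?S) * (real b * real s) \<le> real b * real m" by linarith
    then have "real b * ((c - 3 / ?S) * real s) \<le> real b * real m" by (simp add: mult_ac)
    then have "(c - 3 / ?S) * real s \<le> real m" using b_pos by simp
    moreover have "u / v \<le> 1 / a" if "a * u \<le> v" "0 < a" "0 < v" for a u v :: real
      using that by (simp add: field_simps)
    moreover have "0 < c - 3 / ?S" using load_pos[OF assms(2), of k] False by (simp add: load_def)
    ultimately show ?thesis using False m by (simp only: load_def if_False)
  qed
  then have "(real b * real s) * (real s / real m) \<le> real k * load c k"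
    using bs by (intro mult_mono) auto
  then show ?thesis by (simp add: power2_eq_square)
qed

text \<open>\<open>ln M = s * ln q\<close>, and the summand 1 for the last round is absorbed because
  the exponential is at least 1.\<close>

lemma R_le: "real R \<le> (1 + sqrt (real k) * ln (4 * real k ^ 2)) * exp (real s ^ 2 / real m)"
proof -
  note four = four_squares[OF k]
  have "real M = (4 * real k ^ 2) ^ s" by (simp only: M_def of_nat_power real_q)
  then have "ln (real M) = real s * ln (4 * real k ^ 2)"
    using four by (simp only: ln_realpow)
  also have "\<dots> \<le> sqrt (real k) * ln (4 * real k ^ 2)"
    using four sqrt_s(1) by (intro mult_right_mono) auto
  finally have "real R \<le> 1 + sqrt (real k) * ln (4 * real k ^ 2) * exp (real s ^ 2 / real m)"
    using rows.rounds_le mult_right_mono[of "ln (real M)" _ "exp (real s ^ 2 / real m)"]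
    unfolding R_eq by (smt (verit) exp_ge_zero)
  also have "\<dots> \<le> exp (real s ^ 2 / real m) + sqrt (real k) * ln (4 * real k ^ 2) * exp (real s ^ 2 / real m)"
    by simp
  finally show ?thesis by (simp add: distrib_right)
qed

text \<open>Raising the bound on \<open>R\<close> to the power \<open>b\<close> turns
  \<open>exp (s^2 / m)\<close> into \<open>exp (b * s^2 / m)\<close>; apart from \<open>k\<close>
  and \<open>l\<close>, only the number of hash functions brings in \<open>n\<close>.\<close>

lemma T_le:
  assumes "real l = c * real k" "1 \<le> c"
  shows "real T \<le> size_bound c k * real (bit_bound n)"
proof -
  note four = four_squares[OF k]
  let ?y = "1 + sqrt (real k) * ln (4 * real k ^ 2)"
  have y: "1 \<le> ?y" using four by simp
  have "real W = real q powr real (b - 1 + r)" using q_pos unfolding W_def of_nat_power by (subst powr_realpow) auto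
  also have "\<dots> \<le> real q powr (3 * sqrt (real k))"
    using b_le_sqrt r_le_sqrt four real_q by (intro powr_mono) auto
  finally have W: "real W \<le> (4 * real k ^ 2) powr (3 * sqrt (real k))" by (simp only: real_q)
  have "real (R ^ b) \<le> (?y * exp (real s ^ 2 / real m)) ^ b"
    using R_le by (simp only: of_nat_power) (intro power_mono, auto)
  also have "\<dots> = ?y powr real b * exp (real b * (real s ^ 2 / real m))"
    using y by (simp only: power_mult_distrib exp_of_nat_mult) (subst powr_realpow, auto)
  also have "\<dots> \<le> ?y powr (2 * sqrt (real k)) * exp (real k * load c k)"
    using y b_le_sqrt load_ge[OF assms] by (intro mult_mono powr_mono) auto
  finally have R: "real (R ^ b) \<le> ?y powr (2 * sqrt (real k)) * exp (real k * load c k)" .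
  have "real T = real q * real (bit_bound n) * real W * real (R ^ b)"
    by (simp add: T_def L_def)
  also have "\<dots> \<le> (4 * real k ^ 2) * real (bit_bound n) * (4 * real k ^ 2) powr (3 * sqrt (real k)) *
     (?y powr (2 * sqrt (real k)) * exp (real k * load c k))"
    using W R by (intro mult_mono) (auto simp: real_q)
  also have "\<dots> = size_bound c k * real (bit_bound n)" by (simp add: size_bound_def)
  finally show ?thesis .
qed

text \<open>Rounding up and the added one cost at most 2, which the binary logarithm absorbs once it
  is at least 1. At \<open>n = 1\<close> the right-hand side would be 0.\<close>

lemma bit_bound_le_ln:
  assumes "2 \<le> n"
  shows "real (bit_bound n) \<le> 3 / ln 2 * ln (real n)"
proof -
  have log: "1 \<le> log 2 (real n)" using assms by simp
  have "real (bit_bound n) \<le> 2 + log 2 (real n)"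
  proof (cases "bit_bound n \<le> 2")
    case False
    then have "2 ^ (bit_bound n - 2) < n" using bit_bound_less[of n] by auto
    then have "(2::real) ^ (bit_bound n - 2) < real n" by (metis of_nat_less_iff of_nat_numeral of_nat_power)
    then have "real (bit_bound n - 2) \<le> log 2 (real n)" by (intro less_imp_le less_log_of_power) auto
    then show ?thesis using False by (simp add: of_nat_diff)
  qed (use log in linarith)
  also have "\<dots> \<le> 3 * log 2 (real n)" using log by simp
  also have "\<dots> = 3 / ln 2 * ln (real n)" by (simp add: log_def)
  finally show ?thesis .
qed

lemma X_le:
  assumes "real l = c * real k" "1 \<le> c"
  shows "real X \<le> memory_bound c k * real n"
proof -
  have "real M = real q powr real s" using q_pos by (simp add: M_def powr_realpow)
  also have "\<dots> \<le> real q powr sqrt (real k)"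
    using sqrt_s(1) four_squares(1)[OF k] real_q by (intro powr_mono) auto
  finally have M: "real M \<le> (4 * real k ^ 2) powr sqrt (real k)" by (simp only: real_q)
  let ?Y = "memory_bound c k"
  have "real X \<le> real n + (?Y - 1)"
    using M assms(1) by (simp add: X_def memory_bound_def)
  also have "\<dots> \<le> real n + (?Y - 1) * real n"
    using n memory_bound_ge[OF assms(2), of k] by (intro add_left_mono mult_le_cancel_left1[THEN iffD2]) auto
  also have "\<dots> = ?Y * real n" by (simp add: algebra_simps)
  finally show ?thesis .
qed

text \<open>The exponent is \<open>614 = 6 * 102 + 2\<close>: \<open>\<beta> ^ 102\<close> is
  \<open>X ^ 612\<close>, one factor \<open>n\<close> is the length of each value table, and one
  comes from \<open>bit_bound n \<le> 2 * n\<close>. The constant is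
  \<open>16 = 2 + 14\<close>.\<close>

lemma time_le:
  assumes "real l = c * real k" "1 \<le> c"
    and D: "size_bound c k * memory_bound c k ^ 612 \<le> real D * 2 ^ (9 * k)"
  shows "(T * n + 14) * \<beta> ^ 102 \<le> 16 * D * 2 ^ (9 * k) * n ^ 614"
proof -
  let ?A = "size_bound c k" and ?Y = "memory_bound c k"
  have A: "1 \<le> ?A" using size_bound_ge_1[OF assms(2) k] .
  have n1: "1 \<le> real n" using n by simp
  have "real T \<le> ?A * (2 * real n)"
    using T_le[OF assms(1,2)] bit_bound_le[of n] A n1
      mult_left_mono[of "real (bit_bound n)" "2 * real n" ?A] by linarith
  then have "real (T * n) \<le> ?A * (2 * real n) * real n"
    using n1 by (simp only: of_nat_mult) (intro mult_right_mono, auto)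
  moreover have "1 * 1 \<le> ?A * (real n * real n)" using A n1 by (intro mult_mono) (auto simp: mult_ge1_I)
  ultimately have "real (T * n + 14) \<le> 16 * ?A * (real n * real n)" by (simp add: mult_ac)
  moreover have "real (\<beta> ^ 102) = real X ^ 612" by (simp add: \<beta>_def flip: power_mult)
  moreover have "real X ^ 612 \<le> (?Y * real n) ^ 612" using X_le[OF assms(1,2)] by (intro power_mono) auto
  ultimately have "real (T * n + 14) * real (\<beta> ^ 102) \<le> (16 * ?A * (real n * real n)) * (?Y * real n) ^ 612"
    using A by (intro mult_mono) auto
  also have "\<dots> = 16 * (?A * ?Y ^ 612) * (real n ^ 612 * (real n * real n))"
    by (simp only: power_mult_distrib mult_ac)
  also have "real n ^ 612 * (real n * real n) = real n ^ 614"
    by (simp flip: power2_eq_square power_add)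
  also have "16 * (?A * ?Y ^ 612) * real n ^ 614 \<le> 16 * (real D * 2 ^ (9 * k)) * real n ^ 614"
    using D by (intro mult_right_mono mult_left_mono) auto
  finally have "real ((T * n + 14) * \<beta> ^ 102) \<le> real (16 * D * 2 ^ (9 * k) * n ^ 614)"
    by (simp only: of_nat_mult of_nat_power of_nat_numeral mult.assoc)
  then show ?thesis by (simp only: of_nat_le_iff)
qed

end

theorem theorem5p5:
  fixes c :: real
  assumes "c \<ge> 1"
  shows "\<exists>(P :: com) (r :: nat \<Rightarrow> real) (C :: real) (D :: nat) (d :: nat).
    r \<longlonglongrightarrow> 0 \<and>
    (\<forall>(n :: nat) (k :: nat) (l :: nat). n \<ge> 1 \<and> k \<ge> 1 \<and> real l = c * real k \<longrightarrow>
      (\<exists>(fs :: (nat \<Rightarrow> nat) list) (t :: nat) (m :: mem).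
         exec P (initial n k l) t (m, value_tables n fs) \<and>
         t \<le> D * 2 ^ (9 * k) * n ^ d \<and>
         splitter n k l (set fs) \<and>
         (n \<ge> 2 \<longrightarrow>
           real (length fs) \<le> C * exp (real k / c * (1 + r k)) * ln (real n))))"
proof -
  \<comment> \<open>Solved from \<open>exp (k / c * (1 + rate k)) = size_bound c k\<close>, so the
    whole \<open>o(1)\<close> claim is the limit of \<open>ln (size_bound c k) / k\<close>.\<close>
  define rate where "rate k = c * (ln (size_bound c k) / real k) - 1" for k
  obtain D where D: "\<And>k. 1 \<le> k \<Longrightarrow> size_bound c k * memory_bound c k ^ 612 \<le> real D * 2 ^ (9 * k)"
    using time_constant[OF assms, of 612] by blast
  have "rate \<longlonglongrightarrow> c * (1 / c) - 1"
    unfolding rate_def by (intro tendsto_intros tendsto_ln_size_bound assms)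
  then have r0: "rate \<longlonglongrightarrow> 0" using assms by simp
  have main: "\<exists>fs t m. exec splitter_program (initial n k l) t (m, value_tables n fs) \<and>
      t \<le> 16 * D * 2 ^ (9 * k) * n ^ 614 \<and> splitter n k l (set fs) \<and>
      (n \<ge> 2 \<longrightarrow> real (length fs) \<le> 3 / ln 2 * exp (real k / c * (1 + rate k)) * ln (real n))"
    if nkl: "n \<ge> 1" "k \<ge> 1" "real l = c * real k" for n k l
  proof -
    have "1 * real k \<le> c * real k" using assms by (intro mult_right_mono) auto
    then have "real k \<le> real l" using nkl(3) by linarith
    then have "k \<le> l" by (simp only: of_nat_le_iff)
    then interpret splitter_parameters n k l
      using nkl by unfold_locales auto
    obtain t m' where exec: "exec splitter_program (initial n k l) t (m', value_tables n family)"
      "t \<le> (T * n + 14) * \<beta> ^ 102" using exec_splitter_program by blast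
    have "t \<le> 16 * D * 2 ^ (9 * k) * n ^ 614"
      using exec(2) time_le[OF nkl(3) assms D[OF nkl(2)]] by (rule order_trans)
    moreover have "real (length family) \<le> 3 / ln 2 * exp (real k / c * (1 + rate k)) * ln (real n)" if "n \<ge> 2"
    proof -
      have A: "1 \<le> size_bound c k" using size_bound_ge_1[OF assms nkl(2)] .
      have "real k / c * (1 + rate k) = ln (size_bound c k)" using nkl(2) assms by (simp add: rate_def)
      then have e: "exp (real k / c * (1 + rate k)) = size_bound c k" using A by simp
      have "real (length family) \<le> size_bound c k * real (bit_bound n)"
        using T_le[OF nkl(3) assms] by (simp add: family_def)
      also have "\<dots> \<le> size_bound c k * (3 / ln 2 * ln (real n))"
        using bit_bound_le_ln[OF that] A by (intro mult_left_mono) auto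
      finally show ?thesis unfolding e by (simp add: mult_ac)
    qed
    ultimately show ?thesis using exec(1) splitter_family by blast
  qed
  show ?thesis
    by (rule exI[of _ splitter_program], rule exI[of _ rate], rule exI[of _ "3 / ln 2"],
        rule exI[of _ "16 * D"], rule exI[of _ 614]) (use r0 main in blast)
qed

end
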